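(* Let $\Omega\subset\mathbb{R}^2$ be open and bounded with Lipschitz boundary, let $0<\gamma<\infty$, let $\rho$ and $I$ be as in the context, let $u_0\in W^{1,2}(\Omega,\mathbb{R}^2)$, and let $u\in\mathcal{A}_{u_0}$ be a stationary point of $I$. Then there exists $\alpha=\alpha(\gamma)\in(0,1)$ such that $u\in C^{0,\alpha}_{loc}(\Omega,\mathbb{R}^2)$.
   Context: Fix constants $\gamma>0$, $s_0\ge 0$, $\kappa\ge-\gamma s_0$. Let $\rho\in C^\infty(\mathbb{R})$ be convex with $\rho(s)=0$ for $s\le 0$, $\rho(s)=\gamma s+\kappa$ for $s\ge s_0$, and $\rho=\rho_1$ on $[0,s_0]$ where $\rho_1$ is smooth and convex with $\rho_1(0)=0$, $\rho_1(s_0)=\gamma s_0+\kappa$ (the pieces joined so that $\rho$ is smooth). In particular $0\le\rho'\le\gamma$. For $A\in\mathbb{R}^{2\times 2}$, $\operatorname{cof}A=\begin{pmatrix}a_{22}&-a_{21}\\-a_{12}&a_{11}\end{pmatrix}$, and $|\cdot|$ and $\cdot$ are the Frobenius norm and inner product. The functional is $I(u)=\int_\Omega \tfrac12|\nabla u|^2+\rho(\det\nabla u)\,dx$ for $u\in W^{1,2}(\Omega,\mathbb{R}^2)$. The admissible class is $\mathcal{A}_{u_0}=\{u\in W^{1,2}(\Omega,\mathbb{R}^2): u=u_0 \text{ on }\partial\Omega \text{ in the trace sense}\}$. A stationary point is $u\in\mathcal{A}_{u_0}$ with $\int_\Omega(\nabla u+\rho'(\det\nabla u)\operatorname{cof}\nabla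 u)\cdot\nabla\varphi\,dx=0$ for all $\varphi\in W^{1,2}_0(\Omega,\mathbb{R}^2)$. *)

theory Defs
  imports "HOL-Analysis.Analysis"
begin

text \<open>Points of the plane are \<open>real^2\<close>; 2x2 matrices are \<open>real^2^2\<close>,
  with \<open>A $ i $ j\<close> the entry in row i, column j. For a map \<open>u\<close> into the plane
  the gradient has entries \<open>(Du x) $ i $ j = \<partial>_j u_i\<close>.\<close>

coinductive smooth_fun :: "('a::euclidean_space \<Rightarrow> real) \<Rightarrow> bool" where
  "(\<forall>x. f differentiable (at x)) \<Longrightarrow>
   (\<forall>b\<in>Basis. smooth_fun (\<lambda>x. frechet_derivative f (at x) b)) \<Longrightarrow> smooth_fun f"

definition pderiv2 :: "(real^2 \<Rightarrow> real) \<Rightarrow> 2 \<Rightarrow> real^2 \<Rightarrow> real" where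
  "pderiv2 f j x = frechet_derivative f (at x) (axis j 1)"

definition grad2 :: "(real^2 \<Rightarrow> real^2) \<Rightarrow> real^2 \<Rightarrow> real^2^2" where
  "grad2 v x = (\<chi> i j. pderiv2 (\<lambda>y. v y $ i) j x)"

definition test_fun :: "(real^2) set \<Rightarrow> (real^2 \<Rightarrow> real) \<Rightarrow> bool" where
  "test_fun \<Omega> \<phi> \<longleftrightarrow> smooth_fun \<phi> \<and> compact (closure {x. \<phi> x \<noteq> 0})
      \<and> closure {x. \<phi> x \<noteq> 0} \<subseteq> \<Omega>"

definition test_fun2 :: "(real^2) set \<Rightarrow> (real^2 \<Rightarrow> real^2) \<Rightarrow> bool" where
  "test_fun2 \<Omega> \<psi> \<longleftrightarrow> (\<forall>i. test_fun \<Omega> (\<lambda>x. \<psi> x $ i))"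

definition L2_on :: "(real^2) set \<Rightarrow> (real^2 \<Rightarrow> 'b::euclidean_space) \<Rightarrow> bool" where
  "L2_on \<Omega> f \<longleftrightarrow> set_borel_measurable lebesgue \<Omega> f
      \<and> set_integrable lebesgue \<Omega> (\<lambda>x. (norm (f x))\<^sup>2)"

definition weak_grad :: "(real^2) set \<Rightarrow> (real^2 \<Rightarrow> real^2) \<Rightarrow> (real^2 \<Rightarrow> real^2^2) \<Rightarrow> bool" where
  "weak_grad \<Omega> u Du \<longleftrightarrow> (\<forall>\<phi>. test_fun \<Omega> \<phi> \<longrightarrow> (\<forall>i j.
      (LINT x:\<Omega>|lebesgue. u x $ i * pderiv2 \<phi> j x) = - (LINT x:\<Omega>|lebesgue. Du x $ i $ j * \<phi> x)))"

definition W12 :: "(real^2) set \<Rightarrow> (real^2 \<Rightarrow> real^2) \<Rightarrow> (real^2 \<Rightarrow> real^2^2) \<Rightarrow> bool" where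
  "W12 \<Omega> u Du \<longleftrightarrow> L2_on \<Omega> u \<and> L2_on \<Omega> Du \<and> weak_grad \<Omega> u Du"

definition W012 :: "(real^2) set \<Rightarrow> (real^2 \<Rightarrow> real^2) \<Rightarrow> (real^2 \<Rightarrow> real^2^2) \<Rightarrow> bool" where
  "W012 \<Omega> v Dv \<longleftrightarrow> W12 \<Omega> v Dv \<and> (\<exists>\<psi> :: nat \<Rightarrow> real^2 \<Rightarrow> real^2.
      (\<forall>k. test_fun2 \<Omega> (\<psi> k)) \<and>
      (\<lambda>k. LINT x:\<Omega>|lebesgue. (norm (\<psi> k x - v x))\<^sup>2 + (norm (grad2 (\<psi> k) x - Dv x))\<^sup>2)
        \<longlonglongrightarrow> 0)"

definition same_trace :: "(real^2) set \<Rightarrow> (real^2 \<Rightarrow> real^2) \<Rightarrow> (real^2 \<Rightarrow> real^2^2)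
    \<Rightarrow> (real^2 \<Rightarrow> real^2) \<Rightarrow> (real^2 \<Rightarrow> real^2^2) \<Rightarrow> bool" where
  "same_trace \<Omega> u Du u0 Du0 \<longleftrightarrow> W012 \<Omega> (\<lambda>x. u x - u0 x) (\<lambda>x. Du x - Du0 x)"

definition frob :: "real^2^2 \<Rightarrow> real^2^2 \<Rightarrow> real" where
  "frob A B = (\<Sum>i\<in>UNIV. \<Sum>j\<in>UNIV. A $ i $ j * B $ i $ j)"

definition cof2 :: "real^2^2 \<Rightarrow> real^2^2" where
  "cof2 A = (\<chi> i j. if i = 1 \<and> j = 1 then A $ 2 $ 2
                     else if i = 1 \<and> j = 2 then - A $ 2 $ 1
                     else if i = 2 \<and> j = 1 then - A $ 1 $ 2
                     else A $ 1 $ 1)"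

text \<open>Stationary point of \<open>I(u) = \<integral> |\<nabla>u|^2/2 + \<rho>(det \<nabla>u)\<close>.\<close>
definition stationary :: "(real \<Rightarrow> real) \<Rightarrow> (real^2) set \<Rightarrow> (real^2 \<Rightarrow> real^2) \<Rightarrow> (real^2 \<Rightarrow> real^2^2) \<Rightarrow> bool" where
  "stationary \<rho> \<Omega> u Du \<longleftrightarrow> (\<forall>\<phi> D\<phi>. W012 \<Omega> \<phi> D\<phi> \<longrightarrow>
     (LINT x:\<Omega>|lebesgue. frob (Du x + deriv \<rho> (det (Du x)) *\<^sub>R cof2 (Du x)) (D\<phi> x)) = 0)"

definition lipschitz_boundary :: "(real^2) set \<Rightarrow> bool" where
  "lipschitz_boundary \<Omega> \<longleftrightarrow> (\<forall>p\<in>frontier \<Omega>. \<exists>R r h L (g :: real \<Rightarrow> real).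
      orthogonal_matrix R \<and> r > 0 \<and> h > 0 \<and>
      (\<forall>s t. \<bar>g s - g t\<bar> \<le> L * \<bar>s - t\<bar>) \<and> g 0 = 0 \<and>
      (\<forall>t. \<bar>t\<bar> < r \<longrightarrow> \<bar>g t\<bar> < h / 2) \<and>
      (\<forall>x. let y = R *v (x - p) in
           \<bar>y $ 1\<bar> < r \<and> \<bar>y $ 2\<bar> < h \<longrightarrow> (x \<in> \<Omega> \<longleftrightarrow> y $ 2 < g (y $ 1))))"

definition holder_loc :: "real \<Rightarrow> (real^2) set \<Rightarrow> (real^2 \<Rightarrow> real^2) \<Rightarrow> bool" where
  "holder_loc \<alpha> \<Omega> v \<longleftrightarrow> continuous_on \<Omega> v \<and> (\<forall>K. compact K \<and> K \<subseteq> \<Omega> \<longrightarrow>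
      (\<exists>C. \<forall>x\<in>K. \<forall>y\<in>K. dist (v x) (v y) \<le> C * dist x y powr \<alpha>))"

end

theory Submission
  imports Defs
begin

text \<open>Testing the Euler equation with \<open>\<eta>\<^sup>2 (u - a)\<close> and using
  \<open>cof A \<cdot> A = 2 det A\<close> produces the term \<open>2 \<rho>'(det \<nabla>u) det \<nabla>u\<close>, which is nonnegative because
  \<open>\<rho>'\<close> is nonnegative and vanishes on the negative axis. Hence, although \<open>\<gamma>\<close> may be large, a Caccioppoli
  inequality holds whose right-hand side lives on an annulus. The Poincare inequality on the annulus turns it
  into Widman's hole-filling estimate: the Dirichlet integral over a square of half-side \<open>r\<close> is at most
  \<open>\<theta>\<close> times the one over the concentric square of half-side \<open>3 r\<close>, with \<open>\<theta> < 1\<close> depending only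
  on \<open>\<gamma>\<close>. So Dirichlet integrals decay like a power of \<open>r\<close>, and in the plane this gives Hoelder
  continuity by comparing averages of \<open>u\<close> over small squares. Squares are used instead of discs since the
  annulus between two of them is a union of four overlapping rectangles, so that only the
  Poincare inequality on convex sets is needed.\<close>

subsection \<open>Smooth functions\<close>

text \<open>For \<gamma> > 1 the functional is not convex and the equation is no small perturbation
  of Laplace's, so everything rests on the sign of \<rho>'(d) d. Since \<alpha> may depend on
  \<gamma> alone, every constant that enters \<theta> has to be free of centre, scale and domain:
  cutoffs are rescalings of one profile, and the Poincare constants are explicit multiples of powers
  of r. If D(r) <= M (D(3r) - D(r)) for the Dirichlet integrals, adding M D(r) fills the hole and
  gives \<theta> = M / (M + 1); then \<alpha> solves 3^(-2 \<alpha>) = \<theta>. Two technical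
  points shape the rest. The test map is a cutoff times a Sobolev map, so its admissibility in the
  sense of \<open>W012\<close> requires approximation by test functions; this is why mollification
  is developed for functions that are merely square-integrable. And u is given only up to null sets,
  so the continuous representative has to be constructed: it is the limit of averages over shrinking
  squares with corner x, which the decay makes converge at every point of \<Omega>.\<close>

text \<open>The functions generated by \<open>S\<close> under the ring operations. If partial derivatives do not leave this
  algebra, it serves as the bisimulation in a coinductive proof of smoothness.\<close>

inductive fun_alg :: "(('a \<Rightarrow> real) \<Rightarrow> bool) \<Rightarrow> ('a \<Rightarrow> real) \<Rightarrow> bool" for S where
  gen: "S f \<Longrightarrow> fun_alg S f"
| const: "fun_alg S (\<lambda>x. c)"
| add: "fun_alg S f \<Longrightarrow> fun_alg S g \<Longrightarrow> fun_alg S (\<lambda>x. f x + g x)"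
| mult: "fun_alg S f \<Longrightarrow> fun_alg S g \<Longrightarrow> fun_alg S (\<lambda>x. f x * g x)"

lemma frechet_derivative_eqI:
  "(f has_derivative f') (at x) \<Longrightarrow> frechet_derivative f (at x) = f'"
  using frechet_derivative_at by metis

lemma differentiable_imp_has_derivative:
  "f differentiable (at x) \<Longrightarrow> (f has_derivative frechet_derivative f (at x)) (at x)"
  by (simp add: frechet_derivative_works[symmetric])

lemma smooth_fun_fun_alg:
  fixes f :: "'a::euclidean_space \<Rightarrow> real"
  assumes S: "\<And>f x. S f \<Longrightarrow> f differentiable (at x)"
    and D: "\<And>f b. S f \<Longrightarrow> b \<in> Basis \<Longrightarrow> fun_alg S (\<lambda>x. frechet_derivative f (at x) b)"
    and f: "fun_alg S f"
  shows "smooth_fun f"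
proof -
  have step: "(\<forall>x. f differentiable (at x)) \<and>
      (\<forall>b\<in>Basis. fun_alg S (\<lambda>x. frechet_derivative f (at x) b))"
    if "fun_alg S f" for f
    using that
  proof induction
    case (gen f)
    then show ?case using S D by auto
  next
    case (const c)
    then show ?case by (auto intro: fun_alg.const)
  next
    case (add f g)
    have "frechet_derivative (\<lambda>x. f x + g x) (at x) =
        (\<lambda>b. frechet_derivative f (at x) b + frechet_derivative g (at x) b)" for x
      by (intro frechet_derivative_eqI has_derivative_add differentiable_imp_has_derivative)
        (use add.IH in auto)
    then show ?case using add by (auto intro!: fun_alg.add differentiable_add)
  next
    case (mult f g)
    have "frechet_derivative (\<lambda>x. f x * g x) (at x) =
        (\<lambda>b. f x * frechet_derivative g (at x) b + frechet_derivative f (at x) b * g x)" for x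
      by (intro frechet_derivative_eqI has_derivative_mult differentiable_imp_has_derivative)
        (use mult.IH in auto)
    then show ?case using mult by (auto intro!: fun_alg.add fun_alg.mult differentiable_mult)
  qed
  show ?thesis
    using f by (coinduction arbitrary: f) (use step in blast)
qed

lemma smooth_fun_differentiable: "smooth_fun f \<Longrightarrow> f differentiable (at x)"
  by (erule smooth_fun.cases) auto

lemma smooth_fun_frechet:
  "smooth_fun f \<Longrightarrow> b \<in> Basis \<Longrightarrow> smooth_fun (\<lambda>x. frechet_derivative f (at x) b)"
  by (erule smooth_fun.cases) auto

text \<open>With the smooth functions themselves as generators, the bisimulation becomes closure of
  smoothness under sums and products.\<close>

lemma smooth_fun_alg_closed: "fun_alg smooth_fun f \<Longrightarrow> smooth_fun f"
  by (rule smooth_fun_fun_alg[where S = smooth_fun])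
    (auto intro: fun_alg.gen smooth_fun_differentiable smooth_fun_frechet)

lemma smooth_fun_const [simp]: "smooth_fun (\<lambda>x. c)"
  by (intro smooth_fun_alg_closed fun_alg.const)

lemma smooth_fun_mult: "smooth_fun f \<Longrightarrow> smooth_fun g \<Longrightarrow> smooth_fun (\<lambda>x. f x * g x)"
  by (intro smooth_fun_alg_closed fun_alg.mult) (auto intro: fun_alg.gen)

lemma smooth_fun_has_derivative:
  "smooth_fun f \<Longrightarrow> (f has_derivative frechet_derivative f (at x)) (at x)"
  by (simp add: differentiable_imp_has_derivative smooth_fun_differentiable)

lemma smooth_fun_continuous: "smooth_fun f \<Longrightarrow> continuous_on S f"
  by (meson differentiable_imp_continuous_within continuous_at_imp_continuous_on
      smooth_fun_differentiable)

text \<open>Each differentiation pulls out a factor s, so the coinduction invariant consists of the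
  functions k g(s x + c) with g smooth and k a free scalar.\<close>

lemma smooth_fun_affine:
  fixes f :: "'a::euclidean_space \<Rightarrow> real"
  assumes "smooth_fun f"
  shows "smooth_fun (\<lambda>x. f (s *\<^sub>R x + c))"
proof -
  have der: "((\<lambda>x. g (s *\<^sub>R x + c)) has_derivative
      (\<lambda>h. frechet_derivative g (at (s *\<^sub>R x + c)) (s *\<^sub>R h))) (at x)"
    if "smooth_fun g" for g :: "'a \<Rightarrow> real" and x
    by (rule has_derivative_compose[where g = g]) (auto intro!: derivative_eq_intros smooth_fun_has_derivative that)
  have "smooth_fun f'" if "\<exists>g k. smooth_fun g \<and> f' = (\<lambda>x. k * g (s *\<^sub>R x + c))" for f'
    using that
  proof (coinduction arbitrary: f')
    case smooth_fun
    then obtain g k where g: "smooth_fun g" "f' = (\<lambda>x. k * g (s *\<^sub>R x + c))" by auto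
    have d: "(f' has_derivative (\<lambda>h. k * frechet_derivative g (at (s *\<^sub>R x + c)) (s *\<^sub>R h))) (at x)" for x
      unfolding g(2) by (intro has_derivative_mult_right der g(1))
    have lin: "frechet_derivative g (at y) (s *\<^sub>R h) = s * frechet_derivative g (at y) h" for y h
      using has_derivative_linear[OF smooth_fun_has_derivative[OF g(1)]] by (simp add: linear_cmul)
    have "frechet_derivative f' (at x) b = (k * s) * frechet_derivative g (at (s *\<^sub>R x + c)) b" for x b
      unfolding frechet_derivative_eqI[OF d] lin by simp
    then have "\<exists>h l. smooth_fun h \<and> (\<lambda>x. frechet_derivative f' (at x) b) = (\<lambda>x. l * h (s *\<^sub>R x + c))"
      if "b \<in> Basis" for b
      using smooth_fun_frechet[OF g(1) that] by (intro exI conjI) auto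
    moreover have "f' differentiable (at x)" for x
      using d unfolding differentiable_def by blast
    ultimately show ?case by blast
  qed
  moreover have "\<exists>g k. smooth_fun g \<and> (\<lambda>x. f (s *\<^sub>R x + c)) = (\<lambda>x. k * g (s *\<^sub>R x + c))"
    using assms by (intro exI[of _ f] exI[of _ 1]) auto
  ultimately show ?thesis by blast
qed

text \<open>This family of functions, which contains \<open>exp (- 1 / t)\<close>, is closed under differentiation.\<close>

definition flat_fun :: "real poly \<Rightarrow> real \<Rightarrow> real" where
  "flat_fun p t = (if t > 0 then poly p (1 / t) * exp (- (1 / t)) else 0)"

text \<open>With x = 1/t this is the fact that the exponential outgrows every polynomial at
  infinity.\<close>

lemma flat_fun_tendsto_0: "((\<lambda>t::real. poly p (1 / t) * exp (- (1 / t))) \<longlongrightarrow> 0) (at_right 0)"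
proof -
  have "((\<lambda>x::real. poly p x * exp (- x)) \<longlongrightarrow> 0) at_top"
  proof (induction p)
    case 0
    then show ?case by simp
  next
    case (pCons a p)
    have "((\<lambda>x::real. x * poly p x * exp (- x)) \<longlongrightarrow> 0) at_top"
    proof -
      have "((\<lambda>x::real. (\<Sum>i\<le>degree p. coeff p i * (x ^ Suc i / exp x))) \<longlongrightarrow> (\<Sum>i\<le>degree p. coeff p i * 0)) at_top"
        by (intro tendsto_intros tendsto_power_div_exp_0)
      then show ?thesis
        by (simp add: poly_altdef sum_distrib_left sum_distrib_right exp_minus divide_inverse mult_ac)
    qed
    moreover have "((\<lambda>x::real. a * exp (- x)) \<longlongrightarrow> a * 0) at_top"
      by (intro tendsto_intros filterlim_compose[OF exp_at_bot] filterlim_uminus_at_bot_at_top)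
    ultimately have "((\<lambda>x::real. a * exp (- x) + x * poly p x * exp (- x)) \<longlongrightarrow> a * 0 + 0) at_top"
      by (intro tendsto_add) auto
    then show ?case by (simp add: algebra_simps)
  qed
  then have "((\<lambda>x. poly p (inverse x) * exp (- (inverse x))) \<longlongrightarrow> 0) (at_right 0)"
    by (rule filterlim_compose) (rule filterlim_inverse_at_top_right)
  then show ?thesis by (simp add: divide_inverse)
qed

text \<open>For t > 0 the derivative is t^(-2) (p(1/t) - p'(1/t)) exp(-1/t), and prefixing two zero
  coefficients multiplies a polynomial by the square of its variable.\<close>

lemma flat_fun_has_derivative:
  "(flat_fun p has_real_derivative flat_fun (pCons 0 (pCons 0 (p - pderiv p))) t) (at t)"
proof -
  consider "t > 0" | "t < 0" | "t = 0" by linarith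
  then show ?thesis
  proof cases
    case 1
    have "((\<lambda>t. poly p (1 / t) * exp (- (1 / t))) has_real_derivative
        flat_fun (pCons 0 (pCons 0 (p - pderiv p))) t) (at t)"
      using 1 by (auto intro!: derivative_eq_intros DERIV_chain2[OF poly_DERIV]
          simp: flat_fun_def field_simps power2_eq_square)
    then show ?thesis
      by (rule has_field_derivative_transform_within_open[where S = "{0<..}"])
        (use 1 in \<open>auto simp: flat_fun_def\<close>)
  next
    case 2
    have "((\<lambda>t. 0) has_real_derivative flat_fun (pCons 0 (pCons 0 (p - pderiv p))) t) (at t)"
      using 2 by (simp add: flat_fun_def)
    then show ?thesis
      by (rule has_field_derivative_transform_within_open[where S = "{..<0}"])
        (use 2 in \<open>auto simp: flat_fun_def\<close>)
  next
    case 3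
    have "((\<lambda>h. flat_fun p h / h) \<longlongrightarrow> 0) (at 0)"
      unfolding filterlim_at_split
    proof
      show "((\<lambda>h. flat_fun p h / h) \<longlongrightarrow> 0) (at_left 0)"
        by (rule tendsto_eventually)
          (auto simp: flat_fun_def eventually_at_filter)
      \<comment> \<open>Dividing by h multiplies the polynomial by its variable 1/h, so the right
        difference quotient at 0 is again of the flat form.\<close>
      have "((\<lambda>t. poly (pCons 0 p) (1 / t) * exp (- (1 / t))) \<longlongrightarrow> 0) (at_right 0)"
        by (rule flat_fun_tendsto_0)
      then show "((\<lambda>h. flat_fun p h / h) \<longlongrightarrow> 0) (at_right 0)"
        by (rule Lim_transform_eventually)
          (auto simp: flat_fun_def eventually_at_filter)
    qed
    then show ?thesis using 3 by (simp add: DERIV_def flat_fun_def)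
  qed
qed

text \<open>The classical mollifier profile exp(-1 / (r^2 - |x|^2)), extended by 0; \<open>1\<close>
  is the constant polynomial.\<close>

definition bump :: "real \<Rightarrow> 'a::euclidean_space \<Rightarrow> real" where
  "bump r x = flat_fun 1 (r\<^sup>2 - x \<bullet> x)"

text \<open>The chain rule for r^2 - |x|^2 produces a factor linear in x, which is why linear
  functionals join the flat functions as generators.\<close>

lemma smooth_fun_bump: "smooth_fun (bump r :: 'a::euclidean_space \<Rightarrow> real)"
proof -
  define S :: "('a \<Rightarrow> real) \<Rightarrow> bool" where
    "S f \<longleftrightarrow> (\<exists>p. f = (\<lambda>x. flat_fun p (r\<^sup>2 - x \<bullet> x))) \<or> (\<exists>v. f = (\<lambda>x. x \<bullet> v))" for f
  have d1: "((\<lambda>x. flat_fun p (r\<^sup>2 - x \<bullet> x)) has_derivative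
      (\<lambda>h. (- 2) * ((x \<bullet> h) * flat_fun (pCons 0 (pCons 0 (p - pderiv p))) (r\<^sup>2 - x \<bullet> x)))) (at x)"
    for p and x :: 'a
    by (rule has_derivative_eq_rhs[OF has_derivative_compose[OF _
          flat_fun_has_derivative[unfolded has_field_derivative_def]]])
      (auto intro!: derivative_eq_intros simp: inner_commute algebra_simps)
  have d2: "((\<lambda>x. x \<bullet> v) has_derivative (\<lambda>h. h \<bullet> v)) (at x)" for v x :: 'a
    by (auto intro!: derivative_eq_intros)
  show ?thesis
  proof (rule smooth_fun_fun_alg[where S = S])
    show "f differentiable at x" if "S f" for f x
      using that d1 d2 unfolding S_def differentiable_def by blast
    have S1: "fun_alg S (\<lambda>x. flat_fun p (r\<^sup>2 - x \<bullet> x))" "fun_alg S (\<lambda>x. x \<bullet> v)" for p v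
      by (auto intro!: fun_alg.gen simp: S_def)
    show "fun_alg S (\<lambda>x. frechet_derivative f (at x) b)" if "S f" for f b
    proof -
      have "(\<exists>p. f = (\<lambda>x. flat_fun p (r\<^sup>2 - x \<bullet> x))) \<or> (\<exists>v. f = (\<lambda>x. x \<bullet> v))"
        using that unfolding S_def .
      then show ?thesis
    proof (elim disjE exE)
      fix p assume "f = (\<lambda>x. flat_fun p (r\<^sup>2 - x \<bullet> x))"
      then show ?thesis
        by (simp only: frechet_derivative_eqI[OF d1]) (intro fun_alg.mult fun_alg.const S1)
    next
      fix v assume "f = (\<lambda>x. x \<bullet> v)"
      then show ?thesis
        by (simp only: frechet_derivative_eqI[OF d2] fun_alg.const)
    qed
    qed
    show "fun_alg S (bump r)"
      by (rule fun_alg.gen) (auto simp: S_def bump_def fun_eq_iff)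
  qed
qed

lemma bump_nonneg: "bump r x \<ge> 0"
  by (simp add: bump_def flat_fun_def)

lemma bump_pos_iff: "r > 0 \<Longrightarrow> bump r x > 0 \<longleftrightarrow> norm x < r"
  by (simp add: bump_def flat_fun_def power2_norm_eq_inner[symmetric] abs_square_less_1 power2_less_imp_less)
    (metis norm_ge_zero less_imp_le power2_less_imp_less power_strict_mono zero_less_numeral)

lemma bump_eq_0: "norm x \<ge> r \<Longrightarrow> r \<ge> 0 \<Longrightarrow> bump r x = 0"
  by (auto simp: bump_def flat_fun_def power2_norm_eq_inner[symmetric] not_less)

subsection \<open>Test functions\<close>

lemma test_fun_smooth: "test_fun \<Omega> \<phi> \<Longrightarrow> smooth_fun \<phi>"
  by (simp add: test_fun_def)

lemma test_fun_mono: "test_fun \<Omega> \<phi> \<Longrightarrow> \<Omega> \<subseteq> \<Omega>' \<Longrightarrow> test_fun \<Omega>' \<phi>"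
  by (auto simp: test_fun_def)

lemma test_fun_UNIV: "test_fun \<Omega> \<phi> \<Longrightarrow> test_fun UNIV \<phi>"
  by (erule test_fun_mono) simp

lemma test_fun_support:
  assumes "smooth_fun \<phi>" "compact K" "K \<subseteq> \<Omega>" "\<And>x. x \<notin> K \<Longrightarrow> \<phi> x = 0"
  shows "test_fun \<Omega> \<phi>"
proof -
  have "closure {x. \<phi> x \<noteq> 0} \<subseteq> K"
    using assms by (intro closure_minimal compact_imp_closed) auto
  moreover have "compact (closure {x. \<phi> x \<noteq> 0})"
    using calculation assms(2) by (meson closed_closure compact_Int_closed compact_closure
        bounded_subset compact_imp_bounded closure_subset order.trans)
  ultimately show ?thesis using assms unfolding test_fun_def by auto
qed

lemma test_fun_mult_left:
  assumes "test_fun \<Omega> \<phi>" "smooth_fun f" shows "test_fun \<Omega> (\<lambda>x. \<phi> x * f x)"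
  using assms closure_subset[of "{x. \<phi> x \<noteq> 0}"] unfolding test_fun_def
  by (intro test_fun_support[unfolded test_fun_def, where K = "closure {x. \<phi> x \<noteq> 0}"] smooth_fun_mult) auto

lemma frechet_derivative_eq_sum:
  assumes "smooth_fun f"
  shows "frechet_derivative f (at x) h = (\<Sum>j\<in>UNIV. h $ j * pderiv2 f j x)"
proof -
  have lin: "linear (frechet_derivative f (at x))"
    using has_derivative_linear[OF smooth_fun_has_derivative[OF assms]] .
  have "h = (\<Sum>j\<in>UNIV. h $ j *\<^sub>R axis j 1)"
    by (simp add: vec_eq_iff axis_def if_distrib cong: if_cong)
  then have "frechet_derivative f (at x) h = frechet_derivative f (at x) (\<Sum>j\<in>UNIV. h $ j *\<^sub>R axis j 1)"
    by simp
  also have "\<dots> = (\<Sum>j\<in>UNIV. h $ j * pderiv2 f j x)"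
    by (simp add: linear_sum[OF lin] linear_cmul[OF lin] pderiv2_def)
  finally show ?thesis .
qed

lemma pderiv2_eqI:
  assumes "(f has_derivative f') (at x)" shows "pderiv2 f j x = f' (axis j 1)"
  unfolding pderiv2_def frechet_derivative_eqI[OF assms] ..

lemma smooth_fun_pderiv2: "smooth_fun f \<Longrightarrow> smooth_fun (pderiv2 f j)"
  using smooth_fun_frechet[of f "axis j 1"] by (simp add: pderiv2_def[abs_def] axis_in_Basis_iff)

lemma pderiv2_eq_0:
  assumes "open U" "x \<in> U" "\<And>y. y \<in> U \<Longrightarrow> f y = c"
  shows "pderiv2 f j x = 0"
proof -
  have "((\<lambda>y. c) has_derivative (\<lambda>h. 0)) (at x)" by simp
  then have "(f has_derivative (\<lambda>h. 0)) (at x)"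
    by (rule has_derivative_transform_within_open[OF _ assms(1,2)]) (simp add: assms(3))
  from pderiv2_eqI[OF this] show ?thesis by simp
qed

lemma test_fun_pderiv2:
  assumes "test_fun \<Omega> \<phi>" shows "test_fun \<Omega> (pderiv2 \<phi> j)"
proof (rule test_fun_support[where K = "closure {x. \<phi> x \<noteq> 0}"])
  fix x assume "x \<notin> closure {x. \<phi> x \<noteq> 0}"
  then show "pderiv2 \<phi> j x = 0"
    using closure_subset[of "{x. \<phi> x \<noteq> 0}"]
    by (intro pderiv2_eq_0[of "- closure {x. \<phi> x \<noteq> 0}" _ _ 0]) auto
qed (use assms in \<open>auto simp: test_fun_def intro: smooth_fun_pderiv2\<close>)

lemma pderiv2_mult:
  assumes "smooth_fun f" "smooth_fun g"
  shows "pderiv2 (\<lambda>x. f x * g x) j x = pderiv2 f j x * g x + f x * pderiv2 g j x"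
  using pderiv2_eqI[OF has_derivative_mult[OF smooth_fun_has_derivative[OF assms(1)] smooth_fun_has_derivative[OF assms(2)]]]
  by (simp add: pderiv2_def)

lemma smooth_fun_borel [measurable_dest]: "smooth_fun f \<Longrightarrow> f \<in> borel_measurable borel"
  by (intro borel_measurable_continuous_onI smooth_fun_continuous)

lemma test_fun_bounded:
  assumes "test_fun \<Omega> \<phi>" obtains B where "B > 0" "\<And>x. \<bar>\<phi> x\<bar> \<le> B"
proof -
  have "bounded (\<phi> ` closure {x. \<phi> x \<noteq> 0})"
    using assms by (intro compact_imp_bounded compact_continuous_image smooth_fun_continuous)
      (auto simp: test_fun_def)
  then obtain B where B: "B > 0" "\<And>x. x \<in> closure {x. \<phi> x \<noteq> 0} \<Longrightarrow> \<bar>\<phi> x\<bar> \<le> B"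
    by (auto simp: bounded_pos)
  moreover have "\<bar>\<phi> x\<bar> \<le> B" for x
    using B closure_subset[of "{x. \<phi> x \<noteq> 0}"] by (cases "\<phi> x = 0") auto
  ultimately show ?thesis using that by blast
qed

lemma frechet_bound:
  assumes "smooth_fun f" "\<And>j. \<bar>pderiv2 f j x\<bar> \<le> B"
  shows "\<bar>frechet_derivative f (at x) h\<bar> \<le> 2 * B * norm h"
proof -
  have "\<bar>frechet_derivative f (at x) h\<bar> \<le> (\<Sum>j\<in>UNIV. \<bar>h $ j * pderiv2 f j x\<bar>)"
    unfolding frechet_derivative_eq_sum[OF assms(1)] by (rule sum_abs)
  also have "\<dots> \<le> (\<Sum>j\<in>(UNIV::2 set). norm h * B)"
    using assms(2) by (intro sum_mono) (auto simp: abs_mult component_le_norm_cart intro!: mult_mono)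
  finally show ?thesis by (simp add: mult_ac)
qed

lemma test_fun_Lipschitz:
  assumes "test_fun \<Omega> \<phi>" obtains L where "L > 0" "\<And>x y. \<bar>\<phi> x - \<phi> y\<bar> \<le> L * norm (x - y)"
proof -
  have "\<exists>B>0. \<forall>x. \<bar>pderiv2 \<phi> j x\<bar> \<le> B" for j
    using test_fun_bounded[OF test_fun_pderiv2[OF assms, of j]] by metis
  then obtain B where B: "\<And>j. B j > 0" "\<And>j x. \<bar>pderiv2 \<phi> j x\<bar> \<le> B j"
    by metis
  have sm: "smooth_fun \<phi>" using assms by (rule test_fun_smooth)
  have BB: "\<bar>pderiv2 \<phi> j x\<bar> \<le> B 1 + B 2" for j x
    using B(2)[of j x] B(1)[of 1] B(1)[of 2] exhaust_2[of j] by auto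
  have "norm (\<phi> x - \<phi> y) \<le> (2 * (B 1 + B 2)) * norm (x - y)" for x y
  proof (rule differentiable_bound[where S = UNIV])
    show "(\<phi> has_derivative frechet_derivative \<phi> (at z)) (at z within UNIV)" for z
      using smooth_fun_has_derivative[OF sm] by auto
    show "onorm (frechet_derivative \<phi> (at z)) \<le> 2 * (B 1 + B 2)" for z
      by (rule onorm_le) (use frechet_bound[OF sm BB] in auto)
  qed auto
  then show ?thesis
    using that[of "2 * (B 1 + B 2)"] B(1)[of 1] B(1)[of 2] by auto
qed

text \<open>A remainder bound with one constant for all x allows differentiation under the integral
  sign by a direct estimate.\<close>

lemma test_fun_Taylor:
  assumes "test_fun \<Omega> \<phi>"
  obtains L where "L > 0"
    "\<And>x h. \<bar>\<phi> (x + h) - \<phi> x - frechet_derivative \<phi> (at x) h\<bar> \<le> L * (norm h)\<^sup>2"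
proof -
  have sm: "smooth_fun \<phi>" using assms by (rule test_fun_smooth)
  have "\<exists>L>0. \<forall>x y. \<bar>pderiv2 \<phi> j x - pderiv2 \<phi> j y\<bar> \<le> L * norm (x - y)" for j
    using test_fun_Lipschitz[OF test_fun_pderiv2[OF assms, of j]] by metis
  then obtain L where L: "\<And>j. L j > 0" "\<And>j x y. \<bar>pderiv2 \<phi> j x - pderiv2 \<phi> j y\<bar> \<le> L j * norm (x - y)"
    by metis
  define M where "M = L 1 + L 2"
  have M: "M > 0" using L(1)[of 1] L(1)[of 2] by (simp add: M_def)
  have LM: "\<bar>pderiv2 \<phi> j x - pderiv2 \<phi> j y\<bar> \<le> M * norm (x - y)" for j x y
  proof -
    have "L j \<le> M" using exhaust_2[of j] L(1)[of 1] L(1)[of 2] by (auto simp: M_def)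
    then show ?thesis using L(2)[of j x y] by (meson mult_right_mono norm_ge_zero order_trans)
  qed
  have "\<bar>\<phi> (x + h) - \<phi> x - frechet_derivative \<phi> (at x) h\<bar> \<le> (2 * M) * (norm h)\<^sup>2" for x h
  proof -
    let ?D = "\<lambda>z. frechet_derivative \<phi> (at z)"
    have lin: "linear (?D x)"
      using has_derivative_linear[OF smooth_fun_has_derivative[OF sm]] .
    \<comment> \<open>The mean value inequality is applied to \<phi> minus its linearization at x on
      the closed ball of radius |h|; there the derivative of the difference is at most 2 M |h|,
      because the partial derivatives are Lipschitz.\<close>
    have "norm ((\<phi> (x + h) - ?D x (x + h)) - (\<phi> x - ?D x x)) \<le> (2 * (M * norm h)) * norm (x + h - x)"
    proof (rule differentiable_bound[where S = "cball x (norm h)" and f = "\<lambda>z. \<phi> z - ?D x z"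
          and f' = "\<lambda>z k. ?D z k - ?D x k"])
      show "((\<lambda>z. \<phi> z - ?D x z) has_derivative (\<lambda>k. ?D z k - ?D x k)) (at z within cball x (norm h))" for z
        using smooth_fun_has_derivative[OF sm]
        by (intro has_derivative_diff bounded_linear_imp_has_derivative linear_conv_bounded_linear[THEN iffD1] lin)
          (auto intro: has_derivative_at_withinI)
      show "onorm (\<lambda>k. ?D z k - ?D x k) \<le> 2 * (M * norm h)" if z: "z \<in> cball x (norm h)" for z
      proof (rule onorm_le)
        fix k
        have "norm (?D z k - ?D x k) = \<bar>\<Sum>j\<in>UNIV. k $ j * (pderiv2 \<phi> j z - pderiv2 \<phi> j x)\<bar>"
          by (simp add: frechet_derivative_eq_sum[OF sm] sum_subtractf algebra_simps)
        also have "\<dots> \<le> (\<Sum>j\<in>UNIV. \<bar>k $ j * (pderiv2 \<phi> j z - pderiv2 \<phi> j x)\<bar>)"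
          by (rule sum_abs)
        also have "\<dots> \<le> (\<Sum>j\<in>(UNIV::2 set). norm k * (M * norm h))"
        proof (rule sum_mono)
          fix j
          have "M * norm (z - x) \<le> M * norm h"
            using z M by (intro mult_left_mono) (auto simp: dist_norm norm_minus_commute)
          then have "\<bar>pderiv2 \<phi> j z - pderiv2 \<phi> j x\<bar> \<le> M * norm h"
            using LM[of j z x] by linarith
          then show "\<bar>k $ j * (pderiv2 \<phi> j z - pderiv2 \<phi> j x)\<bar> \<le> norm k * (M * norm h)"
            unfolding abs_mult using component_le_norm_cart[of k j] by (intro mult_mono) auto
        qed
        finally show "norm (?D z k - ?D x k) \<le> 2 * (M * norm h) * norm k" by (simp add: algebra_simps)
      qed
    qed (auto simp: dist_norm)
    then show ?thesis
      by (simp add: linear_add[OF lin] power2_eq_square algebra_simps)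
  qed
  then show ?thesis using that[of "2 * M"] M by auto
qed

subsection \<open>Convolution with test functions\<close>

text \<open>The kernel is reflected, \<open>\<beta> (y - x)\<close> instead of \<open>\<beta> (x - y)\<close>, so that only translation
  invariance of the Lebesgue measure is needed; this causes the minus sign in the derivative.\<close>

definition conv :: "(real^2 \<Rightarrow> real) \<Rightarrow> (real^2 \<Rightarrow> real) \<Rightarrow> real^2 \<Rightarrow> real" where
  "conv \<beta> f x = (LINT y|lborel. \<beta> (y - x) * f y)"

lemma integrable_bounded_mult:
  fixes f g :: "'a \<Rightarrow> real"
  assumes "integrable M f" "g \<in> borel_measurable M" "\<And>x. \<bar>g x\<bar> \<le> B"
  shows "integrable M (\<lambda>x. g x * f x)"
proof (rule Bochner_Integration.integrable_bound)
  show "integrable M (\<lambda>x. B * f x)" using assms(1) by simp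
  show "(\<lambda>x. g x * f x) \<in> borel_measurable M" using assms by (auto intro: borel_measurable_times)
  have "\<bar>g x\<bar> * \<bar>f x\<bar> \<le> \<bar>B\<bar> * \<bar>f x\<bar>" for x
    using assms(3)[of x] by (intro mult_right_mono) auto
  then show "AE x in M. norm (g x * f x) \<le> norm (B * f x)" by (simp add: abs_mult)
qed

lemma test_fun_shift_borel [measurable]:
  "test_fun \<Omega> \<beta> \<Longrightarrow> (\<lambda>y. \<beta> (y - x)) \<in> borel_measurable borel"
  using smooth_fun_borel[OF test_fun_smooth] by measurable

lemma conv_integrable:
  assumes "test_fun \<Omega> \<beta>" "integrable lborel f"
  shows "integrable lborel (\<lambda>y. \<beta> (y - x) * f y)"
proof -
  obtain B where "\<And>x. \<bar>\<beta> x\<bar> \<le> B" using test_fun_bounded[OF assms(1)] by metis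
  then show ?thesis
    using assms by (intro integrable_bounded_mult[where B = B]) (auto simp: measurable_lborel1)
qed

text \<open>The Taylor remainder of the kernel is uniform in the point, so integrating it against
  |f| bounds the remainder of the convolution by L |z - x|^2 times the L1 norm of f.\<close>

lemma conv_has_derivative:
  assumes \<beta>: "test_fun UNIV \<beta>" and f: "integrable lborel f"
  shows "(conv \<beta> f has_derivative (\<lambda>h. - (\<Sum>j\<in>UNIV. h $ j * conv (pderiv2 \<beta> j) f x))) (at x)"
proof -
  have sm: "smooth_fun \<beta>" using \<beta> by (rule test_fun_smooth)
  obtain L where L: "L > 0"
    "\<And>x h. \<bar>\<beta> (x + h) - \<beta> x - frechet_derivative \<beta> (at x) h\<bar> \<le> L * (norm h)\<^sup>2"
    using test_fun_Taylor[OF \<beta>] by metis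
  define I where "I = (LINT y|lborel. \<bar>f y\<bar>)"
  let ?D = "\<lambda>h. - (\<Sum>j\<in>UNIV. h $ j * conv (pderiv2 \<beta> j) f x)"
  have int: "integrable lborel (\<lambda>y. \<beta> (y - z) * f y)" for z
    by (rule conv_integrable[OF \<beta> f])
  have intd: "integrable lborel (\<lambda>y. pderiv2 \<beta> j (y - z) * f y)" for z j
    by (rule conv_integrable[OF test_fun_pderiv2[OF \<beta>] f])
  have main: "\<bar>conv \<beta> f z - conv \<beta> f x - ?D (z - x)\<bar> \<le> L * (norm (z - x))\<^sup>2 * I" for z
  proof -
    have "?D (z - x) = (\<Sum>j\<in>UNIV. (x - z) $ j * conv (pderiv2 \<beta> j) f x)"
      by (simp add: sum_negf[symmetric] algebra_simps)
    also have "\<dots> = (\<Sum>j\<in>UNIV. LINT y|lborel. (x - z) $ j * (pderiv2 \<beta> j (y - x) * f y))"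
      unfolding conv_def by simp
    also have "\<dots> = (LINT y|lborel. (\<Sum>j\<in>UNIV. (x - z) $ j * (pderiv2 \<beta> j (y - x) * f y)))"
      by (rule Bochner_Integration.integral_sum[symmetric]) (use intd in simp)
    finally have D: "?D (z - x) = (LINT y|lborel. frechet_derivative \<beta> (at (y - x)) (x - z) * f y)"
      unfolding frechet_derivative_eq_sum[OF sm] sum_distrib_right by (simp only: mult.assoc)
    have intD: "integrable lborel (\<lambda>y. frechet_derivative \<beta> (at (y - x)) (x - z) * f y)"
      unfolding frechet_derivative_eq_sum[OF sm] sum_distrib_right
      using intd by (auto simp: mult.assoc intro!: Bochner_Integration.integrable_sum)
    have "conv \<beta> f z - conv \<beta> f x - ?D (z - x) =
        (LINT y|lborel. \<beta> (y - z) * f y - \<beta> (y - x) * f y - frechet_derivative \<beta> (at (y - x)) (x - z) * f y)"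
      unfolding D unfolding conv_def using int intD by simp
    also have "\<bar>\<dots>\<bar> \<le> (LINT y|lborel. L * (norm (z - x))\<^sup>2 * \<bar>f y\<bar>)"
    proof (rule integral_abs_bound[THEN order_trans], rule integral_mono)
      fix y
      have "\<bar>\<beta> (y - z) - \<beta> (y - x) - frechet_derivative \<beta> (at (y - x)) (x - z)\<bar> \<le> L * (norm (z - x))\<^sup>2"
        using L(2)[of "y - x" "x - z"] by (simp add: norm_minus_commute)
      then show "\<bar>\<beta> (y - z) * f y - \<beta> (y - x) * f y - frechet_derivative \<beta> (at (y - x)) (x - z) * f y\<bar>
          \<le> L * (norm (z - x))\<^sup>2 * \<bar>f y\<bar>"
        by (metis (no_types, opaque_lifting) abs_ge_zero abs_mult left_diff_distrib mult_right_mono)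
    qed (use int intD f in auto)
    finally show ?thesis by (simp add: I_def)
  qed
  show ?thesis
  proof (rule has_derivativeI_sandwich[where e = 1 and H = "\<lambda>z. L * norm (z - x) * I"])
    show "bounded_linear ?D"
      by (intro bounded_linear_minus bounded_linear_sum bounded_linear_mult_left[THEN bounded_linear_compose]
          bounded_linear_vec_nth)
    show "((\<lambda>z. L * norm (z - x) * I) \<longlongrightarrow> 0) (at x)"
      by (auto intro!: tendsto_eq_intros)
    show "norm (conv \<beta> f z - conv \<beta> f x - ?D (z - x)) / norm (z - x) \<le> L * norm (z - x) * I"
      if "z \<noteq> x" for z
      using main[of z] that by (simp add: field_simps power2_eq_square)
  qed auto
qed

lemma pderiv2_conv:
  assumes "test_fun UNIV \<beta>" "integrable lborel f"
  shows "pderiv2 (conv \<beta> f) j x = - conv (pderiv2 \<beta> j) f x"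
proof -
  have "(\<Sum>k\<in>UNIV. axis j 1 $ k * conv (pderiv2 \<beta> k) f x) =
      (\<Sum>k\<in>UNIV. if k = j then conv (pderiv2 \<beta> k) f x else 0)"
    by (rule sum.cong) (auto simp: axis_def)
  then show ?thesis
    using pderiv2_eqI[OF conv_has_derivative[OF assms], of j] by simp
qed

lemma test_fun_minus: "test_fun \<Omega> \<phi> \<Longrightarrow> test_fun \<Omega> (\<lambda>x. - \<phi> x)"
  using test_fun_mult_left[of \<Omega> \<phi> "\<lambda>x. - 1"] by simp

text \<open>A partial derivative of the convolution is again a convolution of the same f, with a
  test function as kernel. Hence the convolutions of f with arbitrary test functions form a
  bisimulation.\<close>

lemma smooth_fun_conv:
  assumes "test_fun UNIV \<beta>" "integrable lborel f"
  shows "smooth_fun (conv \<beta> f)"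
proof -
  have "smooth_fun g" if "\<exists>\<beta>. test_fun UNIV \<beta> \<and> g = conv \<beta> f" for g
    using that
  proof (coinduction arbitrary: g)
    case smooth_fun
    then obtain \<beta> where \<beta>: "test_fun UNIV \<beta>" "g = conv \<beta> f" by auto
    note d = conv_has_derivative[OF \<beta>(1) assms(2)]
    have "g differentiable (at x)" for x
      unfolding \<beta>(2) differentiable_def using d by blast
    moreover have "\<exists>\<beta>'. test_fun UNIV \<beta>' \<and> (\<lambda>x. frechet_derivative g (at x) b) = conv \<beta>' f"
      if b: "b \<in> Basis" for b
    proof -
      obtain j where j: "b = axis j 1" using b by (auto simp: Basis_vec_def)
      have "(\<lambda>x. frechet_derivative g (at x) b) = conv (\<lambda>x. - pderiv2 \<beta> j x) f"
        using pderiv2_conv[OF \<beta>(1) assms(2), of j]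
        by (auto simp: j pderiv2_def[abs_def] \<beta>(2) conv_def fun_eq_iff)
      then show ?thesis
        using test_fun_minus[OF test_fun_pderiv2[OF \<beta>(1)]] by blast
    qed
    ultimately show ?case by blast
  qed
  then show ?thesis using assms by blast
qed

lemma test_fun_integrable:
  assumes "test_fun \<Omega> \<phi>" shows "integrable lborel \<phi>"
proof -
  obtain B where B: "\<And>x. \<bar>\<phi> x\<bar> \<le> B" using test_fun_bounded[OF assms] by metis
  let ?K = "closure {x. \<phi> x \<noteq> 0}"
  have "integrable lborel (indicator ?K :: real^2 \<Rightarrow> real)"
    using assms by (intro integrable_real_indicator emeasure_bounded_finite compact_imp_bounded) (auto simp: test_fun_def)
  then have "integrable lborel (\<lambda>x. \<phi> x * indicator ?K x)"
    using B smooth_fun_borel[OF test_fun_smooth[OF assms]]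
    by (intro integrable_bounded_mult) (auto simp: measurable_lborel1)
  moreover have "\<phi> x * indicator ?K x = \<phi> x" for x
    using closure_subset[of "{x. \<phi> x \<noteq> 0}"] by (auto simp: indicator_def)
  ultimately show ?thesis by simp
qed

text \<open>The derivative at 0 of the convolution with the indicator of a large ball is this
  integral up to sign, and near 0 that convolution is constant.\<close>

lemma integral_pderiv2_eq_0:
  assumes "test_fun \<Omega> \<phi>" shows "(LINT x|lborel. pderiv2 \<phi> j x) = 0"
proof -
  have \<phi>: "test_fun UNIV \<phi>" using assms by (rule test_fun_UNIV)
  obtain R where R: "R > 0" "\<And>x. \<phi> x \<noteq> 0 \<Longrightarrow> norm x \<le> R"
  proof -
    have "bounded {x. \<phi> x \<noteq> 0}"
      using assms unfolding test_fun_def by (meson bounded_subset closure_subset compact_imp_bounded)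
    then show ?thesis using that by (auto simp: bounded_pos)
  qed
  \<comment> \<open>The support lies in the closed ball of radius R; the extra 1 leaves room for
    shifts by vectors shorter than 1.\<close>
  let ?f = "indicator (ball 0 (R + 1)) :: real^2 \<Rightarrow> real"
  have f: "integrable lborel ?f"
    by (intro integrable_real_indicator emeasure_bounded_finite) auto
  have c: "conv \<phi> ?f x = (LINT y|lborel. \<phi> y)" if "x \<in> ball 0 1" for x
  proof -
    have "conv \<phi> ?f x = (LINT y|lborel. \<phi> (y - x))"
      unfolding conv_def
    proof (rule Bochner_Integration.integral_cong[OF refl])
      fix y
      show "\<phi> (y - x) * ?f y = \<phi> (y - x)"
        using R(2)[of "y - x"] that norm_triangle_sub[of y x]
        by (cases "\<phi> (y - x) = 0") (auto simp: indicator_def)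
    qed
    also have "\<dots> = (LINT y|distr lborel borel ((+) x). \<phi> (y - x))"
      by (simp add: lborel_distr_plus)
    also have "\<dots> = (LINT y|lborel. \<phi> y)"
      using test_fun_shift_borel[OF \<phi>] by (subst integral_distr) auto
    finally show ?thesis .
  qed
  have "pderiv2 (conv \<phi> ?f) j 0 = 0"
    by (rule pderiv2_eq_0[where U = "ball 0 1"]) (use c in auto)
  then have "conv (pderiv2 \<phi> j) ?f 0 = 0"
    using pderiv2_conv[OF \<phi> f, of j 0] by simp
  moreover have "conv (pderiv2 \<phi> j) ?f 0 = (LINT x|lborel. pderiv2 \<phi> j x)"
    unfolding conv_def
  proof (rule Bochner_Integration.integral_cong[OF refl])
    fix y
    have "pderiv2 \<phi> j y = 0" if "norm y \<ge> R + 1"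
      by (rule pderiv2_eq_0[where U = "- cball 0 R" and c = 0]) (use that R in force)+
    then show "pderiv2 \<phi> j (y - 0) * ?f y = pderiv2 \<phi> j y"
      by (auto simp: indicator_def)
  qed
  ultimately show ?thesis by simp
qed

subsection \<open>Mollification in the mean-square sense\<close>

lemma nn_integral_lborel_translate:
  fixes h :: "'a::euclidean_space \<Rightarrow> ennreal"
  assumes [measurable]: "h \<in> borel_measurable borel"
  shows "(\<integral>\<^sup>+x. h (c + x) \<partial>lborel) = (\<integral>\<^sup>+x. h x \<partial>lborel)"
proof -
  have "(\<integral>\<^sup>+x. h x \<partial>lborel) = (\<integral>\<^sup>+x. h x \<partial>distr lborel borel ((+) c))"
    by (simp add: lborel_distr_plus)
  also have "\<dots> = (\<integral>\<^sup>+x. h (c + x) \<partial>lborel)"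
    by (subst nn_integral_distr) auto
  finally show ?thesis ..
qed

lemma nn_integral_lborel_reflect:
  fixes h :: "'a::euclidean_space \<Rightarrow> ennreal"
  assumes [measurable]: "h \<in> borel_measurable borel"
  shows "(\<integral>\<^sup>+x. h (c - x) \<partial>lborel) = (\<integral>\<^sup>+x. h x \<partial>lborel)"
proof -
  have "(\<integral>\<^sup>+x. h x \<partial>lborel) = (\<integral>\<^sup>+x. h x \<partial>density (distr lborel borel (\<lambda>x. c + (-1) *\<^sub>R x)) (\<lambda>_. 1))"
    using lborel_affine[of "-1" c] by simp
  also have "\<dots> = (\<integral>\<^sup>+x. h (c - x) \<partial>lborel)"
    by (simp add: density_1 nn_integral_distr)
  finally show ?thesis ..
qed

lemma integral_shift:
  fixes f :: "real^2 \<Rightarrow> real"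
  assumes "f \<in> borel_measurable borel"
  shows "(LINT y|lborel. f (y - x)) = (LINT y|lborel. f y)"
proof -
  have "(LINT y|lborel. f y) = (LINT y|distr lborel borel ((+) (- x)). f y)"
    by (simp add: lborel_distr_plus)
  also have "\<dots> = (LINT y|lborel. f (y - x))"
    using assms by (subst integral_distr) auto
  finally show ?thesis ..
qed

text \<open>Square-integrability on the whole plane with Borel rather than Lebesgue measurability,
  so that shifts and product measures cause no measurability problems. Functions on \<Omega> enter
  after extension by zero.\<close>

definition sq_int :: "(real^2 \<Rightarrow> real) \<Rightarrow> bool" where
  "sq_int f \<longleftrightarrow> f \<in> borel_measurable borel \<and> integrable lborel (\<lambda>x. (f x)\<^sup>2)"

lemma sq_int_borel [measurable_dest]: "sq_int f \<Longrightarrow> f \<in> borel_measurable borel"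
  by (simp add: sq_int_def)

lemma sq_intD: "sq_int f \<Longrightarrow> integrable lborel (\<lambda>x. (f x)\<^sup>2)"
  by (simp add: sq_int_def)

lemma sq_int_prod:
  assumes "sq_int f" "sq_int g" shows "integrable lborel (\<lambda>x. f x * g x)"
proof (rule Bochner_Integration.integrable_bound)
  show "integrable lborel (\<lambda>x. (f x)\<^sup>2 + (g x)\<^sup>2)" using assms by (simp add: sq_int_def)
  show "(\<lambda>x. f x * g x) \<in> borel_measurable lborel"
    using assms by (auto simp: sq_int_def intro: borel_measurable_times)
  have "\<bar>f x * g x\<bar> \<le> (f x)\<^sup>2 + (g x)\<^sup>2" for x
  proof -
    have "0 \<le> \<bar>f x\<bar> * \<bar>g x\<bar>" "2 * \<bar>f x\<bar> * \<bar>g x\<bar> \<le> (f x)\<^sup>2 + (g x)\<^sup>2"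
      using sum_squares_bound[of "\<bar>f x\<bar>" "\<bar>g x\<bar>"] by simp_all
    then show ?thesis unfolding abs_mult by linarith
  qed
  then show "AE x in lborel. norm (f x * g x) \<le> norm ((f x)\<^sup>2 + (g x)\<^sup>2)" by simp
qed

lemma sq_int_diff: "sq_int f \<Longrightarrow> sq_int g \<Longrightarrow> sq_int (\<lambda>x. f x - g x)"
  unfolding sq_int_def power2_diff
  using sq_int_prod[unfolded sq_int_def, of f g] by (auto simp: mult.assoc)

lemma sq_int_add: "sq_int f \<Longrightarrow> sq_int g \<Longrightarrow> sq_int (\<lambda>x. f x + g x)"
  unfolding sq_int_def power2_sum
  using sq_int_prod[unfolded sq_int_def, of f g] by (auto simp: mult.assoc)

lemma sq_int_bounded_mult:
  assumes "sq_int f" "g \<in> borel_measurable borel" "\<And>x. \<bar>g x\<bar> \<le> B"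
  shows "sq_int (\<lambda>x. g x * f x)"
  unfolding sq_int_def power_mult_distrib
proof
  have "(g x)\<^sup>2 \<le> B\<^sup>2" for x
    using power_mono[OF assms(3)[of x], of 2] by simp
  then show "integrable lborel (\<lambda>x. (g x)\<^sup>2 * (f x)\<^sup>2)"
    using assms by (intro integrable_bounded_mult[where B = "B\<^sup>2"]) (auto simp: sq_int_def measurable_lborel1)
qed (use assms in \<open>auto simp: sq_int_def\<close>)

lemma sq_int_bounded_support:
  assumes "f \<in> borel_measurable borel" "\<And>x. \<bar>f x\<bar> \<le> B" "\<And>x. norm x > R \<Longrightarrow> f x = 0"
  shows "sq_int f" "integrable lborel f"
proof -
  have i: "integrable lborel (indicator (cball 0 R) :: real^2 \<Rightarrow> real)"
    by (intro integrable_real_indicator emeasure_bounded_finite) auto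
  have e: "f x * indicator (cball 0 R) x = f x" "(f x)\<^sup>2 * indicator (cball 0 R) x = (f x)\<^sup>2" for x
    using assms(3)[of x] by (cases "norm x > R"; simp add: indicator_def)+
  have "(f x)\<^sup>2 \<le> B\<^sup>2" for x
    using power_mono[OF assms(2)[of x], of 2] by simp
  then show "sq_int f" "integrable lborel f"
    using integrable_bounded_mult[OF i, of f B] integrable_bounded_mult[OF i, of "\<lambda>x. (f x)\<^sup>2" "B\<^sup>2"] assms e
    by (auto simp: sq_int_def measurable_lborel1)
qed

text \<open>Replaces the triangle inequality of L2: a factor 3 is accepted in order to work with
  squared norms throughout.\<close>

lemma integral_sq_le_3:
  assumes "sq_int f" "sq_int g" "sq_int h"
  shows "(LINT x|lborel. (f x + g x + h x)\<^sup>2) \<le>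
    3 * (LINT x|lborel. (f x)\<^sup>2) + 3 * (LINT x|lborel. (g x)\<^sup>2) + 3 * (LINT x|lborel. (h x)\<^sup>2)"
proof -
  have "(LINT x|lborel. (f x + g x + h x)\<^sup>2) \<le> (LINT x|lborel. 3 * (f x)\<^sup>2 + 3 * (g x)\<^sup>2 + 3 * (h x)\<^sup>2)"
  proof (rule integral_mono)
    show "integrable lborel (\<lambda>x. (f x + g x + h x)\<^sup>2)"
      using sq_int_add[OF sq_int_add[OF assms(1,2)] assms(3)] by (simp add: sq_int_def)
    have "(a + b + c)\<^sup>2 \<le> 3 * a\<^sup>2 + 3 * b\<^sup>2 + 3 * c\<^sup>2" for a b c :: real
      using zero_le_power2[of "a - b"] zero_le_power2[of "b - c"] zero_le_power2[of "a - c"]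
      by (simp add: power2_eq_square algebra_simps)
    then show "(f x + g x + h x)\<^sup>2 \<le> 3 * (f x)\<^sup>2 + 3 * (g x)\<^sup>2 + 3 * (h x)\<^sup>2" for x .
  qed (use assms in \<open>auto simp: sq_int_def\<close>)
  also have "\<dots> = 3 * (LINT x|lborel. (f x)\<^sup>2) + 3 * (LINT x|lborel. (g x)\<^sup>2) + 3 * (LINT x|lborel. (h x)\<^sup>2)"
    using assms by (simp add: sq_int_def)
  finally show ?thesis .
qed

definition kernel :: "(real^2 \<Rightarrow> real) \<Rightarrow> bool" where
  "kernel \<beta> \<longleftrightarrow> test_fun UNIV \<beta> \<and> (\<forall>x. \<beta> x \<ge> 0) \<and> (LINT x|lborel. \<beta> x) = 1"

lemma kernel_shift:
  assumes "kernel \<beta>"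
  shows "(LINT y|lborel. \<beta> (y - x)) = 1" "integrable lborel (\<lambda>y. \<beta> (y - x))"
proof -
  have \<beta>: "test_fun UNIV \<beta>" using assms by (simp add: kernel_def)
  have [measurable]: "\<beta> \<in> borel_measurable borel"
    using \<beta> by (intro smooth_fun_borel test_fun_smooth)
  show "(LINT y|lborel. \<beta> (y - x)) = 1"
    using assms by (simp add: integral_shift kernel_def)
  have "integrable (distr lborel borel ((+) (- x))) \<beta>"
    using test_fun_integrable[OF \<beta>] by (simp add: lborel_distr_plus)
  then show "integrable lborel (\<lambda>y. \<beta> (y - x))"
    by (subst (asm) integrable_distr_eq) auto
qed

text \<open>Jensen's inequality for the square, read off from the nonnegative variance of f under
  the probability density \<beta>(y - x).\<close>

lemma conv_square_le:
  assumes \<beta>: "kernel \<beta>" and f: "integrable lborel f" "sq_int f"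
  shows "(conv \<beta> f x)\<^sup>2 \<le> conv \<beta> (\<lambda>y. (f y)\<^sup>2) x"
proof -
  define m where "m = conv \<beta> f x"
  have t: "test_fun UNIV \<beta>" using \<beta> by (simp add: kernel_def)
  have i1: "integrable lborel (\<lambda>y. \<beta> (y - x) * f y)"
    by (rule conv_integrable[OF t f(1)])
  have i2: "integrable lborel (\<lambda>y. \<beta> (y - x) * (f y)\<^sup>2)"
    by (rule conv_integrable[OF t sq_intD[OF f(2)]])
  note i3 = kernel_shift[OF \<beta>, of x]
  have "0 \<le> (LINT y|lborel. \<beta> (y - x) * (f y - m)\<^sup>2)"
    using \<beta> by (intro integral_nonneg_AE) (auto simp: kernel_def)
  also have "\<dots> = (LINT y|lborel. \<beta> (y - x) * (f y)\<^sup>2 - 2 * m * (\<beta> (y - x) * f y) + m\<^sup>2 * \<beta> (y - x))"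
    by (intro Bochner_Integration.integral_cong) (auto simp: power2_eq_square algebra_simps)
  also have "\<dots> = conv \<beta> (\<lambda>y. (f y)\<^sup>2) x - 2 * m * m + m\<^sup>2"
    using i1 i2 i3 by (simp add: conv_def m_def)
  finally show ?thesis by (simp add: m_def power2_eq_square)
qed

text \<open>Tonelli: after exchanging the integrals, the kernel is integrated in x, and this
  integral is 1 because reflection preserves Lebesgue measure.\<close>

lemma conv_L1:
  assumes \<beta>: "kernel \<beta>" and f: "integrable lborel f" "\<And>x. f x \<ge> 0"
  shows "integrable lborel (conv \<beta> f)" "(LINT x|lborel. conv \<beta> f x) = (LINT x|lborel. f x)"
proof -
  have t: "test_fun UNIV \<beta>" using \<beta> by (simp add: kernel_def)
  have [measurable]: "\<beta> \<in> borel_measurable borel"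
    using t by (intro smooth_fun_borel test_fun_smooth)
  have [measurable]: "f \<in> borel_measurable borel" using f(1) by auto
  have pos: "\<beta> x \<ge> 0" for x using \<beta> by (simp add: kernel_def)
  have cpos: "conv \<beta> f x \<ge> 0" for x
    unfolding conv_def using pos f(2) by (intro integral_nonneg_AE) auto
  have i\<beta>: "(\<integral>\<^sup>+x. ennreal (\<beta> x) \<partial>lborel) = 1"
    using \<beta> test_fun_integrable[OF t] pos by (subst nn_integral_eq_integral) (auto simp: kernel_def)
  have "(\<integral>\<^sup>+x. ennreal (conv \<beta> f x) \<partial>lborel) = (\<integral>\<^sup>+x. \<integral>\<^sup>+y. ennreal (\<beta> (y - x) * f y) \<partial>lborel \<partial>lborel)"
    unfolding conv_def using conv_integrable[OF t f(1)] pos f(2)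
    by (intro nn_integral_cong nn_integral_eq_integral[symmetric]) auto
  also have "\<dots> = (\<integral>\<^sup>+y. \<integral>\<^sup>+x. ennreal (\<beta> (y - x) * f y) \<partial>lborel \<partial>lborel)"
    by (rule lborel_pair.Fubini'[symmetric]) simp
  also have "\<dots> = (\<integral>\<^sup>+y. (\<integral>\<^sup>+x. ennreal (\<beta> (y - x)) \<partial>lborel) * ennreal (f y) \<partial>lborel)"
    using pos f(2) by (simp add: ennreal_mult nn_integral_multc)
  also have "\<dots> = (\<integral>\<^sup>+y. ennreal (f y) \<partial>lborel)"
    by (subst nn_integral_lborel_reflect[where h = "\<lambda>x. ennreal (\<beta> x)"]) (auto simp: i\<beta>)
  also have "\<dots> = ennreal (LINT x|lborel. f x)"
    using f by (intro nn_integral_eq_integral) auto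
  finally have eq: "(\<integral>\<^sup>+x. ennreal (conv \<beta> f x) \<partial>lborel) = ennreal (LINT x|lborel. f x)" .
  have m: "conv \<beta> f \<in> borel_measurable lborel"
    using smooth_fun_borel[OF smooth_fun_conv[OF t f(1)]] by simp
  show "integrable lborel (conv \<beta> f)"
    using m cpos eq by (intro integrableI_nonneg) auto
  show "(LINT x|lborel. conv \<beta> f x) = (LINT x|lborel. f x)"
    using m cpos eq f(2) by (subst integral_eq_nn_integral) (auto intro!: integral_nonneg_AE)
qed

text \<open>The pointwise Jensen inequality is integrated. The resulting contraction property
  carries convergence from a dense class over to all square-integrable functions considered.\<close>

lemma conv_L2:
  assumes \<beta>: "kernel \<beta>" and f: "integrable lborel f" "sq_int f"
  shows "sq_int (conv \<beta> f)" "(LINT x|lborel. (conv \<beta> f x)\<^sup>2) \<le> (LINT x|lborel. (f x)\<^sup>2)"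
proof -
  have t: "test_fun UNIV \<beta>" using \<beta> by (simp add: kernel_def)
  have m: "conv \<beta> f \<in> borel_measurable borel"
    using smooth_fun_borel[OF smooth_fun_conv[OF t f(1)]] by simp
  note c = conv_L1[OF \<beta> sq_intD[OF f(2)], simplified]
  note le = conv_square_le[OF \<beta> f]
  show s: "sq_int (conv \<beta> f)"
    unfolding sq_int_def using m le
    by (auto intro!: Bochner_Integration.integrable_bound[OF c(1)] AE_I2 order_trans[OF _ abs_ge_self])
  have "(LINT x|lborel. (conv \<beta> f x)\<^sup>2) \<le> (LINT x|lborel. conv \<beta> (\<lambda>y. (f y)\<^sup>2) x)"
    using s c le by (intro integral_mono) (auto simp: sq_int_def)
  then show "(LINT x|lborel. (conv \<beta> f x)\<^sup>2) \<le> (LINT x|lborel. (f x)\<^sup>2)"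
    using c by simp
qed

lemma conv_diff:
  assumes "test_fun UNIV \<beta>" "integrable lborel f" "integrable lborel g"
  shows "conv \<beta> (\<lambda>x. f x - g x) x = conv \<beta> f x - conv \<beta> g x"
  using conv_integrable[OF assms(1,2), of x] conv_integrable[OF assms(1,3), of x]
  by (simp add: conv_def right_diff_distrib)

text \<open>f is truncated, and the same truncation is applied to continuous functions that converge
  to f almost everywhere. Both errors tend to 0 by dominated convergence, the truncation supplying
  the dominating function in the second case.\<close>

lemma dense_continuous:
  assumes f: "sq_int f" and e: "e > 0"
  obtains F B where "continuous_on UNIV F" "\<And>x. \<bar>F x\<bar> \<le> B" "\<And>x. norm x > B \<Longrightarrow> F x = 0"
    "(LINT x|lborel. (f x - F x)\<^sup>2) < e"
proof -
  have [measurable]: "f \<in> borel_measurable borel" using f by (rule sq_int_borel)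
  \<comment> \<open>\<open>T m a x\<close> clamps the value a to [-m, m] and multiplies it by a
    function of x that is 1 for |x| <= m and 0 for |x| >= m + 1. It is continuous in a and x
    jointly, hence preserves continuity and pointwise limits.\<close>
  define T :: "nat \<Rightarrow> real \<Rightarrow> real^2 \<Rightarrow> real" where
    "T = (\<lambda>m a x. max (- real m) (min (real m) a) * max 0 (min 1 (real m + 1 - norm x)))"
  have Tm [measurable]: "(\<lambda>x. T m (g x) x) \<in> borel_measurable borel" if [measurable]: "g \<in> borel_measurable borel" for m g
  proof -
    have "(\<lambda>x::real^2. max 0 (min 1 (real m + 1 - norm x))) \<in> borel_measurable borel"
      by (intro borel_measurable_continuous_onI continuous_intros)
    then show ?thesis unfolding T_def by measurable
  qed
  have cont: "continuous_on UNIV (\<lambda>x. T m (g x) x)" if "continuous_on UNIV g" for m g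
    unfolding T_def by (intro continuous_intros that)
  have Tle: "\<bar>T m a x\<bar> \<le> \<bar>a\<bar>" "\<bar>T m a x\<bar> \<le> real m" for m a x
  proof -
    have "\<bar>T m a x\<bar> \<le> \<bar>max (- real m) (min (real m) a)\<bar> * 1"
      unfolding T_def abs_mult by (intro mult_left_mono) auto
    then show "\<bar>T m a x\<bar> \<le> \<bar>a\<bar>" "\<bar>T m a x\<bar> \<le> real m" by linarith+
  qed
  have T0: "T m a x = 0" if "norm x > real m + 1" for m a x
    using that by (simp add: T_def)
  have sqT: "sq_int (\<lambda>x. T m (g x) x)" if "g \<in> borel_measurable borel" for m g
    by (rule sq_int_bounded_support[where B = "real m" and R = "real m + 1"]) (auto simp: Tle T0 intro!: Tm that)
  have "(\<lambda>m. LINT x|lborel. (f x - T m (f x) x)\<^sup>2) \<longlonglongrightarrow> (LINT x|(lborel::(real^2) measure). (0::real))"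
  proof (rule integral_dominated_convergence[where w = "\<lambda>x. 4 * (f x)\<^sup>2"])
    show "AE x in lborel. (\<lambda>m. (f x - T m (f x) x)\<^sup>2) \<longlonglongrightarrow> 0"
    proof (intro AE_I2 tendsto_eventually)
      fix x
      obtain N where N: "real N > \<bar>f x\<bar> + norm x" using reals_Archimedean2 by blast
      show "\<forall>\<^sub>F m in sequentially. (f x - T m (f x) x)\<^sup>2 = 0"
      proof (rule eventually_sequentiallyI)
        fix m assume "N \<le> m"
        then have "real m > \<bar>f x\<bar> + norm x" using N by (simp add: order_less_le_trans)
        then have "max (- real m) (min (real m) (f x)) = f x" "max 0 (min 1 (real m + 1 - norm x)) = 1"
          using norm_ge_zero[of x] by linarith+
        then show "(f x - T m (f x) x)\<^sup>2 = 0" by (simp add: T_def)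
      qed
    qed
    show "AE x in lborel. norm ((f x - T m (f x) x)\<^sup>2) \<le> 4 * (f x)\<^sup>2" for m
    proof (rule AE_I2)
      fix x
      have "\<bar>f x - T m (f x) x\<bar> \<le> \<bar>2 * f x\<bar>" using Tle(1)[of m "f x" x] by linarith
      then have "\<bar>f x - T m (f x) x\<bar>\<^sup>2 \<le> \<bar>2 * f x\<bar>\<^sup>2" by (rule power_mono) simp
      then show "norm ((f x - T m (f x) x)\<^sup>2) \<le> 4 * (f x)\<^sup>2" by simp
    qed
  qed (use f in \<open>auto simp: sq_int_def\<close>)
  then obtain m where m: "(LINT x|lborel. (f x - T m (f x) x)\<^sup>2) < e / 4"
    using e by (elim order_tendstoD(2)[of _ _ _ "e / 4", THEN eventually_happens'[OF sequentially_bot], THEN exE]) simp_all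
  have "f measurable_on UNIV"
    by (subst measurable_on_iff_borel_measurable) (auto simp: lebesgue_on_UNIV_eq intro: measurable_completion)
  then obtain N g where N: "negligible N" and g: "\<And>n. continuous_on UNIV (g n)"
    and lim': "\<forall>x. x \<notin> N \<longrightarrow> (\<lambda>n. g n x) \<longlonglongrightarrow> (if x \<in> UNIV then f x else 0)"
    unfolding measurable_on_def by blast
  have lim: "(\<lambda>n. g n x) \<longlonglongrightarrow> f x" if "x \<notin> N" for x
    using lim'[rule_format, OF that] by simp
  have gm [measurable]: "g n \<in> borel_measurable borel" for n
    using g by (intro borel_measurable_continuous_onI)
  have ae: "AE x in lborel. x \<notin> N"
    using N unfolding negligible_iff_null_sets by (rule AE_completion_iff[THEN iffD1, OF AE_not_in])
  have "(\<lambda>n. LINT x|lborel. (T m (f x) x - T m (g n x) x)\<^sup>2) \<longlonglongrightarrow> (LINT x|(lborel::(real^2) measure). (0::real))"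
  proof (rule integral_dominated_convergence[where w = "\<lambda>x. (2 * real m * indicator (cball 0 (real m + 1)) x)\<^sup>2"])
    show "AE x in lborel. (\<lambda>n. (T m (f x) x - T m (g n x) x)\<^sup>2) \<longlonglongrightarrow> 0"
      using ae
    proof eventually_elim
      case (elim x)
      have "(\<lambda>n. T m (g n x) x) \<longlonglongrightarrow> T m (f x) x"
        unfolding T_def by (intro tendsto_intros lim elim)
      then have "(\<lambda>n. (T m (f x) x - T m (g n x) x)\<^sup>2) \<longlonglongrightarrow> (T m (f x) x - T m (f x) x)\<^sup>2"
        by (intro tendsto_intros)
      then show ?case by simp
    qed
    show "integrable lborel (\<lambda>x::real^2. (2 * real m * indicator (cball 0 (real m + 1)) x)\<^sup>2)"
      by (rule sq_intD, rule sq_int_bounded_support[where B = "2 * real m" and R = "real m + 1"])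
        (auto simp: indicator_def)
    show "AE x in lborel. norm ((T m (f x) x - T m (g n x) x)\<^sup>2) \<le> (2 * real m * indicator (cball 0 (real m + 1)) x)\<^sup>2" for n
    proof (rule AE_I2)
      fix x
      have "\<bar>T m (f x) x - T m (g n x) x\<bar> \<le> 2 * real m * indicator (cball 0 (real m + 1)) x"
        using Tle(2)[of m "f x" x] Tle(2)[of m "g n x" x] T0[of m x] by (auto simp: indicator_def)
      from power_mono[OF this, of 2] show "norm ((T m (f x) x - T m (g n x) x)\<^sup>2) \<le> (2 * real m * indicator (cball 0 (real m + 1)) x)\<^sup>2"
        by simp
    qed
  qed auto
  then obtain n where n: "(LINT x|lborel. (T m (f x) x - T m (g n x) x)\<^sup>2) < e / 12"
    using e by (elim order_tendstoD(2)[of _ _ _ "e / 12", THEN eventually_happens'[OF sequentially_bot], THEN exE]) simp_all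
  have "(LINT x|lborel. (f x - T m (g n x) x)\<^sup>2) =
     (LINT x|lborel. ((f x - T m (f x) x) + (T m (f x) x - T m (g n x) x) + 0)\<^sup>2)" by simp
  \<comment> \<open>The third summand is a dummy 0, and the tolerances fit: 3 (e/4) + 3 (e/12) =
    e.\<close>
  also have "\<dots> \<le> 3 * (LINT x|lborel. (f x - T m (f x) x)\<^sup>2)
      + 3 * (LINT x|lborel. (T m (f x) x - T m (g n x) x)\<^sup>2) + 3 * (LINT x|(lborel::(real^2) measure). (0::real)\<^sup>2)"
    by (intro integral_sq_le_3 sq_int_diff f sqT) (auto simp: sq_int_def)
  also have "\<dots> < e" using m n by simp
  finally have "(LINT x|lborel. (f x - T m (g n x) x)\<^sup>2) < e" .
  moreover have "\<bar>T m a x\<bar> \<le> real m + 1" for a x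
    using Tle(2)[of m a x] by linarith
  ultimately show ?thesis
    using T0[of m] by (intro that[of "\<lambda>x. T m (g n x) x" "real m + 1"] cont g) blast+
qed

text \<open>The convolution is an average of F over the shifted support of the kernel. The case e =
  0 computes it exactly where F is constant on that support.\<close>

lemma conv_minus_le:
  assumes \<beta>: "kernel \<beta>" and F: "integrable lborel F"
    and near: "\<And>y. \<beta> (y - x) \<noteq> 0 \<Longrightarrow> \<bar>F y - c\<bar> \<le> e"
  shows "\<bar>conv \<beta> F x - c\<bar> \<le> e"
proof -
  have t: "test_fun UNIV \<beta>" and pos: "\<And>z. \<beta> z \<ge> 0" using \<beta> by (auto simp: kernel_def)
  note k = kernel_shift[OF \<beta>, of x]
  note i = conv_integrable[OF t F, of x]
  have "conv \<beta> F x - c = (LINT y|lborel. \<beta> (y - x) * F y - c * \<beta> (y - x))"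
    using i k by (simp add: conv_def)
  also have "\<bar>\<dots>\<bar> \<le> (LINT y|lborel. e * \<beta> (y - x))"
  proof (rule integral_abs_bound[THEN order_trans], rule integral_mono)
    fix y
    have "\<bar>\<beta> (y - x) * F y - c * \<beta> (y - x)\<bar> = \<beta> (y - x) * \<bar>F y - c\<bar>"
      using pos[of "y - x"] by (simp add: abs_mult[symmetric] right_diff_distrib mult.commute[of c])
        (metis abs_mult abs_of_nonneg right_diff_distrib)
    also have "\<dots> \<le> \<beta> (y - x) * e"
      using near[of y] pos[of "y - x"] by (cases "\<beta> (y - x) = 0") (auto intro: mult_left_mono)
    finally show "\<bar>\<beta> (y - x) * F y - c * \<beta> (y - x)\<bar> \<le> e * \<beta> (y - x)" by (simp add: mult.commute)
  qed (use i k in auto)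
  finally show ?thesis using k by simp
qed

text \<open>Pointwise convergence is continuity of F. The radii are bounded, so all mollified
  functions live in one ball, which provides the dominating function.\<close>

lemma conv_tendsto_continuous:
  assumes \<beta>: "\<And>k. kernel (\<beta> k)" "\<And>k x. norm x \<ge> r k \<Longrightarrow> \<beta> k x = 0" and r: "r \<longlonglongrightarrow> 0"
    and F: "continuous_on UNIV F" "\<And>x. \<bar>F x\<bar> \<le> B" "\<And>x. norm x > B \<Longrightarrow> F x = 0"
  shows "(\<lambda>k. LINT x|lborel. (conv (\<beta> k) F x - F x)\<^sup>2) \<longlonglongrightarrow> 0"
proof -
  have [measurable]: "F \<in> borel_measurable borel" using F(1) by (rule borel_measurable_continuous_onI)
  have sF: "sq_int F"
    by (rule sq_int_bounded_support(1)[OF _ F(2,3)]) simp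
  have iF: "integrable lborel F"
    by (rule sq_int_bounded_support(2)[OF _ F(2,3)]) simp
  have cm [measurable]: "conv (\<beta> k) F \<in> borel_measurable borel" for k
    using \<beta>(1)[of k] by (intro smooth_fun_borel smooth_fun_conv iF) (simp add: kernel_def)
  have "Bseq r" using r by (simp add: convergent_imp_Bseq convergentI)
  then obtain R where R: "R > 0" "\<And>k. \<bar>r k\<bar> \<le> R" by (auto simp: Bseq_def)
  have "(\<lambda>k. LINT x|lborel. (conv (\<beta> k) F x - F x)\<^sup>2) \<longlonglongrightarrow> (LINT x|(lborel::(real^2) measure). (0::real))"
  proof (rule integral_dominated_convergence[where w = "\<lambda>x. (2 * B * indicator (cball 0 (B + R)) x)\<^sup>2"])
    show "AE x in lborel. (\<lambda>k. (conv (\<beta> k) F x - F x)\<^sup>2) \<longlonglongrightarrow> 0"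
    proof (rule AE_I2)
      fix x
      have "(\<lambda>k. conv (\<beta> k) F x) \<longlonglongrightarrow> F x"
      proof (rule LIMSEQ_I)
        fix e :: real assume e: "e > 0"
        obtain d where d: "d > 0" "\<And>y. dist y x < d \<Longrightarrow> dist (F y) (F x) < e / 2"
          using F(1)[unfolded continuous_on_iff, rule_format, of x "e / 2"] e by auto
        obtain K where K: "\<And>k. k \<ge> K \<Longrightarrow> r k < d"
          using order_tendstoD(2)[OF r d(1)] unfolding eventually_sequentially by blast
        have "norm (conv (\<beta> k) F x - F x) < e" if "k \<ge> K" for k
        proof -
          have "\<bar>conv (\<beta> k) F x - F x\<bar> \<le> e / 2"
          proof (rule conv_minus_le[OF \<beta>(1) iF])
            fix y assume "\<beta> k (y - x) \<noteq> 0"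
            then have "norm (y - x) < r k" using \<beta>(2)[of k "y - x"] by (meson not_le)
            then show "\<bar>F y - F x\<bar> \<le> e / 2"
              using d(2)[of y] K[OF that] by (auto simp: dist_norm)
          qed
          then show ?thesis using e by simp
        qed
        then show "\<exists>K. \<forall>k\<ge>K. norm (conv (\<beta> k) F x - F x) < e" by blast
      qed
      then have "(\<lambda>k. (conv (\<beta> k) F x - F x)\<^sup>2) \<longlonglongrightarrow> (F x - F x)\<^sup>2" by (intro tendsto_intros)
      then show "(\<lambda>k. (conv (\<beta> k) F x - F x)\<^sup>2) \<longlonglongrightarrow> 0" by simp
    qed
    show "integrable lborel (\<lambda>x::real^2. (2 * B * indicator (cball 0 (B + R)) x)\<^sup>2)"
      by (rule sq_intD, rule sq_int_bounded_support[where B = "\<bar>2 * B\<bar>" and R = "B + R"])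
        (auto simp: indicator_def)
    show "AE x in lborel. norm ((conv (\<beta> k) F x - F x)\<^sup>2) \<le> (2 * B * indicator (cball 0 (B + R)) x)\<^sup>2" for k
    proof (rule AE_I2)
      fix x
      have "\<bar>conv (\<beta> k) F x - 0\<bar> \<le> B"
        by (rule conv_minus_le[OF \<beta>(1) iF]) (use F in simp)
      moreover have "\<bar>conv (\<beta> k) F x - 0\<bar> \<le> 0" if "norm x > B + R"
      proof (rule conv_minus_le[OF \<beta>(1) iF])
        fix y assume "\<beta> k (y - x) \<noteq> 0"
        then have "norm (y - x) < R" using \<beta>(2)[of k "y - x"] R(2)[of k] by (meson abs_ge_self not_le order_le_less_trans order_less_le_trans order_trans)
        then have "norm y > B" using that norm_triangle_sub[of x y] by (simp add: norm_minus_commute)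
        then show "\<bar>F y - 0\<bar> \<le> 0" using F(3) by simp
      qed
      ultimately have "\<bar>conv (\<beta> k) F x - F x\<bar> \<le> 2 * B * indicator (cball 0 (B + R)) x"
        using F(2)[of x] F(3)[of x] R(1) by (cases "norm x > B + R") (auto simp: indicator_def)
      from power_mono[OF this, of 2] show "norm ((conv (\<beta> k) F x - F x)\<^sup>2) \<le> (2 * B * indicator (cball 0 (B + R)) x)\<^sup>2"
        by simp
    qed
  qed auto
  then show ?thesis by simp
qed

text \<open>The error splits into conv (f - F), conv F - F and F - f for a continuous F close to f;
  the first is dominated by the last through the contraction property. Each squared error is below
  e/9 and carries a factor 3.\<close>

proposition conv_tendsto_L2:
  assumes \<beta>: "\<And>k. kernel (\<beta> k)" "\<And>k x. norm x \<ge> r k \<Longrightarrow> \<beta> k x = 0" and r: "r \<longlonglongrightarrow> 0"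
    and f: "integrable lborel f" "sq_int f"
  shows "(\<lambda>k. LINT x|lborel. (conv (\<beta> k) f x - f x)\<^sup>2) \<longlonglongrightarrow> 0"
proof (rule LIMSEQ_I)
  fix e :: real assume e: "e > 0"
  then have e9: "e / 9 > 0" by simp
  obtain F B where F: "continuous_on UNIV F" "\<And>x. \<bar>F x\<bar> \<le> B" "\<And>x. norm x > B \<Longrightarrow> F x = 0"
    and fF: "(LINT x|lborel. (f x - F x)\<^sup>2) < e / 9"
    using dense_continuous[OF f(2) e9] by blast
  have [measurable]: "F \<in> borel_measurable borel" using F(1) by (rule borel_measurable_continuous_onI)
  have sF: "sq_int F"
    by (rule sq_int_bounded_support(1)[OF _ F(2,3)]) simp
  have iF: "integrable lborel F"
    by (rule sq_int_bounded_support(2)[OF _ F(2,3)]) simp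
  have t: "test_fun UNIV (\<beta> k)" for k using \<beta>(1)[of k] by (simp add: kernel_def)
  have "(\<lambda>k. LINT x|lborel. (conv (\<beta> k) F x - F x)\<^sup>2) \<longlonglongrightarrow> 0"
    by (rule conv_tendsto_continuous[where \<beta> = \<beta> and r = r and B = B]; fact)
  from LIMSEQ_D[OF this e9]
  obtain K where K: "\<And>k. k \<ge> K \<Longrightarrow> \<bar>LINT x|lborel. (conv (\<beta> k) F x - F x)\<^sup>2\<bar> < e / 9"
    by (simp only: diff_zero real_norm_def) blast
  have "norm (LINT x|lborel. (conv (\<beta> k) f x - f x)\<^sup>2) < e" if k: "k \<ge> K" for k
  proof -
    have sd: "sq_int (\<lambda>x. f x - F x)" "integrable lborel (\<lambda>x. f x - F x)"
      using f iF sF by (auto intro: sq_int_diff)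
    note d = conv_L2[OF \<beta>(1)[of k] sd(2,1)]
    have com: "(LINT x|lborel. (F x - f x)\<^sup>2) = (LINT x|lborel. (f x - F x)\<^sup>2)"
      by (intro Bochner_Integration.integral_cong power2_commute refl)
    have "(LINT x|lborel. (conv (\<beta> k) f x - f x)\<^sup>2) =
       (LINT x|lborel. (conv (\<beta> k) (\<lambda>x. f x - F x) x + (conv (\<beta> k) F x - F x) + (F x - f x))\<^sup>2)"
      by (simp add: conv_diff[OF t f(1) iF])
    also have "\<dots> \<le> 3 * (LINT x|lborel. (conv (\<beta> k) (\<lambda>x. f x - F x) x)\<^sup>2)
      + 3 * (LINT x|lborel. (conv (\<beta> k) F x - F x)\<^sup>2) + 3 * (LINT x|lborel. (F x - f x)\<^sup>2)"
      by (intro integral_sq_le_3 d(1) sq_int_diff conv_L2(1)[OF \<beta>(1) iF sF] sF f)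
    also have "\<dots> \<le> 3 * (LINT x|lborel. (f x - F x)\<^sup>2)
      + 3 * (LINT x|lborel. (conv (\<beta> k) F x - F x)\<^sup>2) + 3 * (LINT x|lborel. (f x - F x)\<^sup>2)"
      using d(2) com by linarith
    also have "\<dots> < e" using fF K[OF k] by simp
    finally have "(LINT x|lborel. (conv (\<beta> k) f x - f x)\<^sup>2) < e" .
    moreover have "0 \<le> (LINT x|lborel. (conv (\<beta> k) f x - f x)\<^sup>2)"
      by (rule integral_nonneg_AE) simp
    ultimately show ?thesis unfolding real_norm_def by linarith
  qed
  then show "\<exists>K. \<forall>k\<ge>K. norm ((LINT x|lborel. (conv (\<beta> k) f x - f x)\<^sup>2) - 0) < e"
    unfolding diff_zero by blast
qed

section \<open>Kernels of small support, rescaled cutoffs, approximation by test functions\<close>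

lemma ex_kernel:
  assumes "e > 0" obtains \<beta> where "kernel \<beta>" "\<And>x. norm x \<ge> e \<Longrightarrow> \<beta> x = 0"
proof -
  let ?b = "bump e :: real^2 \<Rightarrow> real"
  have t: "test_fun UNIV ?b"
    by (rule test_fun_support[where K = "cball 0 e"]) (use assms in \<open>auto simp: smooth_fun_bump bump_eq_0\<close>)
  define I where "I = (LINT x|lborel. ?b x)"
  have int: "integrable lborel ?b" using t by (rule test_fun_integrable)
  have "I > 0"
  proof (rule ccontr)
    assume "\<not> I > 0"
    moreover have "I \<ge> 0" unfolding I_def by (rule integral_nonneg_AE) (simp add: bump_nonneg)
    ultimately have "I = 0" by simp
    then have "AE x in lborel. ?b x = 0"
      using integral_nonneg_eq_0_iff_AE[OF int] by (simp add: I_def bump_nonneg)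
    then have "AE x in lborel. x \<notin> ball (0 :: real^2) e"
      by eventually_elim (use assms bump_pos_iff[of e] in \<open>auto simp: less_le\<close>)
    then have "emeasure lborel (ball (0 :: real^2) e) = 0"
      by (subst (asm) AE_iff_measurable[where N = "ball (0 :: real^2) e"]) auto
    then have "ball (0 :: real^2) e \<in> null_sets lebesgue"
      by (auto simp: null_sets_def)
    then have "negligible (ball (0 :: real^2) e)"
      by (simp add: negligible_iff_null_sets)
    then show False using open_not_negligible[of "ball (0 :: real^2) e"] assms by simp
  qed
  have "kernel (\<lambda>x. ?b x * (1 / I))"
    unfolding kernel_def using \<open>I > 0\<close> test_fun_mult_left[OF t smooth_fun_const, of "1 / I"]
    by (auto simp: bump_nonneg I_def[symmetric])
  then show ?thesis
    using that[of "\<lambda>x. ?b x * (1 / I)"] assms by (simp add: bump_eq_0)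
qed

lemma test_fun_affine:
  assumes "test_fun UNIV \<phi>" "s \<noteq> 0"
  shows "test_fun UNIV (\<lambda>x. \<phi> (s *\<^sub>R x + c))"
proof (rule test_fun_support[where K = "(\<lambda>y. (1 / s) *\<^sub>R (y - c)) ` closure {x. \<phi> x \<noteq> 0}"])
  show "compact ((\<lambda>y. (1 / s) *\<^sub>R (y - c)) ` closure {x. \<phi> x \<noteq> 0})"
    using assms(1) by (intro compact_continuous_image continuous_intros) (simp add: test_fun_def)
  fix x assume *: "x \<notin> (\<lambda>y. (1 / s) *\<^sub>R (y - c)) ` closure {x. \<phi> x \<noteq> 0}"
  show "\<phi> (s *\<^sub>R x + c) = 0"
  proof (rule ccontr)
    assume "\<phi> (s *\<^sub>R x + c) \<noteq> 0"
    then have "s *\<^sub>R x + c \<in> closure {x. \<phi> x \<noteq> 0}"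
      using closure_subset[of "{x. \<phi> x \<noteq> 0}"] by auto
    then show False using * assms(2) by (force simp: image_iff)
  qed
qed (use assms in \<open>auto intro: smooth_fun_affine test_fun_smooth\<close>)

lemma pderiv2_affine:
  assumes "smooth_fun f"
  shows "pderiv2 (\<lambda>x. f (s *\<^sub>R x + c)) j x = s * pderiv2 f j (s *\<^sub>R x + c)"
proof -
  have "((\<lambda>x. f (s *\<^sub>R x + c)) has_derivative
      (\<lambda>h. frechet_derivative f (at (s *\<^sub>R x + c)) (s *\<^sub>R h))) (at x)"
    by (rule has_derivative_compose[where g = f])
      (auto intro!: derivative_eq_intros smooth_fun_has_derivative assms)
  from pderiv2_eqI[OF this] show ?thesis
    using has_derivative_linear[OF smooth_fun_has_derivative[OF assms]]
    by (simp add: linear_cmul pderiv2_def)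
qed

definition cube :: "real^2 \<Rightarrow> real \<Rightarrow> (real^2) set" where
  "cube c r = {x. \<forall>i. \<bar>x $ i - c $ i\<bar> < r}"

lemma cube_eq_box: "cube c r = box (\<chi> i. c $ i - r) (\<chi> i. c $ i + r)"
  by (auto simp: cube_def mem_box_cart abs_less_iff algebra_simps)

lemma open_cube [simp]: "open (cube c r)"
  unfolding cube_eq_box by (rule open_box)

lemma cube_borel [measurable, simp]: "cube c r \<in> sets borel"
  by (intro borel_open open_cube)

lemma cube_subset_cbox: "cube c r \<subseteq> cbox (\<chi> i. c $ i - r) (\<chi> i. c $ i + r)"
  unfolding cube_eq_box by (rule box_subset_cbox)

lemma conv_nonneg:
  assumes "kernel \<beta>" "\<And>x. f x \<ge> 0" shows "conv \<beta> f x \<ge> 0"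
  unfolding conv_def using assms by (intro integral_nonneg_AE) (auto simp: kernel_def)

text \<open>The bound K / r with K fixed is the scale-invariant form of a gradient bound; the
  transition from 1 to 0 takes place in the annulus used for hole filling.\<close>

definition cutoff :: "real \<Rightarrow> (real^2) set \<Rightarrow> real^2 \<Rightarrow> real \<Rightarrow> (real^2 \<Rightarrow> real) \<Rightarrow> bool" where
  "cutoff K \<Omega> c r \<eta> \<longleftrightarrow> test_fun \<Omega> \<eta> \<and> (\<forall>x. 0 \<le> \<eta> x \<and> \<eta> x \<le> 1) \<and>
      (\<forall>x\<in>cube c r. \<eta> x = 1) \<and> (\<forall>x. x \<notin> cube c (3 * r) \<longrightarrow> \<eta> x = 0) \<and> (\<forall>j x. \<bar>pderiv2 \<eta> j x\<bar> \<le> K / r)"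

text \<open>One profile, the indicator of the square of half-side 2 mollified at radius 1, is
  rescaled by x -> (x - c) / r; hence K is independent of c, r and \<Omega>. The square of half-side
  4 r leaves room for the closed one of half-side 3 r that contains the support.\<close>

lemma ex_cutoff:
  obtains K where "K > 0"
    "\<And>c r \<Omega>. r > 0 \<Longrightarrow> cube c (4 * r) \<subseteq> \<Omega> \<Longrightarrow> \<exists>\<eta>. cutoff K \<Omega> c r \<eta>"
proof -
  obtain \<beta> where \<beta>: "kernel \<beta>" "\<And>x. norm x \<ge> 1 \<Longrightarrow> \<beta> x = 0"
    using ex_kernel[of 1] by auto
  let ?f = "indicator (cube 0 2) :: real^2 \<Rightarrow> real"
  have f: "integrable lborel ?f"
    by (intro integrable_real_indicator emeasure_bounded_finite) (auto simp: cube_eq_box)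
  have t: "test_fun UNIV \<beta>" using \<beta>(1) by (simp add: kernel_def)
  define H where "H = conv \<beta> ?f"
  have near: "\<bar>y $ i - x $ i\<bar> < 1" if "\<beta> (y - x) \<noteq> 0" for x y i
  proof -
    have "norm (y - x) < 1" using \<beta>(2)[of "y - x"] that by force
    then show ?thesis using component_le_norm_cart[of "y - x" i] by simp
  qed
  have H1: "H x = 1" if "x \<in> cube 0 1" for x
  proof -
    have "\<bar>H x - 1\<bar> \<le> 0" unfolding H_def
    proof (rule conv_minus_le[OF \<beta>(1) f])
      fix y assume "\<beta> (y - x) \<noteq> 0"
      then have "\<bar>y $ i\<bar> < 2" for i
        using near[of y x i] that by (auto simp: cube_def dest!: spec[of _ i])
      then have "y \<in> cube 0 2" by (simp add: cube_def)
      then show "\<bar>?f y - 1\<bar> \<le> 0" by simp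
    qed
    then show ?thesis by simp
  qed
  have H0: "H x = 0" if "x \<notin> cube 0 3" for x
  proof -
    have "\<bar>H x - 0\<bar> \<le> 0" unfolding H_def
    proof (rule conv_minus_le[OF \<beta>(1) f])
      fix y assume *: "\<beta> (y - x) \<noteq> 0"
      from that have "\<exists>i. \<not> \<bar>x $ i - 0 $ i\<bar> < 3" unfolding cube_def by blast
      then obtain i where "\<not> \<bar>x $ i - 0 $ i\<bar> < 3" ..
      then have "\<bar>x $ i\<bar> \<ge> 3" by simp
      then have "\<not> \<bar>y $ i\<bar> < 2" using near[of y x i] * by auto
      then have "y \<notin> cube 0 2" by (auto simp: cube_def)
      then show "\<bar>?f y - 0\<bar> \<le> 0" by simp
    qed
    then show ?thesis by simp
  qed
  have Hge: "H x \<ge> 0" for x unfolding H_def by (rule conv_nonneg[OF \<beta>(1)]) simp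
  have Hle: "H x \<le> 1" for x
  proof -
    \<comment> \<open>Both values of the indicator have distance 1/2 from 1/2, so its averages do
      not leave [0, 1].\<close>
    have "\<bar>H x - 1 / 2\<bar> \<le> 1 / 2" unfolding H_def
      by (rule conv_minus_le[OF \<beta>(1) f]) (auto simp: indicator_def)
    then show ?thesis by linarith
  qed
  have sm: "smooth_fun H" unfolding H_def by (rule smooth_fun_conv[OF t f])
  have tH: "test_fun UNIV H"
    by (rule test_fun_support[OF sm compact_cbox]) (use H0 cube_subset_cbox[of 0 3] in blast)+
  have "\<exists>B>0. \<forall>x. \<bar>pderiv2 H j x\<bar> \<le> B" for j
    using test_fun_bounded[OF test_fun_pderiv2[OF tH, of j]] by metis
  then obtain B where B: "\<And>j. B j > 0" "\<And>j x. \<bar>pderiv2 H j x\<bar> \<le> B j"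
    by metis
  have BB: "\<bar>pderiv2 H j x\<bar> \<le> B 1 + B 2" for j x
    using B(2)[of j x] B(1)[of 1] B(1)[of 2] exhaust_2[of j] by auto
  show ?thesis
  proof (rule that[of "B 1 + B 2"])
    show "B 1 + B 2 > 0" using B(1)[of 1] B(1)[of 2] by simp
    fix c \<Omega> and r :: real assume r: "r > 0" and sub: "cube c (4 * r) \<subseteq> \<Omega>"
    define d :: "real^2" where "d = - ((1 / r) *\<^sub>R c)"
    let ?h = "\<lambda>x. H ((1 / r) *\<^sub>R x + d)"
    have mem: "(1 / r) *\<^sub>R x + d \<in> cube 0 s \<longleftrightarrow> x \<in> cube c (s * r)" for x s
    proof -
      have "\<bar>x $ i / r - c $ i / r\<bar> = \<bar>x $ i - c $ i\<bar> / r" for i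
        using r by (simp add: diff_divide_distrib[symmetric])
      then show ?thesis using r by (simp add: cube_def d_def field_simps)
    qed
    have "\<bar>pderiv2 ?h j x\<bar> \<le> (B 1 + B 2) / r" for j x
      unfolding pderiv2_affine[OF sm] using BB[of j "(1 / r) *\<^sub>R x + d"] r
      by (simp add: abs_mult divide_right_mono)
    moreover have "test_fun \<Omega> ?h"
    proof (rule test_fun_support[OF smooth_fun_affine[OF sm] compact_cbox])
      show "cbox (\<chi> i. c $ i - 3 * r) (\<chi> i. c $ i + 3 * r) \<subseteq> \<Omega>"
      proof (rule order_trans[OF _ sub], rule subsetI)
        fix x assume "x \<in> cbox (\<chi> i. c $ i - 3 * r) (\<chi> i. c $ i + 3 * r)"
        then have b: "c $ i - 3 * r \<le> x $ i \<and> x $ i \<le> c $ i + 3 * r" for i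
          by (simp add: mem_box_cart)
        have "\<bar>x $ i - c $ i\<bar> < 4 * r" for i using r b[of i] by (simp add: abs_less_iff)
        then show "x \<in> cube c (4 * r)" by (simp add: cube_def)
      qed
      show "?h x = 0" if "x \<notin> cbox (\<chi> i. c $ i - 3 * r) (\<chi> i. c $ i + 3 * r)" for x
        using that mem[of x 3] H0 cube_subset_cbox by blast
    qed
    ultimately show "\<exists>\<eta>. cutoff (B 1 + B 2) \<Omega> c r \<eta>"
      using Hge Hle mem[of _ 1] mem[of _ 3] H1 H0
      by (intro exI[of _ ?h]) (simp add: cutoff_def)
  qed
qed

lemma sq_int_integrable:
  assumes "sq_int f" "bounded K" "\<And>x. x \<notin> K \<Longrightarrow> f x = 0"
  shows "integrable lborel f"
proof -
  obtain R where R: "\<And>x. x \<in> K \<Longrightarrow> norm x \<le> R" using assms(2) by (auto simp: bounded_iff)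
  have "sq_int (indicator (cball 0 R))"
    by (rule sq_int_bounded_support[where B = 1 and R = R]) (auto simp: indicator_def intro!: borel_measurable_indicator)
  from sq_int_prod[OF assms(1) this]
  have "integrable lborel (\<lambda>x. f x * indicator (cball 0 R) x)" .
  moreover have "f x * indicator (cball 0 R) x = f x" for x
    using assms(3)[of x] R[of x] by (auto simp: indicator_def)
  ultimately show ?thesis by simp
qed

text \<open>Mollification at radius at most e keeps the support inside the e-neighbourhood of K,
  which lies in \<Omega>. The weak identity turns derivatives of mollified f into mollifications of
  g by the same kernels, so one L2 convergence result serves both.\<close>

lemma mollify_approx:
  assumes \<Omega>: "open \<Omega>" "compact K" "K \<subseteq> \<Omega>"
    and f: "sq_int f" "\<And>x. x \<notin> K \<Longrightarrow> f x = 0"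
    and g: "\<And>j. sq_int (g j)" "\<And>j x. x \<notin> K \<Longrightarrow> g j x = 0"
    and weak: "\<And>\<phi> j. test_fun UNIV \<phi> \<Longrightarrow>
      (LINT x|lborel. f x * pderiv2 \<phi> j x) = - (LINT x|lborel. g j x * \<phi> x)"
  obtains \<psi> :: "nat \<Rightarrow> real^2 \<Rightarrow> real" where "\<And>k. test_fun \<Omega> (\<psi> k)"
    "(\<lambda>k. LINT x|lborel. (\<psi> k x - f x)\<^sup>2) \<longlonglongrightarrow> 0"
    "\<And>j. (\<lambda>k. LINT x|lborel. (pderiv2 (\<psi> k) j x - g j x)\<^sup>2) \<longlonglongrightarrow> 0"
proof -
  obtain e where e: "e > 0" and sub: "(\<Union>x\<in>K. cball x e) \<subseteq> \<Omega>"
    using compact_subset_open_imp_cball_epsilon_subset[OF \<Omega>(2,1,3)] by metis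
  define r where "r k = e / real (Suc k)" for k
  have r: "r k > 0" "r k \<le> e" for k using e by (auto simp: r_def field_simps)
  have "\<exists>\<beta>. kernel \<beta> \<and> (\<forall>x. norm x \<ge> r k \<longrightarrow> \<beta> x = 0)" for k
    using ex_kernel[OF r(1)[of k]] by metis
  then obtain \<beta> where \<beta>: "\<And>k. kernel (\<beta> k)" "\<And>k x. norm x \<ge> r k \<Longrightarrow> \<beta> k x = 0"
    by metis
  have t: "test_fun UNIV (\<beta> k)" for k using \<beta>(1)[of k] by (simp add: kernel_def)
  have r0: "r \<longlonglongrightarrow> 0"
    unfolding r_def using LIMSEQ_Suc[OF tendsto_divide_0[OF tendsto_const filterlim_real_sequentially[THEN filterlim_at_top_imp_at_infinity], of e]] by simp
  have fi: "integrable lborel f" and gi: "\<And>j. integrable lborel (g j)"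
    using sq_int_integrable[OF f(1) compact_imp_bounded[OF \<Omega>(2)]] f(2)
      sq_int_integrable[OF g(1) compact_imp_bounded[OF \<Omega>(2)]] g(2) by blast+
  have d: "pderiv2 (conv (\<beta> k) f) j x = conv (\<beta> k) (g j) x" for k j x
  proof -
    let ?\<phi> = "\<lambda>y. \<beta> k (1 *\<^sub>R y + (- x))"
    \<comment> \<open>For fixed x the shifted kernel is itself a test function. The minus sign of
      the weak identity cancels the one in the derivative of \<open>conv\<close>.\<close>
    have "conv (pderiv2 (\<beta> k) j) f x = (LINT y|lborel. f y * pderiv2 ?\<phi> j y)"
      unfolding conv_def pderiv2_affine[OF test_fun_smooth[OF t]] by (simp add: mult.commute)
    also have "\<dots> = - (LINT y|lborel. g j y * ?\<phi> y)"
      by (rule weak[OF test_fun_affine[OF t]]) simp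
    also have "\<dots> = - conv (\<beta> k) (g j) x"
      by (simp add: conv_def mult.commute)
    finally show ?thesis
      unfolding pderiv2_conv[OF t fi] by simp
  qed
  show ?thesis
  proof (rule that[of "\<lambda>k. conv (\<beta> k) f"])
    fix k
    show "test_fun \<Omega> (conv (\<beta> k) f)"
    proof (rule test_fun_support[OF smooth_fun_conv[OF t fi]])
      show "compact {x + y | x y. x \<in> K \<and> y \<in> cball 0 e}"
        by (rule compact_sums[OF \<Omega>(2) compact_cball])
      show "{x + y | x y. x \<in> K \<and> y \<in> cball 0 e} \<subseteq> \<Omega>"
        using sub by (force simp: dist_norm)
      fix x assume x: "x \<notin> {x + y | x y. x \<in> K \<and> y \<in> cball 0 e}"
      have "\<bar>conv (\<beta> k) f x - 0\<bar> \<le> 0"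
      proof (rule conv_minus_le[OF \<beta>(1) fi])
        fix y assume "\<beta> k (y - x) \<noteq> 0"
        then have "norm (y - x) < r k" using \<beta>(2)[of k "y - x"] by (meson not_le)
        then have "norm (x - y) \<le> e" using r(2)[of k] by (simp add: norm_minus_commute)
        then have "y \<notin> K"
          using x by (force intro: exI[of _ y] exI[of _ "x - y"])
        then show "\<bar>f y - 0\<bar> \<le> 0" using f(2) by simp
      qed
      then show "conv (\<beta> k) f x = 0" by simp
    qed
  next
    show "(\<lambda>k. LINT x|lborel. (conv (\<beta> k) f x - f x)\<^sup>2) \<longlonglongrightarrow> 0"
      by (rule conv_tendsto_L2[where r = r]; fact)
    show "(\<lambda>k. LINT x|lborel. (pderiv2 (conv (\<beta> k) f) j x - g j x)\<^sup>2) \<longlonglongrightarrow> 0" for j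
      unfolding d by (rule conv_tendsto_L2[where r = r]; fact)
  qed
qed

subsection \<open>Borel representatives of Sobolev functions\<close>

text \<open>The working form of \<open>W12\<close>: Borel representatives on the whole plane that
  vanish off \<Omega>, with integrals against \<open>lborel\<close>. The weak identity is tested
  only by functions supported in \<Omega>, so nothing is asserted across the boundary.\<close>

definition sobolev :: "(real^2) set \<Rightarrow> (real^2 \<Rightarrow> real^2) \<Rightarrow> (real^2 \<Rightarrow> real^2^2) \<Rightarrow> bool" where
  "sobolev \<Omega> u Du \<longleftrightarrow> (\<forall>i. sq_int (\<lambda>x. u x $ i)) \<and> (\<forall>i j. sq_int (\<lambda>x. Du x $ i $ j)) \<and>
    (\<forall>x. x \<notin> \<Omega> \<longrightarrow> u x = 0 \<and> Du x = 0) \<and>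
    (\<forall>\<phi>. test_fun \<Omega> \<phi> \<longrightarrow> (\<forall>i j.
      (LINT x|lborel. u x $ i * pderiv2 \<phi> j x) = - (LINT x|lborel. Du x $ i $ j * \<phi> x)))"

lemma LINT_lebesgue_eq:
  fixes F :: "real^2 \<Rightarrow> real"
  assumes "F \<in> borel_measurable borel" "\<And>x. x \<notin> \<Omega> \<Longrightarrow> F x = 0"
  shows "(LINT x:\<Omega>|lebesgue. F x) = (LINT x|lborel. F x)"
proof -
  have "(\<lambda>x. indicator \<Omega> x *\<^sub>R F x) = F"
    using assms(2) by (auto simp: indicator_def fun_eq_iff)
  then show ?thesis
    using assms(1) by (simp add: set_lebesgue_integral_def integral_completion)
qed

lemma borel_measurable_vecI:
  fixes f :: "'a \<Rightarrow> 'b::euclidean_space^'n"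
  assumes "\<And>i. (\<lambda>x. f x $ i) \<in> borel_measurable M"
  shows "f \<in> borel_measurable M"
  by (subst borel_measurable_euclidean_space) (auto simp: Basis_vec_def inner_axis intro!: borel_measurable_inner assms)

lemma borel_measurable_nth:
  fixes f :: "'a \<Rightarrow> 'b::euclidean_space^'n"
  assumes "f \<in> borel_measurable M" shows "(\<lambda>x. f x $ i) \<in> borel_measurable M"
  by (rule measurable_compose[OF assms borel_measurable_continuous_onI]) (intro continuous_intros)

lemma power2_norm_vec: "(norm (x :: 'a::real_inner^2))\<^sup>2 = (norm (x $ 1))\<^sup>2 + (norm (x $ 2))\<^sup>2"
  by (simp add: power2_norm_eq_inner inner_vec_def sum_2)

lemma power2_norm_mat: "(norm (A :: real^2^2))\<^sup>2 = (\<Sum>i\<in>UNIV. \<Sum>j\<in>UNIV. (A $ i $ j)\<^sup>2)"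
  by (simp add: power2_norm_vec sum_2)

lemma sobolev_borel:
  assumes "sobolev \<Omega> u Du"
  shows "u \<in> borel_measurable borel" "Du \<in> borel_measurable borel"
    "(\<lambda>x. u x $ i) \<in> borel_measurable borel" "(\<lambda>x. Du x $ i $ j) \<in> borel_measurable borel"
proof -
  show 1: "(\<lambda>x. u x $ i) \<in> borel_measurable borel" "(\<lambda>x. Du x $ i $ j) \<in> borel_measurable borel" for i j
    using assms unfolding sobolev_def sq_int_def by auto
  show "u \<in> borel_measurable borel" by (rule borel_measurable_vecI) (rule 1)
  show "Du \<in> borel_measurable borel" by (intro borel_measurable_vecI 1)
qed

lemma set_integrable_lebesgue:
  fixes F :: "real^2 \<Rightarrow> real"
  assumes "integrable lborel F" "\<Omega> \<in> sets lebesgue"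
  shows "set_integrable lebesgue \<Omega> F"
proof -
  have "integrable lebesgue F" using assms(1) by (auto simp: integrable_completion)
  then show ?thesis unfolding set_integrable_def
    by (rule integrable_mult_indicator[OF assms(2)])
qed

text \<open>The way back is required because stationarity quantifies over \<open>W012\<close>, which
  is defined through \<open>W12\<close>.\<close>

lemma sobolev_W12:
  assumes \<Omega>: "open \<Omega>" and s: "sobolev \<Omega> u Du"
  shows "W12 \<Omega> u Du"
proof -
  note b = sobolev_borel[OF s]
  have O: "\<Omega> \<in> sets lebesgue" using \<Omega> by auto
  have sq: "sq_int (\<lambda>x. u x $ i)" "sq_int (\<lambda>x. Du x $ i $ j)" for i j
    using s unfolding sobolev_def by auto
  have z: "u x = 0" "Du x = 0" if "x \<notin> \<Omega>" for x
    using s that unfolding sobolev_def by auto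
  have "integrable lborel (\<lambda>x. (norm (u x))\<^sup>2)"
    unfolding power2_norm_vec using sq by (auto simp: sq_int_def)
  moreover have "integrable lborel (\<lambda>x. (norm (Du x))\<^sup>2)"
    unfolding power2_norm_mat using sq by (auto simp: sq_int_def)
  moreover have "(LINT x:\<Omega>|lebesgue. u x $ i * pderiv2 \<phi> j x) = - (LINT x:\<Omega>|lebesgue. Du x $ i $ j * \<phi> x)"
    if t: "test_fun \<Omega> \<phi>" for \<phi> i j
  proof -
    have m: "\<phi> \<in> borel_measurable borel" "pderiv2 \<phi> j \<in> borel_measurable borel"
      using t by (auto intro: smooth_fun_borel test_fun_smooth smooth_fun_pderiv2)
    have "(LINT x:\<Omega>|lebesgue. u x $ i * pderiv2 \<phi> j x) = (LINT x|lborel. u x $ i * pderiv2 \<phi> j x)"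
      by (rule LINT_lebesgue_eq) (use z m b in auto)
    moreover have "(LINT x:\<Omega>|lebesgue. Du x $ i $ j * \<phi> x) = (LINT x|lborel. Du x $ i $ j * \<phi> x)"
      by (rule LINT_lebesgue_eq) (use z m b in auto)
    ultimately show ?thesis using s t unfolding sobolev_def by simp
  qed
  ultimately show ?thesis
    unfolding W12_def L2_on_def weak_grad_def set_borel_measurable_def
    using b(1,2) O \<Omega>
    by (auto intro!: borel_open set_integrable_lebesgue borel_measurable_scaleR borel_measurable_indicator measurable_completion)
qed

lemma ex_borel_vec:
  fixes f :: "real^2 \<Rightarrow> 'b::euclidean_space"
  assumes "f \<in> borel_measurable lebesgue"
  obtains g where "g \<in> borel_measurable borel" "AE x in lebesgue. g x = f x"
proof -
  have "\<exists>g\<in>borel_measurable lborel. AE x in lborel. f x \<bullet> b = g x" for b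
    by (rule completion_ex_borel_measurable_real) (use assms in auto)
  then obtain h where h: "\<And>b. h b \<in> borel_measurable lborel" "\<And>b. AE x in lborel. f x \<bullet> b = h b x"
    by metis
  have "AE x in lborel. \<forall>b\<in>Basis. f x \<bullet> b = h b x"
    using h(2) by (simp add: AE_ball_countable countable_finite)
  then have "AE x in lborel. (\<Sum>b\<in>Basis. h b x *\<^sub>R b) = f x"
  proof eventually_elim
    case (elim x)
    then have "(\<Sum>b\<in>Basis. h b x *\<^sub>R b) = (\<Sum>b\<in>Basis. (f x \<bullet> b) *\<^sub>R b)" by simp
    then show ?case by (simp add: euclidean_representation)
  qed
  then show ?thesis
    using h(1) by (intro that[of "\<lambda>x. \<Sum>b\<in>Basis. h b x *\<^sub>R b"])
      (auto intro!: AE_completion borel_measurable_sum borel_measurable_scaleR)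
qed

text \<open>u and Du are multiplied by the indicator of \<Omega> and then changed on a null set to
  become Borel; the integrals in the weak identity do not see this.\<close>

lemma W12_ex_sobolev:
  assumes \<Omega>: "open \<Omega>" and w: "W12 \<Omega> u Du"
  obtains v Dv where "sobolev \<Omega> v Dv" "AE x in lebesgue. x \<in> \<Omega> \<longrightarrow> v x = u x \<and> Dv x = Du x"
proof -
  have O: "\<Omega> \<in> sets borel" "\<Omega> \<in> sets lebesgue" using \<Omega> by auto
  have m: "(\<lambda>x. indicator \<Omega> x *\<^sub>R u x) \<in> borel_measurable lebesgue"
    "(\<lambda>x. indicator \<Omega> x *\<^sub>R Du x) \<in> borel_measurable lebesgue"
    and i: "integrable lebesgue (\<lambda>x. indicator \<Omega> x *\<^sub>R (norm (u x))\<^sup>2)"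
    "integrable lebesgue (\<lambda>x. indicator \<Omega> x *\<^sub>R (norm (Du x))\<^sup>2)"
    using w unfolding W12_def L2_on_def set_borel_measurable_def set_integrable_def by auto
  obtain v0 where v0: "v0 \<in> borel_measurable borel" "AE x in lebesgue. v0 x = indicator \<Omega> x *\<^sub>R u x"
    using ex_borel_vec[OF m(1)] by blast
  obtain D0 where D0: "D0 \<in> borel_measurable borel" "AE x in lebesgue. D0 x = indicator \<Omega> x *\<^sub>R Du x"
    using ex_borel_vec[OF m(2)] by blast
  define v where "v x = indicator \<Omega> x *\<^sub>R v0 x" for x
  define Dv where "Dv x = indicator \<Omega> x *\<^sub>R D0 x" for x
  have b: "v \<in> borel_measurable borel" "Dv \<in> borel_measurable borel"
    unfolding v_def[abs_def] Dv_def[abs_def] using v0(1) D0(1) O by (auto intro!: borel_measurable_scaleR)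
  have aev: "AE x in lebesgue. v x = indicator \<Omega> x *\<^sub>R u x"
    using v0(2) by eventually_elim (auto simp: v_def indicator_def)
  have aeD: "AE x in lebesgue. Dv x = indicator \<Omega> x *\<^sub>R Du x"
    using D0(2) by eventually_elim (auto simp: Dv_def indicator_def)
  have bc: "(\<lambda>x. v x $ i) \<in> borel_measurable borel" "(\<lambda>x. Dv x $ i $ j) \<in> borel_measurable borel" for i j
    using b by (auto intro!: borel_measurable_nth)
  have z: "v x = 0" "Dv x = 0" if "x \<notin> \<Omega>" for x
    using that by (auto simp: v_def Dv_def)
  have "integrable lebesgue (\<lambda>x. (norm (v x))\<^sup>2)"
    by (rule integrable_cong_AE_imp[OF i(1)])
      (use aev b(1) in \<open>auto intro!: measurable_completion elim!: eventually_mono simp: indicator_def\<close>)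
  then have iv: "integrable lborel (\<lambda>x. (norm (v x))\<^sup>2)"
    using b(1) by (subst (asm) integrable_completion) auto
  have "integrable lebesgue (\<lambda>x. (norm (Dv x))\<^sup>2)"
    by (rule integrable_cong_AE_imp[OF i(2)])
      (use aeD b(2) in \<open>auto intro!: measurable_completion elim!: eventually_mono simp: indicator_def\<close>)
  then have iD: "integrable lborel (\<lambda>x. (norm (Dv x))\<^sup>2)"
    using b(2) by (subst (asm) integrable_completion) auto
  have sq: "sq_int h" if "h \<in> borel_measurable borel" "integrable lborel (\<lambda>x. (norm (w x))\<^sup>2)" "\<And>x. \<bar>h x\<bar> \<le> norm (w x)"
    for h and w :: "real^2 \<Rightarrow> 'z::real_normed_vector"
  proof -
    have "(h x)\<^sup>2 \<le> (norm (w x))\<^sup>2" for x using power_mono[OF that(3)[of x], of 2] by simp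
    then show ?thesis unfolding sq_int_def
      using that(1) by (auto intro!: Bochner_Integration.integrable_bound[OF that(2)])
  qed
  have "sq_int (\<lambda>x. v x $ i)" for i
    by (rule sq[OF bc(1) iv component_le_norm_cart])
  moreover have "sq_int (\<lambda>x. Dv x $ i $ j)" for i j
    by (rule sq[OF bc(2) iD order_trans[OF component_le_norm_cart Finite_Cartesian_Product.norm_nth_le]])
  moreover have "(LINT x|lborel. v x $ i * pderiv2 \<phi> j x) = - (LINT x|lborel. Dv x $ i $ j * \<phi> x)"
    if t: "test_fun \<Omega> \<phi>" for \<phi> i j
  proof -
    have m': "\<phi> \<in> borel_measurable borel" "pderiv2 \<phi> j \<in> borel_measurable borel"
      using t by (auto intro: smooth_fun_borel test_fun_smooth smooth_fun_pderiv2)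
    have mu: "(\<lambda>x. (indicator \<Omega> x *\<^sub>R u x) $ i) \<in> borel_measurable lebesgue"
      "(\<lambda>x. (indicator \<Omega> x *\<^sub>R Du x) $ i $ j) \<in> borel_measurable lebesgue"
      using m by (auto intro!: borel_measurable_nth simp del: vector_scaleR_component)
    have "(LINT x|lborel. v x $ i * pderiv2 \<phi> j x) = (LINT x|lebesgue. v x $ i * pderiv2 \<phi> j x)"
      using m' bc by (simp add: integral_completion)
    also have "\<dots> = (LINT x|lebesgue. (indicator \<Omega> x *\<^sub>R u x) $ i * pderiv2 \<phi> j x)"
      using aev m' bc mu
      by (intro integral_cong_AE borel_measurable_times) (auto intro!: measurable_completion elim!: eventually_mono)
    also have "\<dots> = (LINT x:\<Omega>|lebesgue. u x $ i * pderiv2 \<phi> j x)"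
      by (simp add: set_lebesgue_integral_def mult.assoc)
    also have "\<dots> = - (LINT x:\<Omega>|lebesgue. Du x $ i $ j * \<phi> x)"
      using w t unfolding W12_def weak_grad_def by blast
    also have "(LINT x:\<Omega>|lebesgue. Du x $ i $ j * \<phi> x) = (LINT x|lebesgue. (indicator \<Omega> x *\<^sub>R Du x) $ i $ j * \<phi> x)"
      by (simp add: set_lebesgue_integral_def mult.assoc)
    also have "\<dots> = (LINT x|lebesgue. Dv x $ i $ j * \<phi> x)"
      using aeD m' bc mu
      by (intro integral_cong_AE borel_measurable_times) (auto intro!: measurable_completion elim!: eventually_mono)
    also have "\<dots> = (LINT x|lborel. Dv x $ i $ j * \<phi> x)"
      using m' bc by (simp add: integral_completion)
    finally show ?thesis .
  qed
  ultimately have "sobolev \<Omega> v Dv"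
    using z unfolding sobolev_def by blast
  moreover have "AE x in lebesgue. x \<in> \<Omega> \<longrightarrow> v x = u x \<and> Dv x = Du x"
    using aev aeD by eventually_elim auto
  ultimately show ?thesis by (rule that)
qed

section \<open>Cut-off Sobolev maps as admissible test maps\<close>

lemma test_fun_mult_integrable:
  assumes "test_fun \<Omega> \<tau>" "integrable lborel f" shows "integrable lborel (\<lambda>x. \<tau> x * f x)"
proof -
  obtain B where "\<And>x. \<bar>\<tau> x\<bar> \<le> B" using test_fun_bounded[OF assms(1)] by metis
  then show ?thesis
    using assms by (intro integrable_bounded_mult) (auto simp: measurable_lborel1 intro: smooth_fun_borel test_fun_smooth)
qed

lemma test_fun_sq_int: "test_fun \<Omega> \<tau> \<Longrightarrow> sq_int \<tau>"
  using test_fun_mult_integrable[OF _ test_fun_integrable, of \<Omega> \<tau> \<Omega> \<tau>]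
  by (auto simp: sq_int_def power2_eq_square intro: smooth_fun_borel test_fun_smooth)

lemma sq_int_test_mult:
  assumes "test_fun \<Omega> \<tau>" "sq_int f" shows "sq_int (\<lambda>x. \<tau> x * f x)"
proof -
  obtain B where "\<And>x. \<bar>\<tau> x\<bar> \<le> B" using test_fun_bounded[OF assms(1)] by metis
  then show ?thesis
    using assms by (intro sq_int_bounded_mult) (auto intro: smooth_fun_borel test_fun_smooth)
qed

text \<open>The product rule for weak derivatives, obtained by testing with \<zeta> \<phi>. The
  constant a drops out since derivatives of test functions have integral 0. Compact support comes
  from \<zeta>, so \<phi> may be any smooth function.\<close>

lemma cutoff_weak:
  assumes s: "sobolev \<Omega> u Du" and \<Omega>: "bounded \<Omega>" and \<zeta>: "test_fun \<Omega> \<zeta>" and \<phi>: "smooth_fun \<phi>"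
  shows "(LINT x|lborel. \<zeta> x * (u x $ i - a) * pderiv2 \<phi> j x) =
    - (LINT x|lborel. (\<zeta> x * Du x $ i $ j + (u x $ i - a) * pderiv2 \<zeta> j x) * \<phi> x)"
proof -
  let ?t = "\<lambda>x. \<zeta> x * \<phi> x"
  have t: "test_fun \<Omega> ?t" by (rule test_fun_mult_left[OF \<zeta> \<phi>])
  have sm: "smooth_fun \<zeta>" using \<zeta> by (rule test_fun_smooth)
  have p: "pderiv2 ?t j x = pderiv2 \<zeta> j x * \<phi> x + \<zeta> x * pderiv2 \<phi> j x" for x
    by (rule pderiv2_mult[OF sm \<phi>])
  have sq: "sq_int (\<lambda>x. u x $ i)" "sq_int (\<lambda>x. Du x $ i $ j)" for i j
    using s unfolding sobolev_def by auto
  have ui: "integrable lborel (\<lambda>x. u x $ i)" and Di: "integrable lborel (\<lambda>x. Du x $ i $ j)" for i j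
    using sq_int_integrable[OF sq(1) \<Omega>] sq_int_integrable[OF sq(2) \<Omega>] s unfolding sobolev_def by auto
  have t1: "test_fun \<Omega> (\<lambda>x. pderiv2 \<zeta> j x * \<phi> x)" by (rule test_fun_mult_left[OF test_fun_pderiv2[OF \<zeta>] \<phi>])
  have t2: "test_fun \<Omega> (\<lambda>x. \<zeta> x * pderiv2 \<phi> j x)" by (rule test_fun_mult_left[OF \<zeta> smooth_fun_pderiv2[OF \<phi>]])
  \<comment> \<open>Both sides are combinations of five integrals; the weak identity reads A1 + A2 =
    - A3, and the integral of a derivative gives A4 + A5 = 0.\<close>
  define A1 where "A1 = (LINT x|lborel. pderiv2 \<zeta> j x * \<phi> x * u x $ i)"
  define A2 where "A2 = (LINT x|lborel. \<zeta> x * pderiv2 \<phi> j x * u x $ i)"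
  define A3 where "A3 = (LINT x|lborel. \<zeta> x * \<phi> x * Du x $ i $ j)"
  define A4 where "A4 = (LINT x|lborel. pderiv2 \<zeta> j x * \<phi> x)"
  define A5 where "A5 = (LINT x|lborel. \<zeta> x * pderiv2 \<phi> j x)"
  note i = test_fun_mult_integrable[OF t1 ui[of i]] test_fun_mult_integrable[OF t2 ui[of i]]
    test_fun_mult_integrable[OF t Di[of i j]] test_fun_integrable[OF t1] test_fun_integrable[OF t2]
  have "(LINT x|lborel. u x $ i * pderiv2 ?t j x) = (LINT x|lborel. pderiv2 \<zeta> j x * \<phi> x * u x $ i + \<zeta> x * pderiv2 \<phi> j x * u x $ i)"
    unfolding p by (simp add: algebra_simps)
  also have "\<dots> = A1 + A2" unfolding A1_def A2_def using i by simp
  finally have "A1 + A2 = - (LINT x|lborel. Du x $ i $ j * ?t x)"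
    using s t unfolding sobolev_def by simp
  then have 1: "A1 + A2 = - A3" by (simp add: A3_def mult.commute)
  have 2: "A4 + A5 = 0"
    using integral_pderiv2_eq_0[OF t, of j] i unfolding p A4_def A5_def by simp
  have "(LINT x|lborel. \<zeta> x * (u x $ i - a) * pderiv2 \<phi> j x) =
      (LINT x|lborel. \<zeta> x * pderiv2 \<phi> j x * u x $ i - a * (\<zeta> x * pderiv2 \<phi> j x))"
    by (simp add: algebra_simps)
  also have "\<dots> = A2 - a * A5" unfolding A2_def A5_def using i by simp
  finally have L: "(LINT x|lborel. \<zeta> x * (u x $ i - a) * pderiv2 \<phi> j x) = A2 - a * A5" .
  have "(LINT x|lborel. (\<zeta> x * Du x $ i $ j + (u x $ i - a) * pderiv2 \<zeta> j x) * \<phi> x) =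
      (LINT x|lborel. \<zeta> x * \<phi> x * Du x $ i $ j + pderiv2 \<zeta> j x * \<phi> x * u x $ i - a * (pderiv2 \<zeta> j x * \<phi> x))"
    by (simp add: algebra_simps)
  also have "\<dots> = A3 + A1 - a * A4" unfolding A3_def A1_def A4_def using i by simp
  finally have R: "(LINT x|lborel. (\<zeta> x * Du x $ i $ j + (u x $ i - a) * pderiv2 \<zeta> j x) * \<phi> x) = A3 + A1 - a * A4" .
  have "A4 = - A5" using 2 by simp
  then show ?thesis unfolding L R using 1 by simp
qed

definition cut :: "(real^2 \<Rightarrow> real) \<Rightarrow> (real^2 \<Rightarrow> real^2) \<Rightarrow> real^2 \<Rightarrow> real^2 \<Rightarrow> real^2" where
  "cut \<zeta> u a x = \<zeta> x *\<^sub>R (u x - a)"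

text \<open>The gradient of \<open>cut \<zeta> u a\<close> by the product rule. With \<zeta> the
  square of a cutoff this belongs to the Caccioppoli test map; with a = 0 and \<zeta> = 1 on a
  square it localizes u itself.\<close>

definition Dcut :: "(real^2 \<Rightarrow> real) \<Rightarrow> (real^2 \<Rightarrow> real^2) \<Rightarrow> (real^2 \<Rightarrow> real^2^2) \<Rightarrow> real^2 \<Rightarrow> real^2 \<Rightarrow> real^2^2" where
  "Dcut \<zeta> u Du a x = (\<chi> i j. \<zeta> x * Du x $ i $ j + (u x $ i - a $ i) * pderiv2 \<zeta> j x)"

lemma cut_sq_int:
  assumes s: "sobolev \<Omega> u Du" and \<zeta>: "test_fun \<Omega> \<zeta>"
  shows "sq_int (\<lambda>x. cut \<zeta> u a x $ i)" "sq_int (\<lambda>x. Dcut \<zeta> u Du a x $ i $ j)"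
proof -
  have sq: "sq_int (\<lambda>x. u x $ i)" "sq_int (\<lambda>x. Du x $ i $ j)" for i j
    using s unfolding sobolev_def by auto
  have const: "sq_int (\<lambda>x. \<tau> x * c)" if t: "test_fun \<Omega> \<tau>" for \<tau> c
    by (rule test_fun_sq_int[OF test_fun_mult_left[OF t smooth_fun_const]])
  have "(\<lambda>x. cut \<zeta> u a x $ i) = (\<lambda>x. \<zeta> x * u x $ i - \<zeta> x * a $ i)"
    by (auto simp: cut_def algebra_simps)
  then show "sq_int (\<lambda>x. cut \<zeta> u a x $ i)"
    by (simp only: sq_int_diff sq_int_test_mult[OF \<zeta>] const[OF \<zeta>] sq)
  have "(\<lambda>x. Dcut \<zeta> u Du a x $ i $ j) =
      (\<lambda>x. \<zeta> x * Du x $ i $ j + (pderiv2 \<zeta> j x * u x $ i - pderiv2 \<zeta> j x * a $ i))"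
    by (auto simp: Dcut_def algebra_simps)
  then show "sq_int (\<lambda>x. Dcut \<zeta> u Du a x $ i $ j)"
    by (simp only: sq_int_diff sq_int_add sq_int_test_mult[OF \<zeta>] sq_int_test_mult[OF test_fun_pderiv2[OF \<zeta>]]
        const[OF test_fun_pderiv2[OF \<zeta>]] sq)
qed

lemma test_fun_support_eq_0:
  assumes "x \<notin> closure {x. \<zeta> x \<noteq> 0}" shows "\<zeta> x = 0" "pderiv2 \<zeta> j x = 0"
proof -
  show "\<zeta> x = 0" using assms closure_subset[of "{x. \<zeta> x \<noteq> 0}"] by auto
  show "pderiv2 \<zeta> j x = 0"
    using assms closure_subset[of "{x. \<zeta> x \<noteq> 0}"]
    by (intro pderiv2_eq_0[of "- closure {x. \<zeta> x \<noteq> 0}" _ _ 0]) auto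
qed

lemma test_fun_out:
  assumes "test_fun \<Omega> \<zeta>" "x \<notin> \<Omega>" shows "\<zeta> x = 0" "pderiv2 \<zeta> j x = 0"
  using test_fun_support_eq_0[of x \<zeta>] assms unfolding test_fun_def by blast+

lemma cut_approx:
  assumes s: "sobolev \<Omega> u Du" and \<Omega>: "open \<Omega>" "bounded \<Omega>" and \<zeta>: "test_fun \<Omega> \<zeta>"
  obtains \<psi> :: "nat \<Rightarrow> real^2 \<Rightarrow> real" where "\<And>k. test_fun \<Omega> (\<psi> k)"
    "(\<lambda>k. LINT x|lborel. (\<psi> k x - cut \<zeta> u a x $ i)\<^sup>2) \<longlonglongrightarrow> 0"
    "\<And>j. (\<lambda>k. LINT x|lborel. (pderiv2 (\<psi> k) j x - Dcut \<zeta> u Du a x $ i $ j)\<^sup>2) \<longlonglongrightarrow> 0"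
proof (rule mollify_approx[OF \<Omega>(1), where K = "closure {x. \<zeta> x \<noteq> 0}" and f = "\<lambda>x. cut \<zeta> u a x $ i"
        and g = "\<lambda>j x. Dcut \<zeta> u Du a x $ i $ j"])
  show "sq_int (\<lambda>x. cut \<zeta> u a x $ i)" "sq_int (\<lambda>x. Dcut \<zeta> u Du a x $ i $ j)" for j
    using cut_sq_int[OF s \<zeta>] by auto
  show "(LINT x|lborel. cut \<zeta> u a x $ i * pderiv2 \<phi> j x) =
       - (LINT x|lborel. Dcut \<zeta> u Du a x $ i $ j * \<phi> x)" if "test_fun UNIV \<phi>" for \<phi> j
    using cutoff_weak[OF s \<Omega>(2) \<zeta> test_fun_smooth[OF that], of i "a $ i" j]
    by (simp add: cut_def Dcut_def)
  show "compact (closure {x. \<zeta> x \<noteq> 0})" "closure {x. \<zeta> x \<noteq> 0} \<subseteq> \<Omega>"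
    using \<zeta> unfolding test_fun_def by auto
  show "cut \<zeta> u a x $ i = 0" "Dcut \<zeta> u Du a x $ i $ j = 0" if "x \<notin> closure {x. \<zeta> x \<noteq> 0}" for x j
    using test_fun_support_eq_0[OF that] by (simp_all add: cut_def Dcut_def)
qed (rule that)

text \<open>The two components are approximated separately and then assembled: the integrand in
  \<open>W012\<close> is the sum of two squared errors of values and four squared errors of
  derivatives.\<close>

proposition W012_cut:
  assumes s: "sobolev \<Omega> u Du" and \<Omega>: "open \<Omega>" "bounded \<Omega>" and \<zeta>: "test_fun \<Omega> \<zeta>"
  shows "W012 \<Omega> (cut \<zeta> u a) (Dcut \<zeta> u Du a)"
proof -
  note out = test_fun_out[OF \<zeta>]
  have sob: "sobolev \<Omega> (cut \<zeta> u a) (Dcut \<zeta> u Du a)"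
    unfolding sobolev_def
  proof (intro conjI allI impI)
    show "sq_int (\<lambda>x. cut \<zeta> u a x $ i)" "sq_int (\<lambda>x. Dcut \<zeta> u Du a x $ i $ j)" for i j
      using cut_sq_int[OF s \<zeta>] by auto
    show "cut \<zeta> u a x = 0" "Dcut \<zeta> u Du a x = 0" if "x \<notin> \<Omega>" for x
      using out[OF that] by (simp_all add: cut_def Dcut_def vec_eq_iff)
    show "(LINT x|lborel. cut \<zeta> u a x $ i * pderiv2 \<phi> j x) =
       - (LINT x|lborel. Dcut \<zeta> u Du a x $ i $ j * \<phi> x)" if "test_fun \<Omega> \<phi>" for \<phi> i j
      using cutoff_weak[OF s \<Omega>(2) \<zeta> test_fun_smooth[OF that], of i "a $ i" j]
      by (simp add: cut_def Dcut_def)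
  qed
  define Q :: "2 \<Rightarrow> (nat \<Rightarrow> real^2 \<Rightarrow> real) \<Rightarrow> bool" where
    "Q i \<psi> \<longleftrightarrow> (\<forall>k. test_fun \<Omega> (\<psi> k)) \<and>
    (\<lambda>k. LINT x|lborel. (\<psi> k x - cut \<zeta> u a x $ i)\<^sup>2) \<longlonglongrightarrow> 0 \<and>
    (\<forall>j. (\<lambda>k. LINT x|lborel. (pderiv2 (\<psi> k) j x - Dcut \<zeta> u Du a x $ i $ j)\<^sup>2) \<longlonglongrightarrow> 0)" for i \<psi>
  have "\<exists>\<psi>. Q i \<psi>" for i
  proof (rule cut_approx[OF s \<Omega> \<zeta>, of a i])
    fix \<psi> :: "nat \<Rightarrow> real^2 \<Rightarrow> real"
    assume "\<And>k. test_fun \<Omega> (\<psi> k)" "(\<lambda>k. LINT x|lborel. (\<psi> k x - cut \<zeta> u a x $ i)\<^sup>2) \<longlonglongrightarrow> 0"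
      "\<And>j. (\<lambda>k. LINT x|lborel. (pderiv2 (\<psi> k) j x - Dcut \<zeta> u Du a x $ i $ j)\<^sup>2) \<longlonglongrightarrow> 0"
    then have "Q i \<psi>" unfolding Q_def by (intro conjI allI)
    then show ?thesis by blast
  qed
  then have "\<exists>P. \<forall>i. Q i (P i)" by (intro choice allI)
  then obtain P where PQ: "\<And>i. Q i (P i)" by blast
  have P: "test_fun \<Omega> (P i k)"
    "(\<lambda>k. LINT x|lborel. (P i k x - cut \<zeta> u a x $ i)\<^sup>2) \<longlonglongrightarrow> 0"
    "(\<lambda>k. LINT x|lborel. (pderiv2 (P i k) j x - Dcut \<zeta> u Du a x $ i $ j)\<^sup>2) \<longlonglongrightarrow> 0" for i j k
    using PQ[of i] unfolding Q_def by (blast, blast, blast)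
  define \<psi> :: "nat \<Rightarrow> real^2 \<Rightarrow> real^2" where "\<psi> k x = (\<chi> i. P i k x)" for k x
  let ?N = "\<lambda>k. LINT x:\<Omega>|lebesgue. (norm (\<psi> k x - cut \<zeta> u a x))\<^sup>2 + (norm (grad2 (\<psi> k) x - Dcut \<zeta> u Du a x))\<^sup>2"
  let ?S = "\<lambda>k x. (\<Sum>i\<in>UNIV. (P i k x - cut \<zeta> u a x $ i)\<^sup>2) +
    (\<Sum>i\<in>UNIV. \<Sum>j\<in>UNIV. (pderiv2 (P i k) j x - Dcut \<zeta> u Du a x $ i $ j)\<^sup>2)"
  have "?N k =
     (\<Sum>i\<in>UNIV. LINT x|lborel. (P i k x - cut \<zeta> u a x $ i)\<^sup>2) +
     (\<Sum>i\<in>UNIV. \<Sum>j\<in>UNIV. LINT x|lborel. (pderiv2 (P i k) j x - Dcut \<zeta> u Du a x $ i $ j)\<^sup>2)" (is "_ = ?R k") for k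
  proof -
    have d: "sq_int (\<lambda>x. P i k x - cut \<zeta> u a x $ i)"
      "sq_int (\<lambda>x. pderiv2 (P i k) j x - Dcut \<zeta> u Du a x $ i $ j)" for i j
      by (intro sq_int_diff test_fun_sq_int[OF P(1)] test_fun_sq_int[OF test_fun_pderiv2[OF P(1)]] cut_sq_int[OF s \<zeta>])+
    have "?N k = (LINT x:\<Omega>|lebesgue. ?S k x)"
      by (simp add: power2_norm_vec sum_2 \<psi>_def grad2_def)
    also have "\<dots> = (LINT x|lborel. ?S k x)"
    proof (rule LINT_lebesgue_eq)
      show "(\<lambda>x. ?S k x) \<in> borel_measurable borel"
        using d[THEN sq_int_borel] by (intro borel_measurable_add borel_measurable_sum borel_measurable_power) auto
      fix x assume x: "x \<notin> \<Omega>"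
      show "?S k x = 0"
        using out[OF x] test_fun_out[OF P(1) x] by (simp add: cut_def Dcut_def)
    qed
    also have "\<dots> = ?R k"
      using d[THEN sq_intD] by simp
    finally show ?thesis .
  qed
  moreover have "?R \<longlonglongrightarrow> (\<Sum>i\<in>(UNIV::2 set). 0) + (\<Sum>i\<in>(UNIV::2 set). \<Sum>j\<in>(UNIV::2 set). 0)"
    by (intro tendsto_add tendsto_sum P)
  ultimately have "?N \<longlonglongrightarrow> 0" by simp
  moreover have "test_fun2 \<Omega> (\<psi> k)" for k
    using P(1) by (simp add: test_fun2_def \<psi>_def)
  ultimately show ?thesis
    unfolding W012_def using sobolev_W12[OF \<Omega>(1) sob] by blast
qed

subsection \<open>Poincare inequalities\<close>

text \<open>The increment is the mean over [0, 1] of the directional derivative along the segment.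
  Its square is estimated by the variance expansion and then by Cauchy-Schwarz in the plane. The
  form in \<open>ennreal\<close> is ready for Tonelli.\<close>

lemma square_increment_le:
  assumes "smooth_fun \<psi>"
  shows "ennreal ((\<psi> (x + h) - \<psi> x)\<^sup>2) \<le>
    (\<integral>\<^sup>+t. indicator {0..1} t * ennreal ((norm h)\<^sup>2 * (\<Sum>j\<in>UNIV. (pderiv2 \<psi> j (x + t *\<^sub>R h))\<^sup>2)) \<partial>lborel)"
proof -
  define g where "g t = frechet_derivative \<psi> (at (x + t *\<^sub>R h)) h" for t :: real
  have g_sum: "g t = (\<Sum>j\<in>UNIV. h $ j * pderiv2 \<psi> j (x + t *\<^sub>R h))" for t
    unfolding g_def by (rule frechet_derivative_eq_sum[OF assms])
  have cont: "continuous_on UNIV g"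
    unfolding g_sum
    by (intro continuous_intros continuous_on_compose2[OF smooth_fun_continuous[where S = UNIV, OF smooth_fun_pderiv2[OF assms]]]) auto
  have gm [measurable]: "g \<in> borel_measurable borel" by (rule borel_measurable_continuous_onI[OF cont])
  have der: "((\<lambda>t. \<psi> (x + t *\<^sub>R h)) has_real_derivative g t) (at t)" for t
  proof -
    have "((\<lambda>t. \<psi> (x + t *\<^sub>R h)) has_derivative (\<lambda>s. frechet_derivative \<psi> (at (x + t *\<^sub>R h)) (s *\<^sub>R h))) (at t)"
      by (rule has_derivative_compose[where g = \<psi>]) (auto intro!: derivative_eq_intros smooth_fun_has_derivative assms)
    moreover have "(\<lambda>s. frechet_derivative \<psi> (at (x + t *\<^sub>R h)) (s *\<^sub>R h)) = (*) (g t)"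
      using has_derivative_linear[OF smooth_fun_has_derivative[OF assms]]
      by (auto simp: g_def linear_cmul mult.commute)
    ultimately show ?thesis by (simp add: has_field_derivative_def)
  qed
  define m where "m = \<psi> (x + h) - \<psi> x"
  let ?I = "indicator {0..1} :: real \<Rightarrow> real"
  have i0: "integrable lborel ?I" "(LINT t|lborel. ?I t) = 1" by auto
  have i1: "integrable lborel (\<lambda>t. g t * ?I t)" "(LINT t|lborel. g t * ?I t) = m"
  proof -
    have "has_bochner_integral lborel (\<lambda>t. g t * ?I t) (\<psi> (x + 1 *\<^sub>R h) - \<psi> (x + 0 *\<^sub>R h))"
      by (rule has_bochner_integral_FTC_Icc_real)
        (use der cont in \<open>auto simp: continuous_on_eq_continuous_at\<close>)
    then show "integrable lborel (\<lambda>t. g t * ?I t)" "(LINT t|lborel. g t * ?I t) = m"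
      by (auto simp: has_bochner_integral_iff m_def)
  qed
  have i2: "integrable lborel (\<lambda>t. (g t)\<^sup>2 * ?I t)"
  proof -
    have "continuous_on {0..1} (\<lambda>t. (g t)\<^sup>2)"
      by (intro continuous_intros continuous_on_subset[OF cont]) auto
    then show ?thesis
      using borel_integrable_atLeastAtMost'[of 0 1 "\<lambda>t. (g t)\<^sup>2"]
      by (simp add: set_integrable_def mult.commute)
  qed
  have "0 \<le> (LINT t|lborel. (g t - m)\<^sup>2 * ?I t)"
    by (rule integral_nonneg_AE) simp
  also have "\<dots> = (LINT t|lborel. (g t)\<^sup>2 * ?I t - 2 * m * (g t * ?I t) + m\<^sup>2 * ?I t)"
    by (intro Bochner_Integration.integral_cong) (auto simp: power2_eq_square algebra_simps)
  also have "\<dots> = (LINT t|lborel. (g t)\<^sup>2 * ?I t) - 2 * m * m + m\<^sup>2"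
    using i0 i1 i2 by simp
  finally have "m\<^sup>2 \<le> (LINT t|lborel. (g t)\<^sup>2 * ?I t)"
    by (simp add: power2_eq_square)
  then have "ennreal (m\<^sup>2) \<le> (\<integral>\<^sup>+t. ennreal ((g t)\<^sup>2 * ?I t) \<partial>lborel)"
    using i2 by (subst nn_integral_eq_integral) (auto intro: ennreal_leI)
  also have "\<dots> \<le> (\<integral>\<^sup>+t. indicator {0..1} t * ennreal ((norm h)\<^sup>2 * (\<Sum>j\<in>UNIV. (pderiv2 \<psi> j (x + t *\<^sub>R h))\<^sup>2)) \<partial>lborel)"
  proof (rule nn_integral_mono)
    fix t
    have cs: "(a * p + b * q)\<^sup>2 \<le> (a\<^sup>2 + b\<^sup>2) * (p\<^sup>2 + q\<^sup>2)" for a b p q :: real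
      using zero_le_power2[of "a * q - b * p"] by (simp add: power2_eq_square algebra_simps)
    have "(g t)\<^sup>2 \<le> (norm h)\<^sup>2 * (\<Sum>j\<in>UNIV. (pderiv2 \<psi> j (x + t *\<^sub>R h))\<^sup>2)"
      unfolding g_sum power2_norm_vec sum_2 using cs by simp
    then show "ennreal ((g t)\<^sup>2 * ?I t) \<le> indicator {0..1} t * ennreal ((norm h)\<^sup>2 * (\<Sum>j\<in>UNIV. (pderiv2 \<psi> j (x + t *\<^sub>R h))\<^sup>2))"
      by (auto simp: indicator_def intro: ennreal_leI)
  qed
  finally show ?thesis unfolding m_def .
qed

text \<open>Convexity keeps the segment from x to x + h inside T. After Tonelli, every t contributes
  a translate of one and the same integral over T.\<close>

lemma convex_translate_smooth:
  assumes sm: "smooth_fun \<psi>" and T: "convex T" "T \<in> sets borel"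
  shows "(\<integral>\<^sup>+x. indicator T x * indicator T (x + h) * ennreal ((\<psi> (x + h) - \<psi> x)\<^sup>2) \<partial>lborel) \<le>
    ennreal ((norm h)\<^sup>2) * (\<integral>\<^sup>+x. indicator T x * ennreal (\<Sum>j\<in>UNIV. (pderiv2 \<psi> j x)\<^sup>2) \<partial>lborel)"
proof -
  define G where "G x = indicator T x * ennreal ((norm h)\<^sup>2 * (\<Sum>j\<in>UNIV. (pderiv2 \<psi> j x)\<^sup>2))" for x
  have [measurable]: "pderiv2 \<psi> j \<in> borel_measurable borel" for j
    by (intro smooth_fun_borel smooth_fun_pderiv2 sm)
  have [measurable]: "T \<in> sets borel" by (rule T)
  have G [measurable]: "G \<in> borel_measurable borel"
    unfolding G_def by measurable
  have "(\<integral>\<^sup>+x. indicator T x * indicator T (x + h) * ennreal ((\<psi> (x + h) - \<psi> x)\<^sup>2) \<partial>lborel) \<le>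
    (\<integral>\<^sup>+x. \<integral>\<^sup>+t. indicator {0..1} t * G (x + t *\<^sub>R h) \<partial>lborel \<partial>lborel)"
  proof (rule nn_integral_mono)
    fix x
    show "indicator T x * indicator T (x + h) * ennreal ((\<psi> (x + h) - \<psi> x)\<^sup>2) \<le>
      (\<integral>\<^sup>+t. indicator {0..1} t * G (x + t *\<^sub>R h) \<partial>lborel)"
    proof (cases "x \<in> T \<and> x + h \<in> T")
      case True
      have "x + t *\<^sub>R h \<in> T" if "0 \<le> t" "t \<le> 1" for t
      proof -
        have "(1 - t) *\<^sub>R x + t *\<^sub>R (x + h) \<in> T"
          using T(1) True that by (simp add: convex_alt)
        then show ?thesis by (simp add: algebra_simps)
      qed
      then have "(\<integral>\<^sup>+t. indicator {0..1} t * ennreal ((norm h)\<^sup>2 * (\<Sum>j\<in>UNIV. (pderiv2 \<psi> j (x + t *\<^sub>R h))\<^sup>2)) \<partial>lborel) =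
        (\<integral>\<^sup>+t. indicator {0..1} t * G (x + t *\<^sub>R h) \<partial>lborel)"
        by (intro nn_integral_cong) (auto simp: G_def indicator_def)
      then show ?thesis
        using square_increment_le[OF sm, of x h] True by simp
    qed (auto simp: indicator_def)
  qed
  also have "\<dots> = (\<integral>\<^sup>+t. \<integral>\<^sup>+x. indicator {0..1} t * G (x + t *\<^sub>R h) \<partial>lborel \<partial>lborel)"
    by (rule lborel_pair.Fubini') measurable
  also have "\<dots> = (\<integral>\<^sup>+t. indicator {0..1} (t :: real) * (\<integral>\<^sup>+x. G x \<partial>lborel) \<partial>lborel)"
  proof (rule nn_integral_cong)
    fix t :: real
    have "(\<integral>\<^sup>+x. G (x + t *\<^sub>R h) \<partial>lborel) = (\<integral>\<^sup>+x. G x \<partial>lborel)"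
      using nn_integral_lborel_translate[OF G, of "t *\<^sub>R h"] by (simp only: add.commute)
    then show "(\<integral>\<^sup>+x. indicator {0..1} t * G (x + t *\<^sub>R h) \<partial>lborel) = indicator {0..1} t * (\<integral>\<^sup>+x. G x \<partial>lborel)"
      by (subst nn_integral_cmult) auto
  qed
  also have "\<dots> = (\<integral>\<^sup>+x. G x \<partial>lborel)"
    by (simp add: nn_integral_multc)
  also have "\<dots> = ennreal ((norm h)\<^sup>2) * (\<integral>\<^sup>+x. indicator T x * ennreal (\<Sum>j\<in>UNIV. (pderiv2 \<psi> j x)\<^sup>2) \<partial>lborel)"
    unfolding G_def by (subst nn_integral_cmult[symmetric]) (auto simp: ennreal_mult sum_nonneg mult_ac intro!: nn_integral_cong)
  finally show ?thesis .
qed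

lemma nn_integral_sq_eq:
  "sq_int f \<Longrightarrow> (\<integral>\<^sup>+x. ennreal ((f x)\<^sup>2) \<partial>lborel) = ennreal (LINT x|lborel. (f x)\<^sup>2)"
  by (intro nn_integral_eq_integral) (auto simp: sq_int_def)

text \<open>The factor 6 (instead of 1) is the price for avoiding square roots in the passage to the limit.\<close>

lemma convex_translate_limit:
  assumes \<psi>: "\<And>k. test_fun \<Omega> (\<psi> k)" and f: "sq_int f" and g: "\<And>j. sq_int (g j)"
    and lim: "(\<lambda>k. LINT x|lborel. (\<psi> k x - f x)\<^sup>2) \<longlonglongrightarrow> 0"
      "\<And>j. (\<lambda>k. LINT x|lborel. (pderiv2 (\<psi> k) j x - g j x)\<^sup>2) \<longlonglongrightarrow> 0"
    and T: "convex T" "T \<in> sets borel"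
  shows "(\<integral>\<^sup>+x. indicator T x * indicator T (x + h) * ennreal ((f (x + h) - f x)\<^sup>2) \<partial>lborel) \<le>
    ennreal (6 * (norm h)\<^sup>2) * (\<integral>\<^sup>+x. indicator T x * ennreal (\<Sum>j\<in>UNIV. (g j x)\<^sup>2) \<partial>lborel)"
proof -
  let ?F = "\<lambda>x. indicator T x * indicator T (x + h) * ennreal ((f (x + h) - f x)\<^sup>2)"
  let ?A = "\<lambda>k x. indicator T x * indicator T (x + h) * ennreal ((\<psi> k (x + h) - \<psi> k x)\<^sup>2)"
  let ?G = "\<lambda>x. indicator T x * ennreal (\<Sum>j\<in>UNIV. (g j x)\<^sup>2)"
  let ?B = "\<lambda>k x. indicator T x * ennreal (\<Sum>j\<in>UNIV. (pderiv2 (\<psi> k) j x)\<^sup>2)"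
  let ?H = "\<lambda>k x. (\<Sum>j\<in>UNIV. ennreal ((pderiv2 (\<psi> k) j x - g j x)\<^sup>2))"
  let ?L = "\<integral>\<^sup>+x. ?F x \<partial>lborel"
  let ?R = "\<integral>\<^sup>+x. ?G x \<partial>lborel"
  define e where "e k = (LINT x|lborel. (\<psi> k x - f x)\<^sup>2)" for k
  define d where "d k = (\<Sum>j\<in>UNIV. LINT x|lborel. (pderiv2 (\<psi> k) j x - g j x)\<^sup>2)" for k
  have [measurable]: "T \<in> sets borel" by (rule T)
  have [measurable]: "f \<in> borel_measurable borel" "g j \<in> borel_measurable borel" for j
    using f g by (auto simp: sq_int_def)
  have [measurable]: "\<psi> k \<in> borel_measurable borel" "pderiv2 (\<psi> k) j \<in> borel_measurable borel" for k j
    using test_fun_smooth[OF \<psi>[of k]] by (auto intro: smooth_fun_borel smooth_fun_pderiv2)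
  have sq: "sq_int (\<lambda>x. \<psi> k x - f x)" "sq_int (\<lambda>x. pderiv2 (\<psi> k) j x - g j x)" for k j
    by (intro sq_int_diff test_fun_sq_int[OF \<psi>] test_fun_sq_int[OF test_fun_pderiv2[OF \<psi>]] f g)+
  have epos: "e k \<ge> 0" "d k \<ge> 0" for k
    unfolding e_def d_def by (auto intro!: sum_nonneg integral_nonneg_AE)
  have le: "?L \<le> ennreal (6 * (norm h)\<^sup>2) * ?R + ennreal (6 * (norm h)\<^sup>2 * d k + 6 * e k)" for k
  proof -
    have "?L \<le> (\<integral>\<^sup>+x. 3 * (?A k x)
       + (3 * ennreal ((\<psi> k (h + x) - f (h + x))\<^sup>2) + 3 * ennreal ((\<psi> k x - f x)\<^sup>2)) \<partial>lborel)"
    proof (rule nn_integral_mono)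
      fix x
      \<comment> \<open>This three-term splitting contributes a factor 3, the two-term splitting of
        the gradients below a factor 2; together they make 6.\<close>
      have sq3: "(b - c)\<^sup>2 \<le> 3 * (p - q)\<^sup>2 + (3 * (p - b)\<^sup>2 + 3 * (q - c)\<^sup>2)" for b c p q :: real
        using zero_le_power2[of "(p - q) + (p - b)"] zero_le_power2[of "(p - b) + (q - c)"] zero_le_power2[of "(p - q) - (q - c)"]
        by (simp add: power2_eq_square algebra_simps)
      have "ennreal ((f (x + h) - f x)\<^sup>2) \<le> ennreal (3 * (\<psi> k (x + h) - \<psi> k x)\<^sup>2 +
          (3 * (\<psi> k (x + h) - f (x + h))\<^sup>2 + 3 * (\<psi> k x - f x)\<^sup>2))"
        by (rule ennreal_leI) (rule sq3)
      also have "\<dots> = 3 * ennreal ((\<psi> k (x + h) - \<psi> k x)\<^sup>2) +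
          (3 * ennreal ((\<psi> k (x + h) - f (x + h))\<^sup>2) + 3 * ennreal ((\<psi> k x - f x)\<^sup>2))"
        by (simp add: ennreal_plus ennreal_mult)
      finally show "?F x \<le>
        3 * (?A k x)
       + (3 * ennreal ((\<psi> k (h + x) - f (h + x))\<^sup>2) + 3 * ennreal ((\<psi> k x - f x)\<^sup>2))"
        by (auto simp: indicator_def add.commute)
    qed
    also have "\<dots> = 3 * (\<integral>\<^sup>+x. ?A k x \<partial>lborel)
       + (3 * (\<integral>\<^sup>+x. ennreal ((\<psi> k (h + x) - f (h + x))\<^sup>2) \<partial>lborel) + 3 * (\<integral>\<^sup>+x. ennreal ((\<psi> k x - f x)\<^sup>2) \<partial>lborel))"
      by (simp add: nn_integral_add nn_integral_cmult)
    also have "\<dots> = 3 * (\<integral>\<^sup>+x. ?A k x \<partial>lborel) + ennreal (6 * e k)"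
    proof -
      have "(\<integral>\<^sup>+x. ennreal ((\<psi> k (h + x) - f (h + x))\<^sup>2) \<partial>lborel) = ennreal (e k)"
        "(\<integral>\<^sup>+x. ennreal ((\<psi> k x - f x)\<^sup>2) \<partial>lborel) = ennreal (e k)"
        using nn_integral_lborel_translate[of "\<lambda>x. ennreal ((\<psi> k x - f x)\<^sup>2)" h] nn_integral_sq_eq[OF sq(1)[of k]]
        by (simp_all add: e_def)
      moreover have "3 * ennreal (e k) + 3 * ennreal (e k) = ennreal (6 * e k)"
      proof -
        have "3 * ennreal (e k) = ennreal (3 * e k)" using epos(1)[of k] by (simp add: ennreal_mult)
        then show ?thesis using epos(1)[of k] by (simp add: ennreal_plus[symmetric] del: ennreal_plus)
      qed
      ultimately show ?thesis by simp
    qed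
    also have "(\<integral>\<^sup>+x. ?A k x \<partial>lborel) \<le>
       ennreal ((norm h)\<^sup>2) * (\<integral>\<^sup>+x. ?B k x \<partial>lborel)"
      by (rule convex_translate_smooth[OF test_fun_smooth[OF \<psi>] T])
    also have "(\<integral>\<^sup>+x. ?B k x \<partial>lborel) \<le>
       (\<integral>\<^sup>+x. 2 * (?G x) + 2 * ?H k x \<partial>lborel)"
    proof (rule nn_integral_mono)
      fix x
      have sq2: "p\<^sup>2 \<le> 2 * q\<^sup>2 + 2 * (p - q)\<^sup>2" for p q :: real
        using zero_le_power2[of "2 * q - p"] by (simp add: power2_eq_square algebra_simps)
      have "(\<Sum>j\<in>UNIV. (pderiv2 (\<psi> k) j x)\<^sup>2) \<le> 2 * (\<Sum>j\<in>UNIV. (g j x)\<^sup>2) + 2 * (\<Sum>j\<in>UNIV. (pderiv2 (\<psi> k) j x - g j x)\<^sup>2)"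
        unfolding sum_distrib_left sum.distrib[symmetric] by (rule sum_mono) (rule sq2)
      then have "ennreal (\<Sum>j\<in>UNIV. (pderiv2 (\<psi> k) j x)\<^sup>2) \<le> ennreal (2 * (\<Sum>j\<in>UNIV. (g j x)\<^sup>2) + 2 * (\<Sum>j\<in>UNIV. (pderiv2 (\<psi> k) j x - g j x)\<^sup>2))"
        by (rule ennreal_leI)
      also have "\<dots> = 2 * ennreal (\<Sum>j\<in>UNIV. (g j x)\<^sup>2) + 2 * ?H k x"
        by (simp add: ennreal_plus ennreal_mult sum_nonneg sum_ennreal)
      finally show "?B k x \<le>
        2 * (?G x) + 2 * ?H k x"
        by (auto simp: indicator_def)
    qed
    also have "\<dots> = 2 * ?R + ennreal (2 * d k)"
    proof -
      have "(\<integral>\<^sup>+x. ?H k x \<partial>lborel) =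
          (\<Sum>j\<in>UNIV. ennreal (LINT x|lborel. (pderiv2 (\<psi> k) j x - g j x)\<^sup>2))"
        by (subst nn_integral_sum, measurable) (simp only: nn_integral_sq_eq[OF sq(2)])
      also have "\<dots> = ennreal (d k)"
        unfolding d_def by (intro sum_ennreal integral_nonneg_AE) simp
      finally have "(\<integral>\<^sup>+x. ?H k x \<partial>lborel) = ennreal (d k)" .
      moreover have "(\<integral>\<^sup>+x. 2 * (?G x) +
          2 * ?H k x \<partial>lborel) =
          2 * ?R + 2 * (\<integral>\<^sup>+x. ?H k x \<partial>lborel)"
        by (subst nn_integral_add, measurable) (subst nn_integral_cmult, measurable)+
      ultimately show ?thesis using epos(2)[of k] by (simp only: ennreal_mult' ennreal_numeral)
    qed
    finally have "?L \<le> 3 * (ennreal ((norm h)\<^sup>2) * (2 * ?R + ennreal (2 * d k))) + ennreal (6 * e k)"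
      by (simp add: mult_left_mono add_mono)
    also have "\<dots> = ennreal (6 * (norm h)\<^sup>2) * ?R + ennreal (6 * (norm h)\<^sup>2 * d k + 6 * e k)"
    proof -
      have "3 * (ennreal ((norm h)\<^sup>2) * (2 * ?R)) = ennreal (6 * (norm h)\<^sup>2) * ?R"
        by (simp add: ennreal_mult mult_ac)
      moreover have "3 * (ennreal ((norm h)\<^sup>2) * ennreal (2 * d k)) = ennreal (6 * (norm h)\<^sup>2 * d k)"
        using epos(2)[of k] by (simp add: ennreal_mult[symmetric] ennreal_numeral[symmetric] del: ennreal_numeral)
      ultimately show ?thesis
        using epos[of k] by (simp add: distrib_left add.assoc ennreal_plus)
    qed
    finally show ?thesis .
  qed
  have "(\<lambda>k. 6 * (norm h)\<^sup>2 * d k + 6 * e k) \<longlonglongrightarrow> 6 * (norm h)\<^sup>2 * (\<Sum>j\<in>(UNIV::2 set). 0) + 6 * 0"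
    unfolding d_def e_def by (intro tendsto_intros lim)
  then have "(\<lambda>k. ennreal (6 * (norm h)\<^sup>2) * ?R + ennreal (6 * (norm h)\<^sup>2 * d k + 6 * e k)) \<longlonglongrightarrow>
      ennreal (6 * (norm h)\<^sup>2) * ?R + ennreal 0"
    by (intro tendsto_add tendsto_const tendsto_ennrealI) simp
  from LIMSEQ_le_const[OF this] show ?thesis using le by auto
qed

text \<open>u is replaced by its product with a cutoff that is 1 on the square, which is a limit of
  test functions. On T this changes neither u nor Du, since the derivatives of the cutoff vanish
  there.\<close>

lemma sobolev_translate:
  assumes s: "sobolev \<Omega> u Du" and \<Omega>: "open \<Omega>" "bounded \<Omega>"
    and R: "R > 0" "cube c (4 * R) \<subseteq> \<Omega>" and T: "convex T" "T \<in> sets borel" "T \<subseteq> cube c R"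
  shows "(\<integral>\<^sup>+x. indicator T x * indicator T (x + h) * ennreal ((norm (u (x + h) - u x))\<^sup>2) \<partial>lborel) \<le>
    ennreal (6 * (norm h)\<^sup>2) * (\<integral>\<^sup>+x. indicator T x * ennreal ((norm (Du x))\<^sup>2) \<partial>lborel)"
proof -
  obtain K \<zeta> where "cutoff K \<Omega> c R \<zeta>"
    by (rule ex_cutoff) (use R in blast)
  then have \<zeta>: "test_fun \<Omega> \<zeta>" "\<And>x. x \<in> cube c R \<Longrightarrow> \<zeta> x = 1"
    unfolding cutoff_def by blast+
  have p0: "pderiv2 \<zeta> j x = 0" if "x \<in> cube c R" for j x
    by (rule pderiv2_eq_0[OF open_cube that \<zeta>(2)])
  have c: "cut \<zeta> u 0 x = u x" "Dcut \<zeta> u Du 0 x = Du x" if "x \<in> T" for x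
    using that T(3) p0[of x] \<zeta>(2)[of x] by (auto simp: cut_def Dcut_def vec_eq_iff)
  note b [measurable] = sobolev_borel[OF s] T(2)
  have *: "(\<integral>\<^sup>+x. indicator T x * indicator T (x + h) * ennreal ((u (x + h) $ i - u x $ i)\<^sup>2) \<partial>lborel) \<le>
    ennreal (6 * (norm h)\<^sup>2) * (\<integral>\<^sup>+x. indicator T x * ennreal (\<Sum>j\<in>UNIV. (Du x $ i $ j)\<^sup>2) \<partial>lborel)" for i
  proof (rule cut_approx[OF s \<Omega> \<zeta>(1), of 0 i])
    fix \<psi> :: "nat \<Rightarrow> real^2 \<Rightarrow> real"
    assume a: "\<And>k. test_fun \<Omega> (\<psi> k)" "(\<lambda>k. LINT x|lborel. (\<psi> k x - cut \<zeta> u 0 x $ i)\<^sup>2) \<longlonglongrightarrow> 0"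
      "\<And>j. (\<lambda>k. LINT x|lborel. (pderiv2 (\<psi> k) j x - Dcut \<zeta> u Du 0 x $ i $ j)\<^sup>2) \<longlonglongrightarrow> 0"
    have "(\<integral>\<^sup>+x. indicator T x * indicator T (x + h) * ennreal ((cut \<zeta> u 0 (x + h) $ i - cut \<zeta> u 0 x $ i)\<^sup>2) \<partial>lborel) \<le>
      ennreal (6 * (norm h)\<^sup>2) * (\<integral>\<^sup>+x. indicator T x * ennreal (\<Sum>j\<in>UNIV. (Dcut \<zeta> u Du 0 x $ i $ j)\<^sup>2) \<partial>lborel)"
      by (rule convex_translate_limit[OF a(1) cut_sq_int[OF s \<zeta>(1)] a(2,3) T(1,2)])
    also have "(\<integral>\<^sup>+x. indicator T x * ennreal (\<Sum>j\<in>UNIV. (Dcut \<zeta> u Du 0 x $ i $ j)\<^sup>2) \<partial>lborel) =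
      (\<integral>\<^sup>+x. indicator T x * ennreal (\<Sum>j\<in>UNIV. (Du x $ i $ j)\<^sup>2) \<partial>lborel)"
      using c by (intro nn_integral_cong) (auto simp: indicator_def)
    also have "(\<integral>\<^sup>+x. indicator T x * indicator T (x + h) * ennreal ((cut \<zeta> u 0 (x + h) $ i - cut \<zeta> u 0 x $ i)\<^sup>2) \<partial>lborel) =
      (\<integral>\<^sup>+x. indicator T x * indicator T (x + h) * ennreal ((u (x + h) $ i - u x $ i)\<^sup>2) \<partial>lborel)"
      using c by (intro nn_integral_cong) (auto simp: indicator_def)
    finally show ?thesis .
  qed
  have "(\<integral>\<^sup>+x. indicator T x * indicator T (x + h) * ennreal ((norm (u (x + h) - u x))\<^sup>2) \<partial>lborel) =
    (\<Sum>i\<in>UNIV. \<integral>\<^sup>+x. indicator T x * indicator T (x + h) * ennreal ((u (x + h) $ i - u x $ i)\<^sup>2) \<partial>lborel)"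
    by (subst nn_integral_sum[symmetric])
      (auto simp: power2_norm_vec sum_2 ennreal_plus distrib_left intro!: nn_integral_cong)
  also have "\<dots> \<le> (\<Sum>i\<in>UNIV. ennreal (6 * (norm h)\<^sup>2) * (\<integral>\<^sup>+x. indicator T x * ennreal (\<Sum>j\<in>UNIV. (Du x $ i $ j)\<^sup>2) \<partial>lborel))"
    by (intro sum_mono *)
  also have "\<dots> = ennreal (6 * (norm h)\<^sup>2) * (\<integral>\<^sup>+x. (\<Sum>i\<in>UNIV. indicator T x * ennreal (\<Sum>j\<in>UNIV. (Du x $ i $ j)\<^sup>2)) \<partial>lborel)"
    by (subst nn_integral_sum) (auto simp: sum_distrib_left)
  also have "(\<integral>\<^sup>+x. (\<Sum>i\<in>UNIV. indicator T x * ennreal (\<Sum>j\<in>UNIV. (Du x $ i $ j)\<^sup>2)) \<partial>lborel) =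
     (\<integral>\<^sup>+x. indicator T x * ennreal ((norm (Du x))\<^sup>2) \<partial>lborel)"
    by (intro nn_integral_cong) (auto simp: power2_norm_mat sum_2 ennreal_plus distrib_left)
  finally show ?thesis .
qed

section \<open>Oscillation integrals over convex sets and over annuli\<close>

definition energy :: "(real^2 \<Rightarrow> real^2^2) \<Rightarrow> (real^2) set \<Rightarrow> ennreal" where
  "energy Du T = (\<integral>\<^sup>+x. indicator T x * ennreal ((norm (Du x))\<^sup>2) \<partial>lborel)"

text \<open>For X = Y of finite measure and u square-integrable this is twice the measure of X times
  the squared L2 distance of u from its mean. A bound by the energy is thus a Poincare inequality,
  in a form that behaves well under unions.\<close>

definition osc :: "(real^2 \<Rightarrow> real^2) \<Rightarrow> (real^2) set \<Rightarrow> (real^2) set \<Rightarrow> ennreal" where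
  "osc u X Y = (\<integral>\<^sup>+x. \<integral>\<^sup>+y. indicator X x * indicator Y y * ennreal ((norm (u x - u y))\<^sup>2) \<partial>lborel \<partial>lborel)"

lemma energy_mono: "S \<subseteq> T \<Longrightarrow> energy Du S \<le> energy Du T"
  unfolding energy_def by (intro nn_integral_mono mult_right_mono) (auto simp: indicator_def)

lemma osc_mono: "X \<subseteq> X' \<Longrightarrow> Y \<subseteq> Y' \<Longrightarrow> osc u X Y \<le> osc u X' Y'"
  unfolding osc_def by (intro nn_integral_mono mult_mono) (auto simp: indicator_def)

lemma emeasure_cube: "r \<ge> 0 \<Longrightarrow> emeasure lborel (cube c r) = ennreal ((2 * r)\<^sup>2)"
proof -
  assume r: "r \<ge> 0"
  have *: "((\<chi> i. c $ i + r) - (\<chi> i. c $ i - r) :: real^2) \<bullet> b = 2 * r" if b: "b \<in> Basis" for b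
    using b by (auto simp: Basis_vec_def inner_axis)
  have "emeasure lborel (cube c r) = (\<Prod>b\<in>(Basis :: (real^2) set). ((\<chi> i. c $ i + r) - (\<chi> i. c $ i - r) :: real^2) \<bullet> b)"
    unfolding cube_eq_box
    by (rule emeasure_lborel_box) (use r in \<open>auto simp: Basis_vec_def inner_axis\<close>)
  also have "(\<Prod>b\<in>(Basis :: (real^2) set). ((\<chi> i. c $ i + r) - (\<chi> i. c $ i - r) :: real^2) \<bullet> b) = (\<Prod>b\<in>(Basis :: (real^2) set). 2 * r)"
    by (rule prod.cong) (use * in auto)
  finally show ?thesis by simp
qed

lemma convex_cube: "convex (cube c r)"
  unfolding cube_eq_box by (rule convex_box)

text \<open>With y = x + h the double integral becomes one over shifts. They satisfy |h|^2 <= 8 R^2,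
  so each contributes at most 6 * 8 R^2 times the energy, and they fill at most a square of area 16
  R^2; 16 * 48 = 768.\<close>

lemma osc_convex:
  assumes s: "sobolev \<Omega> u Du" and \<Omega>: "open \<Omega>" "bounded \<Omega>"
    and R: "R > 0" "cube c (4 * R) \<subseteq> \<Omega>" and T: "convex T" "T \<in> sets borel" "T \<subseteq> cube c R"
  shows "osc u T T \<le> ennreal (768 * R ^ 4) * energy Du T"
proof -
  note [measurable] = sobolev_borel[OF s] T(2)
  have "osc u T T = (\<integral>\<^sup>+x. \<integral>\<^sup>+h. indicator T x * indicator T (x + h) * ennreal ((norm (u (x + h) - u x))\<^sup>2) \<partial>lborel \<partial>lborel)"
    unfolding osc_def
  proof (rule nn_integral_cong)
    fix x
    show "(\<integral>\<^sup>+y. indicator T x * indicator T y * ennreal ((norm (u x - u y))\<^sup>2) \<partial>lborel) =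
      (\<integral>\<^sup>+h. indicator T x * indicator T (x + h) * ennreal ((norm (u (x + h) - u x))\<^sup>2) \<partial>lborel)"
      using nn_integral_lborel_translate[of "\<lambda>y. indicator T x * indicator T y * ennreal ((norm (u x - u y))\<^sup>2)" x]
      by (simp add: norm_minus_commute)
  qed
  also have "\<dots> = (\<integral>\<^sup>+h. \<integral>\<^sup>+x. indicator T x * indicator T (x + h) * ennreal ((norm (u (x + h) - u x))\<^sup>2) \<partial>lborel \<partial>lborel)"
    by (rule lborel_pair.Fubini') measurable
  also have "\<dots> \<le> (\<integral>\<^sup>+h. indicator (cube 0 (2 * R)) h * (ennreal (48 * R\<^sup>2) * energy Du T) \<partial>lborel)"
  proof (rule nn_integral_mono)
    fix h :: "real^2"
    show "(\<integral>\<^sup>+x. indicator T x * indicator T (x + h) * ennreal ((norm (u (x + h) - u x))\<^sup>2) \<partial>lborel) \<le>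
      indicator (cube 0 (2 * R)) h * (ennreal (48 * R\<^sup>2) * energy Du T)"
    proof (cases "h \<in> cube 0 (2 * R)")
      case True
      then have h: "\<bar>h $ i\<bar> \<le> 2 * R" for i by (auto simp: cube_def less_imp_le)
      have "(h $ i)\<^sup>2 \<le> (2 * R)\<^sup>2" for i using power_mono[OF h[of i], of 2] by simp
      from add_mono[OF this[of 1] this[of 2]] have "6 * (norm h)\<^sup>2 \<le> 48 * R\<^sup>2"
        by (simp add: power2_norm_vec power_mult_distrib)
      then have "ennreal (6 * (norm h)\<^sup>2) * energy Du T \<le> ennreal (48 * R\<^sup>2) * energy Du T"
        by (intro mult_right_mono ennreal_leI) auto
      with sobolev_translate[OF s \<Omega> R T, of h] True show ?thesis
        by (simp add: energy_def)
    next
      case False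
      have z: "indicator T x * indicator T (x + h) = (0 :: ennreal)" for x
      proof (rule ccontr)
        assume "indicator T x * indicator T (x + h) \<noteq> (0 :: ennreal)"
        then have "x \<in> T" "x + h \<in> T" by (auto simp: indicator_def split: if_splits)
        then have "x \<in> cube c R" "x + h \<in> cube c R" using T(3) by auto
        then have b: "\<bar>x $ i - c $ i\<bar> < R" "\<bar>x $ i + h $ i - c $ i\<bar> < R" for i by (auto simp: cube_def)
        have "\<bar>h $ i\<bar> < 2 * R" for i using b[of i] by linarith
        then show False using False by (simp add: cube_def)
      qed
      show ?thesis unfolding z by simp
    qed
  qed
  also have "\<dots> = ennreal ((4 * R)\<^sup>2) * (ennreal (48 * R\<^sup>2) * energy Du T)"
    using emeasure_cube[of "2 * R" 0] R by (simp add: nn_integral_multc)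
  also have "\<dots> = ennreal (768 * R ^ 4) * energy Du T"
  proof -
    have "ennreal ((4 * R)\<^sup>2) * ennreal (48 * R\<^sup>2) = ennreal (768 * R ^ 4)"
      by (subst ennreal_mult'[symmetric]) (simp_all add: power2_eq_square power4_eq_xxxx mult.assoc)
    then show ?thesis by (simp only: mult.assoc[symmetric])
  qed
  finally show ?thesis .
qed

lemma osc_commute:
  assumes u [measurable]: "u \<in> borel_measurable borel" and [measurable]: "X \<in> sets borel" "Y \<in> sets borel"
  shows "osc u X Y = osc u Y X"
  unfolding osc_def
  by (subst lborel_pair.Fubini') (auto simp: norm_minus_commute mult_ac intro!: nn_integral_cong)

text \<open>Points of X and Y are compared through a third point z, and the squared triangle
  inequality is integrated over z in the overlap Z.\<close>

lemma osc_chain: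
  assumes u [measurable]: "u \<in> borel_measurable borel"
    and XY [measurable]: "X \<in> sets borel" "Y \<in> sets borel" "Z \<in> sets borel" and Z: "Z \<subseteq> X" "Z \<subseteq> Y"
  shows "emeasure lborel Z * osc u X Y \<le> 2 * (emeasure lborel Y * osc u X X + emeasure lborel X * osc u Y Y)"
proof -
  let ?L = "\<lambda>x y. ennreal ((norm (u x - u y))\<^sup>2)"
  have "emeasure lborel Z * osc u X Y =
    (\<integral>\<^sup>+z. \<integral>\<^sup>+x. \<integral>\<^sup>+y. indicator Z z * (indicator X x * indicator Y y * ?L x y) \<partial>lborel \<partial>lborel \<partial>lborel)"
    by (simp add: osc_def nn_integral_cmult nn_integral_multc)
  also have "\<dots> \<le> (\<integral>\<^sup>+z. \<integral>\<^sup>+x. \<integral>\<^sup>+y. 2 * (indicator Z z * indicator X x * ?L z x * indicator Y y)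
      + 2 * (indicator X x * (indicator Z z * indicator Y y * ?L z y)) \<partial>lborel \<partial>lborel \<partial>lborel)"
  proof (intro nn_integral_mono)
    fix x y z
    have "norm (u x - u y) \<le> norm (u z - u x) + norm (u z - u y)"
      using norm_triangle_ineq4[of "u z - u y" "u z - u x"] by (simp add: add.commute)
    from power_mono[OF this, of 2] have "(norm (u x - u y))\<^sup>2 \<le> (norm (u z - u x) + norm (u z - u y))\<^sup>2"
      by simp
    also have "\<dots> \<le> 2 * (norm (u z - u x))\<^sup>2 + 2 * (norm (u z - u y))\<^sup>2"
      using zero_le_power2[of "norm (u z - u x) - norm (u z - u y)"] by (simp add: power2_eq_square algebra_simps)
    finally have "?L x y \<le> ennreal (2 * (norm (u z - u x))\<^sup>2 + 2 * (norm (u z - u y))\<^sup>2)"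
      by (rule ennreal_leI)
    also have "\<dots> = 2 * ?L z x + 2 * ?L z y" by (simp add: ennreal_plus ennreal_mult)
    finally have *: "?L x y \<le> 2 * ?L z x + 2 * ?L z y" .
    show "indicator Z z * (indicator X x * indicator Y y * ?L x y) \<le>
      2 * (indicator Z z * indicator X x * ?L z x * indicator Y y)
      + 2 * (indicator X x * (indicator Z z * indicator Y y * ?L z y))"
      by (cases "z \<in> Z \<and> x \<in> X \<and> y \<in> Y") (use * in auto)
  qed
  also have "\<dots> = 2 * (osc u Z X * emeasure lborel Y) + 2 * (emeasure lborel X * osc u Z Y)"
    by (simp add: osc_def nn_integral_add nn_integral_cmult nn_integral_multc)
  also have "\<dots> \<le> 2 * (osc u X X * emeasure lborel Y) + 2 * (emeasure lborel X * osc u Y Y)"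
    using Z by (intro add_mono mult_mono osc_mono) auto
  finally show ?thesis by (simp add: distrib_left mult.commute)
qed

text \<open>The areas are at most 36 r^2 and the overlap contains a square of area 4 r^2, so each
  mixed term is at most 2 * 36 / 4 = 18 times the sum of the pure ones. Two mixed terms and the pure
  terms give 37.\<close>

lemma osc_union:
  assumes u [measurable]: "u \<in> borel_measurable borel"
    and XY [measurable]: "X \<in> sets borel" "Y \<in> sets borel"
    and r: "r > 0" "X \<subseteq> cube c (3 * r)" "Y \<subseteq> cube c (3 * r)" "cube d r \<subseteq> X" "cube d r \<subseteq> Y"
    and J: "osc u X X \<le> ennreal a * e" "osc u Y Y \<le> ennreal b * e" "a \<ge> 0" "b \<ge> 0"
  shows "osc u (X \<union> Y) (X \<union> Y) \<le> ennreal (37 * (a + b)) * e"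
proof -
  have m: "emeasure lborel X \<le> ennreal (36 * r\<^sup>2)" "emeasure lborel Y \<le> ennreal (36 * r\<^sup>2)"
    using emeasure_mono[OF r(2), of lborel] emeasure_mono[OF r(3), of lborel] emeasure_cube[of "3 * r" c] r(1)
    by (simp_all add: power_mult_distrib)
  have "ennreal (4 * r\<^sup>2) * osc u X Y \<le> 2 * (emeasure lborel Y * osc u X X + emeasure lborel X * osc u Y Y)"
    using osc_chain[OF u XY cube_borel r(4,5)] emeasure_cube[of r d] r(1) by (simp add: power_mult_distrib)
  also have "\<dots> \<le> 2 * (ennreal (36 * r\<^sup>2) * osc u X X + ennreal (36 * r\<^sup>2) * osc u Y Y)"
    by (intro mult_left_mono add_mono mult_right_mono m) auto
  also have "\<dots> = ennreal (4 * r\<^sup>2) * (18 * (osc u X X + osc u Y Y))"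
  proof -
    have "ennreal (36 * r\<^sup>2) = ennreal (4 * r\<^sup>2) * 9"
      by (subst ennreal_numeral[symmetric], subst ennreal_mult[symmetric]) (auto simp: mult.commute)
    moreover have "2 * (w * 9 * p + w * 9 * q) = w * (18 * (p + q))" for w p q :: ennreal
    proof -
      have "2 * (w * 9 * p + w * 9 * q) = (2 * 9) * (w * (p + q))" by (simp only: distrib_left mult_ac)
      then show ?thesis by (simp add: mult.left_commute)
    qed
    ultimately show ?thesis by (simp only:)
  qed
  finally have XY_le: "osc u X Y \<le> 18 * (osc u X X + osc u Y Y)"
    using r(1) by (subst (asm) ennreal_mult_le_mult_iff) auto
  have "osc u (X \<union> Y) (X \<union> Y) \<le> (\<integral>\<^sup>+x. \<integral>\<^sup>+y.
      (indicator X x * indicator X y * ennreal ((norm (u x - u y))\<^sup>2) + indicator X x * indicator Y y * ennreal ((norm (u x - u y))\<^sup>2))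
    + (indicator Y x * indicator X y * ennreal ((norm (u x - u y))\<^sup>2) + indicator Y x * indicator Y y * ennreal ((norm (u x - u y))\<^sup>2))
      \<partial>lborel \<partial>lborel)"
    unfolding osc_def by (intro nn_integral_mono) (auto simp: indicator_def)
  also have "\<dots> = (osc u X X + osc u X Y) + (osc u Y X + osc u Y Y)"
    by (simp add: osc_def nn_integral_add)
  also have "\<dots> \<le> (osc u X X + 18 * (osc u X X + osc u Y Y)) + (18 * (osc u X X + osc u Y Y) + osc u Y Y)"
    using XY_le osc_commute[OF u XY] by (intro add_mono) auto
  also have "\<dots> = 37 * (osc u X X + osc u Y Y)"
  proof -
    have "p + 18 * s + (18 * s + q) = (p + q) + 36 * s" for p q s :: ennreal
    proof -
      have "18 * s + 18 * s = 36 * s" by (simp add: distrib_right[symmetric])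
      then show ?thesis by (metis add.assoc add.commute)
    qed
    moreover have "s + 36 * s = 37 * s" for s :: ennreal
      using distrib_right[of 1 36 s] by simp
    ultimately show ?thesis by metis
  qed
  also have "\<dots> \<le> 37 * (ennreal a * e + ennreal b * e)"
    by (intro mult_left_mono add_mono J) auto
  also have "\<dots> = ennreal (37 * (a + b)) * e"
    using J(3,4) by (simp add: ennreal_mult ennreal_plus distrib_right mult.assoc)
  finally show ?thesis .
qed

text \<open>Left, top, right and bottom rectangles are joined in this order; each new one shares a
  corner square of half-side r with what is already there. With q = 768 * 81 r^4 per rectangle,
  three unions give 37 (37 (37 * 2 q + q) + q) = 102712 q. The half-side 12 r is the factor 4 of the
  convex estimate applied to 3 r.\<close>

lemma osc_annulus:
  assumes s: "sobolev \<Omega> u Du" and \<Omega>: "open \<Omega>" "bounded \<Omega>" and r: "r > 0" "cube c (12 * r) \<subseteq> \<Omega>"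
  defines "A \<equiv> cube c (3 * r) - cube c r"
  shows "osc u A A \<le> ennreal (6389508096 * r ^ 4) * energy Du A"
proof -
  define H where "H v b = cube c (3 * r) \<inter> {x :: real^2. v \<bullet> x \<le> b}" for v b
  define e1 where "e1 = (axis 1 1 :: real^2)"
  define e2 where "e2 = (axis 2 1 :: real^2)"
  define L where "L = H e1 (c $ 1 - r)"
  define T where "T = H (- e2) (- (c $ 2 + r))"
  define R where "R = H (- e1) (- (c $ 1 + r))"
  define B where "B = H e2 (c $ 2 - r)"
  define q where "q = 768 * (3 * r) ^ 4"
  have q: "q \<ge> 0" by (simp add: q_def)
  have in1: "e1 \<bullet> x = x $ 1" "e2 \<bullet> x = x $ 2" for x by (simp_all add: e1_def e2_def inner_axis')
  have mem: "x \<in> L \<longleftrightarrow> x \<in> cube c (3 * r) \<and> x $ 1 \<le> c $ 1 - r"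
    "x \<in> T \<longleftrightarrow> x \<in> cube c (3 * r) \<and> x $ 2 \<ge> c $ 2 + r"
    "x \<in> R \<longleftrightarrow> x \<in> cube c (3 * r) \<and> x $ 1 \<ge> c $ 1 + r"
    "x \<in> B \<longleftrightarrow> x \<in> cube c (3 * r) \<and> x $ 2 \<le> c $ 2 - r" for x
    by (auto simp: L_def T_def R_def B_def H_def in1)
  have cu: "x \<in> cube d p \<longleftrightarrow> \<bar>x $ 1 - d $ 1\<bar> < p \<and> \<bar>x $ 2 - d $ 2\<bar> < p" for x d p
    by (auto simp: cube_def forall_2)
  have Hc: "convex (H v b)" "H v b \<in> sets borel" "H v b \<subseteq> cube c (3 * r)" for v b
    unfolding H_def by (auto intro!: convex_Int convex_cube convex_halfspace_le borel_closed closed_halfspace_le sets.Int)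
  have A: "A = L \<union> T \<union> R \<union> B"
    using r(1) by (auto simp: A_def mem cu)
  have bm [measurable]: "L \<in> sets borel" "T \<in> sets borel" "R \<in> sets borel" "B \<in> sets borel"
    unfolding L_def T_def R_def B_def by (rule Hc)+
  have sub: "L \<subseteq> cube c (3 * r)" "T \<subseteq> cube c (3 * r)" "R \<subseteq> cube c (3 * r)" "B \<subseteq> cube c (3 * r)"
    unfolding L_def T_def R_def B_def by (rule Hc)+
  have JH: "osc u (H v b) (H v b) \<le> ennreal q * energy Du A" if "H v b \<subseteq> A" for v b
  proof -
    have "osc u (H v b) (H v b) \<le> ennreal q * energy Du (H v b)"
      unfolding q_def by (rule osc_convex[OF s \<Omega> _ _ Hc]) (use r in auto)
    also have "\<dots> \<le> ennreal q * energy Du A"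
      by (intro mult_left_mono energy_mono that) auto
    finally show ?thesis .
  qed
  have J: "osc u L L \<le> ennreal q * energy Du A" "osc u T T \<le> ennreal q * energy Du A"
    "osc u R R \<le> ennreal q * energy Du A" "osc u B B \<le> ennreal q * energy Du A"
  proof -
    have "L \<subseteq> A" "T \<subseteq> A" "R \<subseteq> A" "B \<subseteq> A" using A by auto
    then show "osc u L L \<le> ennreal q * energy Du A" "osc u T T \<le> ennreal q * energy Du A"
      "osc u R R \<le> ennreal q * energy Du A" "osc u B B \<le> ennreal q * energy Du A"
      unfolding L_def T_def R_def B_def by (simp_all only: JH)
  qed
  note um = sobolev_borel(1)[OF s]
  \<comment> \<open>For s and t equal to 1 or -1, \<open>d s t\<close> is the centre of a corner
    square of the annulus; three of the four corners serve as overlaps.\<close>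
  define d where "d s t = ((\<chi> i. (if i = 1 then c $ 1 + s * (2 * r) else c $ 2 + t * (2 * r))) :: real^2)" for s t :: real
  have d: "d s t $ 1 = c $ 1 + s * (2 * r)" "d s t $ 2 = c $ 2 + t * (2 * r)" for s t
    by (simp_all add: d_def)
  have k: "cube (d (-1) 1) r \<subseteq> L" "cube (d (-1) 1) r \<subseteq> T" "cube (d 1 1) r \<subseteq> L \<union> T" "cube (d 1 1) r \<subseteq> R"
    "cube (d 1 (-1)) r \<subseteq> L \<union> T \<union> R" "cube (d 1 (-1)) r \<subseteq> B"
    using r(1) by (auto simp: mem cu d abs_less_iff)
  have J1: "osc u (L \<union> T) (L \<union> T) \<le> ennreal (37 * (q + q)) * energy Du A"
    by (rule osc_union[OF um bm(1,2) r(1) sub(1,2) k(1,2) J(1,2) q q])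
  have J2: "osc u (L \<union> T \<union> R) (L \<union> T \<union> R) \<le> ennreal (37 * (37 * (q + q) + q)) * energy Du A"
    by (rule osc_union[OF um _ bm(3) r(1) _ sub(3) k(3,4) J1 J(3)]) (use sub q in auto)
  have J3: "osc u A A \<le> ennreal (37 * (37 * (37 * (q + q) + q) + q)) * energy Du A"
    unfolding A
    by (rule osc_union[OF um _ bm(4) r(1) _ sub(4) k(5,6) J2[unfolded A] J(4)[unfolded A]]) (use sub q in auto)
  then show ?thesis by (simp add: q_def power_mult_distrib)
qed

text \<open>Some value a = u(z) with z in the annulus is good enough: otherwise integration over z
  would contradict the bound on \<open>osc\<close>. The slack \<delta> makes the contradiction
  strict, also for e = 0. The constant is 6389508096 / 4, since the annulus has area at least 4
  r^2.\<close>

proposition annulus_Poincare: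
  assumes s: "sobolev \<Omega> u Du" and \<Omega>: "open \<Omega>" "bounded \<Omega>" and r: "r > 0" "cube c (12 * r) \<subseteq> \<Omega>"
    and \<delta>: "\<delta> > 0" and e: "energy Du (cube c (3 * r) - cube c r) = ennreal e" "e \<ge> 0"
  shows "\<exists>a. (\<integral>\<^sup>+x. indicator (cube c (3 * r) - cube c r) x * ennreal ((norm (u x - a))\<^sup>2) \<partial>lborel)
    \<le> ennreal (1597377024 * r\<^sup>2 * e + \<delta>)"
proof (rule ccontr)
  assume neg: "\<not> ?thesis"
  let ?A = "cube c (3 * r) - cube c r"
  let ?m = "1597377024 * r\<^sup>2 * e + \<delta>"
  note [measurable] = sobolev_borel(1)[OF s]
  define d where "d = (\<chi> i. c $ i + 2 * r)"
  have "cube d r \<subseteq> ?A"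
  proof
    fix x assume "x \<in> cube d r"
    then have x: "\<bar>x $ i - (c $ i + 2 * r)\<bar> < r" for i by (auto simp: cube_def d_def)
    have "\<bar>x $ i - c $ i\<bar> < 3 * r" "\<not> \<bar>x $ i - c $ i\<bar> < r" for i using x[of i] r by auto
    then show "x \<in> ?A" by (auto simp: cube_def)
  qed
  from emeasure_mono[OF this, of lborel] have m: "ennreal (4 * r\<^sup>2) \<le> emeasure lborel ?A"
    using emeasure_cube[of r d] r(1) by (simp add: power_mult_distrib)
  have "ennreal (4 * r\<^sup>2) * ennreal ?m \<le> emeasure lborel ?A * ennreal ?m"
    by (rule mult_right_mono[OF m]) simp
  also have "\<dots> = (\<integral>\<^sup>+z. indicator ?A z * ennreal ?m \<partial>lborel)"
    by (simp add: nn_integral_multc)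
  \<comment> \<open>The negated claim is used for a = u(z), separately for every z.\<close>
  also have "\<dots> \<le> (\<integral>\<^sup>+z. indicator ?A z * (\<integral>\<^sup>+x. indicator ?A x * ennreal ((norm (u x - u z))\<^sup>2) \<partial>lborel) \<partial>lborel)"
    using neg by (intro nn_integral_mono mult_left_mono) (auto simp: not_le intro: less_imp_le)
  also have "\<dots> = osc u ?A ?A"
    unfolding osc_def
    by (intro nn_integral_cong) (simp add: nn_integral_cmult[symmetric] mult.assoc norm_minus_commute)
  also have "\<dots> \<le> ennreal (6389508096 * r ^ 4) * ennreal e"
    using osc_annulus[OF s \<Omega> r] unfolding e .
  finally have le: "ennreal (4 * r\<^sup>2) * ennreal ?m \<le> ennreal (6389508096 * r ^ 4) * ennreal e" .
  have "ennreal (4 * r\<^sup>2 * ?m) = ennreal (4 * r\<^sup>2) * ennreal ?m"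
    "ennreal (6389508096 * r ^ 4 * e) = ennreal (6389508096 * r ^ 4) * ennreal e"
    by (rule ennreal_mult', simp)+
  then have "ennreal (4 * r\<^sup>2 * ?m) \<le> ennreal (6389508096 * r ^ 4 * e)"
    using le by (simp only:)
  then have "4 * r\<^sup>2 * ?m \<le> 6389508096 * r ^ 4 * e"
    using e(2) by (subst (asm) ennreal_le_iff) auto
  moreover have "4 * r\<^sup>2 * ?m = 6389508096 * r ^ 4 * e + 4 * r\<^sup>2 * \<delta>"
    by (simp add: power2_eq_square power4_eq_xxxx algebra_simps)
  ultimately show False using r(1) \<delta> by (simp add: mult_le_0_iff)
qed

subsection \<open>The Caccioppoli inequality and hole filling\<close>

text \<open>The real-valued counterpart of \<open>energy\<close>: hole filling subtracts the
  integral over the inner square, which is awkward in \<open>ennreal\<close>.\<close>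

definition dirichlet :: "(real^2 \<Rightarrow> real^2^2) \<Rightarrow> (real^2) set \<Rightarrow> real" where
  "dirichlet Du T = (LINT x|lborel. indicator T x * (norm (Du x))\<^sup>2)"

lemma sobolev_integrable:
  assumes "sobolev \<Omega> u Du" shows "integrable lborel (\<lambda>x. (norm (Du x))\<^sup>2)" "integrable lborel (\<lambda>x. (norm (u x))\<^sup>2)"
  using assms unfolding power2_norm_mat power2_norm_vec sobolev_def sq_int_def by auto

lemma dirichlet_integrable:
  assumes "sobolev \<Omega> u Du" "T \<in> sets borel" shows "integrable lborel (\<lambda>x. indicator T x * (norm (Du x))\<^sup>2)"
  using integrable_mult_indicator[OF _ sobolev_integrable(1)[OF assms(1)], of T] assms(2) by simp

lemma energy_eq_dirichlet:
  assumes "sobolev \<Omega> u Du" "T \<in> sets borel" shows "energy Du T = ennreal (dirichlet Du T)"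
proof -
  have "energy Du T = (\<integral>\<^sup>+x. ennreal (indicator T x * (norm (Du x))\<^sup>2) \<partial>lborel)"
    unfolding energy_def by (intro nn_integral_cong) (auto simp: indicator_def)
  also have "\<dots> = ennreal (dirichlet Du T)"
    unfolding dirichlet_def by (rule nn_integral_eq_integral[OF dirichlet_integrable[OF assms]]) simp
  finally show ?thesis .
qed

lemma dirichlet_nonneg: "dirichlet Du T \<ge> 0"
  unfolding dirichlet_def by (rule integral_nonneg_AE) simp

lemma dirichlet_mono:
  assumes "sobolev \<Omega> u Du" "S \<in> sets borel" "T \<in> sets borel" "S \<subseteq> T" shows "dirichlet Du S \<le> dirichlet Du T"
  unfolding dirichlet_def
  by (rule integral_mono[OF dirichlet_integrable[OF assms(1,2)] dirichlet_integrable[OF assms(1,3)]])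
    (use assms(4) in \<open>auto simp: indicator_def\<close>)

lemma dirichlet_Diff:
  assumes "sobolev \<Omega> u Du" "S \<in> sets borel" "T \<in> sets borel" "S \<subseteq> T"
  shows "dirichlet Du (T - S) = dirichlet Du T - dirichlet Du S"
  unfolding dirichlet_def
  by (subst Bochner_Integration.integral_diff[symmetric, OF dirichlet_integrable[OF assms(1,3)] dirichlet_integrable[OF assms(1,2)]])
    (use assms(4) in \<open>auto simp: indicator_def intro!: Bochner_Integration.integral_cong\<close>)

text \<open>With \<open>A = Du\<close>, \<open>v = u - a\<close> and \<open>g = \<nabla>\<eta>\<close>, the four products add up to
  \<open>(A + p cof A) \<cdot> \<nabla>(\<eta>\<^sup>2 v)\<close>.\<close>

lemma stress_inequality:
  fixes D11 D12 D21 D22 p \<gamma> \<eta> v1 v2 g1 g2 :: real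
  assumes p: "0 \<le> p" "p \<le> \<gamma>" "0 \<le> p * (D11 * D22 - D12 * D21)" and \<eta>: "0 \<le> \<eta>" "\<eta> \<le> 1"
  shows "\<eta>\<^sup>2 * (D11\<^sup>2 + D12\<^sup>2 + D21\<^sup>2 + D22\<^sup>2) \<le>
     (D11 + p * D22) * (\<eta>\<^sup>2 * D11 + v1 * (2 * \<eta> * g1)) + (D12 - p * D21) * (\<eta>\<^sup>2 * D12 + v1 * (2 * \<eta> * g2))
   + (D21 - p * D12) * (\<eta>\<^sup>2 * D21 + v2 * (2 * \<eta> * g1)) + (D22 + p * D11) * (\<eta>\<^sup>2 * D22 + v2 * (2 * \<eta> * g2))
   + (1 + \<gamma>) * ((D11\<^sup>2 + D12\<^sup>2 + D21\<^sup>2 + D22\<^sup>2) + (v1\<^sup>2 + v2\<^sup>2) * (g1\<^sup>2 + g2\<^sup>2))"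
proof -
  define N where "N = D11\<^sup>2 + D12\<^sup>2 + D21\<^sup>2 + D22\<^sup>2"
  define W where "W = (v1\<^sup>2 + v2\<^sup>2) * (g1\<^sup>2 + g2\<^sup>2)"
  \<comment> \<open>X1 and X2 are the Frobenius products of v \<otimes> g with A and with cof A, and
    W is the squared norm of v \<otimes> g. The cofactor matrix has the same norm as A, so
    completing squares bounds both in the same way.\<close>
  define X1 where "X1 = D11 * v1 * g1 + D12 * v1 * g2 + D21 * v2 * g1 + D22 * v2 * g2"
  define X2 where "X2 = D22 * v1 * g1 - D21 * v1 * g2 - D12 * v2 * g1 + D11 * v2 * g2"
  have "0 \<le> (D11 + v1 * g1)\<^sup>2 + (D12 + v1 * g2)\<^sup>2 + (D21 + v2 * g1)\<^sup>2 + (D22 + v2 * g2)\<^sup>2"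
    by (intro add_nonneg_nonneg zero_le_power2)
  also have "\<dots> = N + W + 2 * X1"
    unfolding N_def W_def X1_def by (simp add: power2_eq_square algebra_simps)
  finally have X1: "- (2 * X1) \<le> N + W" by simp
  have "0 \<le> (D22 + v1 * g1)\<^sup>2 + (- D21 + v1 * g2)\<^sup>2 + (- D12 + v2 * g1)\<^sup>2 + (D11 + v2 * g2)\<^sup>2"
    by (intro add_nonneg_nonneg zero_le_power2)
  also have "\<dots> = N + W + 2 * X2"
    unfolding N_def W_def X2_def by (simp add: power2_eq_square algebra_simps)
  finally have X2: "- (2 * X2) \<le> N + W" by simp
  have NW: "0 \<le> N + W" unfolding N_def W_def by simp
  have "- (2 * (X1 + p * X2)) \<le> (N + W) + p * (N + W)"
    using X1 mult_left_mono[OF X2 p(1)] by (simp add: algebra_simps)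
  also have "\<dots> \<le> (1 + \<gamma>) * (N + W)"
    using mult_right_mono[OF p(2) NW] by (simp add: algebra_simps)
  finally have "\<eta> * (- (2 * (X1 + p * X2))) \<le> \<eta> * ((1 + \<gamma>) * (N + W))"
    by (rule mult_left_mono[OF _ \<eta>(1)])
  also have "\<dots> \<le> 1 * ((1 + \<gamma>) * (N + W))"
    using p NW by (intro mult_right_mono \<eta>(2)) auto
  finally have main: "\<eta> * (- (2 * (X1 + p * X2))) \<le> (1 + \<gamma>) * (N + W)" by simp
  have "0 \<le> \<eta>\<^sup>2 * (2 * (p * (D11 * D22 - D12 * D21)))"
    by (rule mult_nonneg_nonneg[OF zero_le_power2 mult_nonneg_nonneg[OF _ p(3)]]) simp
  moreover have "(D11 + p * D22) * (\<eta>\<^sup>2 * D11 + v1 * (2 * \<eta> * g1)) + (D12 - p * D21) * (\<eta>\<^sup>2 * D12 + v1 * (2 * \<eta> * g2))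
   + (D21 - p * D12) * (\<eta>\<^sup>2 * D21 + v2 * (2 * \<eta> * g1)) + (D22 + p * D11) * (\<eta>\<^sup>2 * D22 + v2 * (2 * \<eta> * g2))
    = \<eta>\<^sup>2 * N + \<eta>\<^sup>2 * (2 * (p * (D11 * D22 - D12 * D21))) - \<eta> * (- (2 * (X1 + p * X2)))"
    unfolding N_def X1_def X2_def by (simp add: power2_eq_square algebra_simps)
  ultimately show ?thesis
    using main unfolding N_def[symmetric] W_def[symmetric] by linarith
qed

text \<open>The weak equation with \<zeta> = \<eta>^2 says that F has integral 0. Off the annulus F
  is at least \<eta>^2 |Du|^2 by the sign of q det Du; on the annulus the stress inequality limits
  how negative F can be. The factor 2 K^2 / r^2 bounds |\<nabla>\<eta>|^2. The coefficient q stands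
  for \<rho>'(det Du).\<close>

lemma Caccioppoli:
  assumes s: "sobolev \<Omega> u Du" and \<Omega>: "open \<Omega>" "bounded \<Omega>"
    and q: "q \<in> borel_measurable borel" "\<And>x. 0 \<le> q x" "\<And>x. q x \<le> \<gamma>" "\<And>x. 0 \<le> q x * det (Du x)"
    and weak: "\<And>\<zeta>. test_fun \<Omega> \<zeta> \<Longrightarrow>
      (LINT x|lborel. frob (Du x + q x *\<^sub>R cof2 (Du x)) (Dcut \<zeta> u Du a x)) = 0"
    and r: "r > 0" and \<eta>: "cutoff K \<Omega> c r \<eta>" and K: "K > 0"
    and v: "(\<integral>\<^sup>+x. indicator (cube c (3 * r) - cube c r) x * ennreal ((norm (u x - a))\<^sup>2) \<partial>lborel) \<le> ennreal m" "m \<ge> 0"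
  shows "dirichlet Du (cube c r) \<le> (1 + \<gamma>) * (dirichlet Du (cube c (3 * r) - cube c r) + 2 * K\<^sup>2 / r\<^sup>2 * m)"
proof -
  let ?A = "cube c (3 * r) - cube c r"
  have \<eta>t: "test_fun \<Omega> \<eta>" and \<eta>01: "\<And>x. 0 \<le> \<eta> x" "\<And>x. \<eta> x \<le> 1" and \<eta>1: "\<And>x. x \<in> cube c r \<Longrightarrow> \<eta> x = 1"
    and \<eta>0: "\<And>x. x \<notin> cube c (3 * r) \<Longrightarrow> \<eta> x = 0" and \<eta>K: "\<And>j x. \<bar>pderiv2 \<eta> j x\<bar> \<le> K / r"
    using \<eta> unfolding cutoff_def by blast+
  have sm: "smooth_fun \<eta>" using \<eta>t by (rule test_fun_smooth)
  define \<zeta> where "\<zeta> x = \<eta> x * \<eta> x" for x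
  have \<zeta>: "test_fun \<Omega> \<zeta>" unfolding \<zeta>_def by (rule test_fun_mult_left[OF \<eta>t sm])
  have d\<zeta>: "pderiv2 \<zeta> j x = 2 * \<eta> x * pderiv2 \<eta> j x" for j x
    unfolding \<zeta>_def[abs_def] pderiv2_mult[OF sm sm] by simp
  have sq: "sq_int (\<lambda>x. Du x $ i $ j)" for i j
    using s unfolding sobolev_def by auto
  have qsq: "sq_int (\<lambda>x. q x * Du x $ i $ j)" for i j
    by (rule sq_int_bounded_mult[OF sq q(1), where B = \<gamma>]) (use q in auto)
  note dsq = cut_sq_int(2)[OF s \<zeta>, of a]
  define F where "F x = frob (Du x + q x *\<^sub>R cof2 (Du x)) (Dcut \<zeta> u Du a x)" for x
  have F_eq: "F x = (Du x $ 1 $ 1 + q x * Du x $ 2 $ 2) * Dcut \<zeta> u Du a x $ 1 $ 1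
      + (Du x $ 1 $ 2 - q x * Du x $ 2 $ 1) * Dcut \<zeta> u Du a x $ 1 $ 2
      + (Du x $ 2 $ 1 - q x * Du x $ 1 $ 2) * Dcut \<zeta> u Du a x $ 2 $ 1
      + (Du x $ 2 $ 2 + q x * Du x $ 1 $ 1) * Dcut \<zeta> u Du a x $ 2 $ 2" for x
    by (simp add: F_def frob_def cof2_def sum_2)
  have Fi: "integrable lborel F"
    unfolding F_eq
    by (intro Bochner_Integration.integrable_add sq_int_prod sq_int_add sq_int_diff sq qsq dsq)
  have F0: "(LINT x|lborel. F x) = 0"
    unfolding F_def by (rule weak[OF \<zeta>])
  note Am = sets.Diff[OF cube_borel cube_borel]
  note Di = dirichlet_integrable[OF s]
  have um [measurable]: "u \<in> borel_measurable borel" by (rule sobolev_borel[OF s])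
  have vi: "integrable lborel (\<lambda>x. indicator ?A x * (norm (u x - a))\<^sup>2)"
    and vm: "(LINT x|lborel. indicator ?A x * (norm (u x - a))\<^sup>2) \<le> m"
  proof -
    have eq: "(\<integral>\<^sup>+x. ennreal (indicator ?A x * (norm (u x - a))\<^sup>2) \<partial>lborel) =
        (\<integral>\<^sup>+x. indicator ?A x * ennreal ((norm (u x - a))\<^sup>2) \<partial>lborel)"
      by (intro nn_integral_cong) (auto simp: indicator_def)
    show i: "integrable lborel (\<lambda>x. indicator ?A x * (norm (u x - a))\<^sup>2)"
    proof (rule integrableI_nonneg)
      show "(\<integral>\<^sup>+x. ennreal (indicator ?A x * (norm (u x - a))\<^sup>2) \<partial>lborel) < \<infinity>"
        unfolding eq using v(1) by (rule order_le_less_trans) simp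
    qed (auto intro!: borel_measurable_times borel_measurable_indicator)
    show "(LINT x|lborel. indicator ?A x * (norm (u x - a))\<^sup>2) \<le> m"
      using v unfolding eq[symmetric] by (subst (asm) nn_integral_eq_integral[OF i]) auto
  qed
  have pt: "indicator (cube c r) x * (norm (Du x))\<^sup>2 \<le> F x + (1 + \<gamma>) *
      (indicator ?A x * (norm (Du x))\<^sup>2 + 2 * K\<^sup>2 / r\<^sup>2 * (indicator ?A x * (norm (u x - a))\<^sup>2))" for x
  proof -
    \<comment> \<open>Restricting \<nabla>\<eta> to the annulus does not change \<eta>
      \<nabla>\<eta>: on the open inner square \<eta> is constant, and off the outer square \<eta>
      itself is 0.\<close>
    define gx where "gx j = (if x \<in> ?A then pderiv2 \<eta> j x else 0)" for j
    have g: "2 * \<eta> x * pderiv2 \<eta> j x = 2 * \<eta> x * gx j" for j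
    proof (cases "x \<in> ?A")
      case False
      then have "x \<in> cube c r \<or> x \<notin> cube c (3 * r)" by auto
      then have "\<eta> x * pderiv2 \<eta> j x = 0"
      proof
        assume "x \<in> cube c r"
        then have "pderiv2 \<eta> j x = 0" by (rule pderiv2_eq_0[OF open_cube _ \<eta>1])
        then show ?thesis by simp
      qed (simp add: \<eta>0)
      then show ?thesis using False by (simp add: gx_def)
    qed (simp add: gx_def)
    define I where "I = (indicator ?A x :: real)"
    have G: "(gx 1)\<^sup>2 + (gx 2)\<^sup>2 \<le> I * (2 * K\<^sup>2 / r\<^sup>2)"
    proof (cases "x \<in> ?A")
      case True
      have "(pderiv2 \<eta> j x)\<^sup>2 \<le> (K / r)\<^sup>2" for j
        using power_mono[OF \<eta>K[of j x], of 2] by simp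
      from add_mono[OF this[of 1] this[of 2]] show ?thesis
        using True by (simp add: gx_def I_def power_divide)
    next
      case False
      then have "gx j = 0" for j unfolding gx_def by (rule if_not_P)
      then show ?thesis by (simp add: I_def)
    qed
    define N where "N = (norm (Du x))\<^sup>2"
    define V where "V = (norm (u x - a))\<^sup>2"
    have N: "N = (Du x $ 1 $ 1)\<^sup>2 + (Du x $ 1 $ 2)\<^sup>2 + (Du x $ 2 $ 1)\<^sup>2 + (Du x $ 2 $ 2)\<^sup>2"
      unfolding N_def power2_norm_mat sum_2 by simp
    have V: "V = (u x $ 1 - a $ 1)\<^sup>2 + (u x $ 2 - a $ 2)\<^sup>2"
      unfolding V_def power2_norm_vec by simp
    have VN: "V \<ge> 0" "N \<ge> 0" unfolding V_def N_def by auto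
    have det: "0 \<le> q x * (Du x $ 1 $ 1 * Du x $ 2 $ 2 - Du x $ 1 $ 2 * Du x $ 2 $ 1)"
      using q(4)[of x] by (simp add: det_2)
    have \<gamma>: "0 \<le> 1 + \<gamma>" using q(2)[of x] q(3)[of x] by linarith
    have "(\<eta> x)\<^sup>2 * N \<le> F x + (1 + \<gamma>) * (N + V * ((gx 1)\<^sup>2 + (gx 2)\<^sup>2))"
      using stress_inequality[OF q(2)[of x] q(3)[of x] det \<eta>01(1)[of x] \<eta>01(2)[of x],
          of "u x $ 1 - a $ 1" "gx 1" "gx 2" "u x $ 2 - a $ 2"]
      unfolding F_eq N V by (simp add: Dcut_def d\<zeta> g \<zeta>_def power2_eq_square)
    also have "F x + (1 + \<gamma>) * (N + V * ((gx 1)\<^sup>2 + (gx 2)\<^sup>2)) \<le> F x + (1 + \<gamma>) * (N + V * (I * (2 * K\<^sup>2 / r\<^sup>2)))"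
      using \<gamma> VN G by (intro add_left_mono mult_left_mono) auto
    finally have 1: "(\<eta> x)\<^sup>2 * N \<le> F x + (1 + \<gamma>) * (N + V * (I * (2 * K\<^sup>2 / r\<^sup>2)))" .
    show ?thesis
    proof (cases "x \<in> ?A")
      case True
      then have "indicator (cube c r) x * N = 0" by (simp add: indicator_def)
      moreover have "0 \<le> (\<eta> x)\<^sup>2 * N" using VN by simp
      ultimately show ?thesis using 1 True unfolding N_def[symmetric] V_def[symmetric]
        by (simp add: I_def mult_ac)
    next
      \<comment> \<open>Here the error term of the stress inequality is not affordable, so F is
        computed directly with gradient term 0.\<close>
      case False
      have gx0: "gx j = 0" for j using False unfolding gx_def by (rule if_not_P)
      have d0: "Dcut \<zeta> u Du a x $ i $ j = (\<eta> x)\<^sup>2 * Du x $ i $ j" for i j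
        by (simp add: Dcut_def d\<zeta> g gx0 \<zeta>_def power2_eq_square)
      have "F x = (\<eta> x)\<^sup>2 * N + (\<eta> x)\<^sup>2 * (2 * (q x * (Du x $ 1 $ 1 * Du x $ 2 $ 2 - Du x $ 1 $ 2 * Du x $ 2 $ 1)))"
        unfolding F_eq d0 N by (simp add: power2_eq_square algebra_simps)
      moreover have "0 \<le> (\<eta> x)\<^sup>2 * (2 * (q x * (Du x $ 1 $ 1 * Du x $ 2 $ 2 - Du x $ 1 $ 2 * Du x $ 2 $ 1)))"
        by (rule mult_nonneg_nonneg[OF zero_le_power2 mult_nonneg_nonneg[OF _ det]]) simp
      ultimately have "(\<eta> x)\<^sup>2 * N \<le> F x" by simp
      moreover have "indicator (cube c r) x * N \<le> (\<eta> x)\<^sup>2 * N"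
        using VN \<eta>1[of x] by (auto simp: indicator_def)
      ultimately show ?thesis using False unfolding N_def[symmetric] by simp
    qed
  qed
  have "dirichlet Du (cube c r) \<le> (LINT x|lborel. F x + (1 + \<gamma>) *
      (indicator ?A x * (norm (Du x))\<^sup>2 + 2 * K\<^sup>2 / r\<^sup>2 * (indicator ?A x * (norm (u x - a))\<^sup>2)))"
    unfolding dirichlet_def
    by (rule integral_mono[OF Di[OF cube_borel] _ pt]) (intro Bochner_Integration.integrable_add integrable_mult_right Fi Di[OF Am] vi)
  also have "\<dots> = (LINT x|lborel. F x) + (1 + \<gamma>) * (dirichlet Du ?A + 2 * K\<^sup>2 / r\<^sup>2 * (LINT x|lborel. indicator ?A x * (norm (u x - a))\<^sup>2))"
    unfolding dirichlet_def using Fi Di[OF Am] vi by simp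
  also have "\<dots> \<le> (1 + \<gamma>) * (dirichlet Du ?A + 2 * K\<^sup>2 / r\<^sup>2 * m)"
  proof -
    have "0 \<le> 1 + \<gamma>" using q(2,3) by (meson add_nonneg_nonneg order_trans zero_le_one)
    then show ?thesis using vm unfolding F0
      by (simp only: add_0) (intro mult_left_mono add_left_mono, auto)
  qed
  finally show ?thesis .
qed

text \<open>Packages the uniformity: \<theta> is chosen before the domain, the map and the
  coefficient q, so that it can depend on \<gamma> only.\<close>

definition hole_constant :: "real \<Rightarrow> real \<Rightarrow> bool" where
  "hole_constant \<gamma> \<theta> \<longleftrightarrow> (\<forall>\<Omega> u Du q. sobolev \<Omega> u Du \<and> open \<Omega> \<and> bounded \<Omega> \<and>
    q \<in> borel_measurable borel \<and> (\<forall>x. 0 \<le> q x \<and> q x \<le> \<gamma> \<and> 0 \<le> q x * det (Du x)) \<and>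
    (\<forall>\<zeta> a. test_fun \<Omega> \<zeta> \<longrightarrow> (LINT x|lborel. frob (Du x + q x *\<^sub>R cof2 (Du x)) (Dcut \<zeta> u Du a x)) = 0) \<longrightarrow>
    (\<forall>c r. r > 0 \<and> cube c (12 * r) \<subseteq> \<Omega> \<longrightarrow> dirichlet Du (cube c r) \<le> \<theta> * dirichlet Du (cube c (3 * r))))"

text \<open>Caccioppoli and Poincare give D(r) <= M (D(3r) - D(r)), and moving the last term to the
  left yields \<theta> = M / (M + 1). M >= 1 ensures \<theta> >= 1/2, which later keeps the Hoelder
  exponent below 1.\<close>

lemma hole_filling:
  fixes \<gamma> :: real
  assumes "\<gamma> > 0"
  obtains \<theta> where "1 / 2 \<le> \<theta>" "\<theta> < 1" "hole_constant \<gamma> \<theta>"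
proof -
  obtain K where K: "K > 0" "\<And>c r \<Omega>. r > 0 \<Longrightarrow> cube c (4 * r) \<subseteq> \<Omega> \<Longrightarrow> \<exists>\<eta>. cutoff K \<Omega> c r \<eta>"
    by (rule ex_cutoff) blast
  \<comment> \<open>The 1 accounts for the Dirichlet integral over the annulus, the other summand
    for the zero-order term: the r^2 of the Poincare inequality cancels the r^2 in the gradient
    bound.\<close>
  define M where "M = (1 + \<gamma>) * (1 + 2 * K\<^sup>2 * 1597377024)"
  have "1 * 1 \<le> M"
    unfolding M_def using assms by (intro mult_mono) auto
  then have M: "M \<ge> 1" by simp
  show ?thesis
  proof (rule that[of "M / (M + 1)"])
    show "1 / 2 \<le> M / (M + 1)" "M / (M + 1) < 1" using M by (auto simp: field_simps)
    show "hole_constant \<gamma> (M / (M + 1))"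
      unfolding hole_constant_def
    proof (intro allI impI, elim conjE)
      fix \<Omega> u Du q c and r :: real
      assume s: "sobolev \<Omega> u Du" and \<Omega>: "open \<Omega>" "bounded \<Omega>" and q0: "q \<in> borel_measurable borel"
        and q': "\<forall>x. 0 \<le> q x \<and> q x \<le> \<gamma> \<and> 0 \<le> q x * det (Du x)"
        and weak': "\<forall>\<zeta> a. test_fun \<Omega> \<zeta> \<longrightarrow>
          (LINT x|lborel. frob (Du x + q x *\<^sub>R cof2 (Du x)) (Dcut \<zeta> u Du a x)) = 0"
        and r: "r > 0" "cube c (12 * r) \<subseteq> \<Omega>"
      have q: "q \<in> borel_measurable borel" "\<And>x. 0 \<le> q x" "\<And>x. q x \<le> \<gamma>" "\<And>x. 0 \<le> q x * det (Du x)"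
        using q0 q' by auto
      note weak = weak'[rule_format]
      let ?A = "cube c (3 * r) - cube c r"
      have sub: "cube c p \<subseteq> cube c p'" if "p \<le> p'" for p p'
        using that unfolding cube_def by (auto intro: order_less_le_trans)
      have "cube c (4 * r) \<subseteq> \<Omega>" using sub[of "4 * r" "12 * r"] r by auto
      then obtain \<eta> where \<eta>: "cutoff K \<Omega> c r \<eta>" using K(2) r(1) by blast
      have le: "dirichlet Du (cube c r) \<le> M * dirichlet Du ?A + e" if e: "e > 0" for e
      proof -
        \<comment> \<open>Chosen so that the slack of the Poincare inequality contributes exactly e,
          which is then sent to 0.\<close>
        define \<delta> where "\<delta> = e * r\<^sup>2 / ((1 + \<gamma>) * (2 * K\<^sup>2))"
        have \<delta>: "\<delta> > 0" unfolding \<delta>_def using e r K assms by (intro divide_pos_pos mult_pos_pos) auto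
        obtain a where a: "(\<integral>\<^sup>+x. indicator ?A x * ennreal ((norm (u x - a))\<^sup>2) \<partial>lborel)
            \<le> ennreal (1597377024 * r\<^sup>2 * dirichlet Du ?A + \<delta>)"
          using annulus_Poincare[OF s \<Omega> r \<delta> energy_eq_dirichlet[OF s sets.Diff[OF cube_borel cube_borel]] dirichlet_nonneg] by blast
        have "dirichlet Du (cube c r) \<le> (1 + \<gamma>) * (dirichlet Du ?A + 2 * K\<^sup>2 / r\<^sup>2 * (1597377024 * r\<^sup>2 * dirichlet Du ?A + \<delta>))"
          by (rule Caccioppoli[OF s \<Omega> q weak r(1) \<eta> K(1) a]) (use \<delta> dirichlet_nonneg[of Du ?A] in auto)
        also have "\<dots> = M * dirichlet Du ?A + (1 + \<gamma>) * (2 * K\<^sup>2) / r\<^sup>2 * \<delta>"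
          unfolding M_def using r(1) by (simp add: field_simps)
        also have "(1 + \<gamma>) * (2 * K\<^sup>2) / r\<^sup>2 * \<delta> = e"
        proof -
          have "(1 + \<gamma>) * (2 * K\<^sup>2) \<noteq> 0" using assms K(1) by auto
          then show ?thesis unfolding \<delta>_def using r(1) by simp
        qed
        finally show ?thesis .
      qed
      have "dirichlet Du (cube c r) \<le> M * dirichlet Du ?A"
        by (rule field_le_epsilon) (rule le)
      also have "dirichlet Du ?A = dirichlet Du (cube c (3 * r)) - dirichlet Du (cube c r)"
        by (rule dirichlet_Diff[OF s cube_borel cube_borel sub]) (use r in simp)
      finally have "(M + 1) * dirichlet Du (cube c r) \<le> M * dirichlet Du (cube c (3 * r))"
        by (simp add: algebra_simps)
      then show "dirichlet Du (cube c r) \<le> M / (M + 1) * dirichlet Du (cube c (3 * r))"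
        using M by (simp add: field_simps)
    qed
  qed
qed

text \<open>All bounds come from tangent lines lying below the convex \<rho>: compared at s - 1 and
  at 0 they give the signs, and a slope above \<gamma> would eventually overtake the affine part of
  \<rho>.\<close>

lemma energy_density_deriv:
  fixes \<rho> :: "real \<Rightarrow> real"
  assumes \<rho>: "smooth_fun \<rho>" "convex_on UNIV \<rho>" "\<And>s. s \<le> 0 \<Longrightarrow> \<rho> s = 0" "\<And>s. s \<ge> s0 \<Longrightarrow> \<rho> s = \<gamma> * s + \<kappa>"
  shows "deriv \<rho> \<in> borel_measurable borel" "0 \<le> deriv \<rho> s" "deriv \<rho> s \<le> \<gamma>" "0 \<le> deriv \<rho> s * s"
proof -
  have D: "(\<rho> has_real_derivative deriv \<rho> s) (at s)" for s
    using smooth_fun_differentiable[OF \<rho>(1), of s]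
    by (metis DERIV_imp_deriv real_differentiable_def)
  have "frechet_derivative \<rho> (at s) = (*) (deriv \<rho> s)" for s
    by (rule frechet_derivative_eqI) (use D in \<open>simp add: has_field_derivative_def\<close>)
  then have "deriv \<rho> = (\<lambda>s. frechet_derivative \<rho> (at s) 1)" by auto
  then show "deriv \<rho> \<in> borel_measurable borel"
    using smooth_fun_borel[OF smooth_fun_frechet[OF \<rho>(1), of 1]] by simp
  have tan: "\<rho> x - \<rho> c \<ge> deriv \<rho> c * (x - c)" for x c
    by (rule convex_on_imp_above_tangent[OF \<rho>(2)]) (use D in auto)
  have neg: "deriv \<rho> c \<ge> 0" if "c \<le> 0" for c
    using tan[of c "c - 1"] \<rho>(3)[of c] \<rho>(3)[of "c - 1"] that by simp
  have nonneg: "\<rho> x \<ge> 0" for x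
  proof (cases "x \<le> 0")
    case False
    then have "0 \<le> deriv \<rho> 0 * (x - 0)" using neg[of 0] by simp
    then show ?thesis using tan[of 0 x] \<rho>(3)[of 0] by simp
  qed (simp add: \<rho>(3))
  show pos: "0 \<le> deriv \<rho> s"
  proof (cases "s \<le> 0")
    case False
    then have "deriv \<rho> s * s \<ge> 0" using tan[of s 0] \<rho>(3)[of 0] nonneg[of s] by simp
    then show ?thesis using False by (simp add: zero_le_mult_iff)
  qed (rule neg)
  show "deriv \<rho> s \<le> \<gamma>"
  proof (rule ccontr)
    assume "\<not> deriv \<rho> s \<le> \<gamma>"
    then have g: "deriv \<rho> s - \<gamma> > 0" by simp
    \<comment> \<open>For x >= s0 the tangent inequality reads (\<rho>'(s) - \<gamma>) x <= B; the x
      below violates it.\<close>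
    define B where "B = \<kappa> - \<rho> s + deriv \<rho> s * s"
    define x where "x = max s0 ((B + 1) / (deriv \<rho> s - \<gamma>))"
    have "(deriv \<rho> s - \<gamma>) * x \<le> B"
      using tan[of s x] \<rho>(4)[of x] by (simp add: x_def B_def algebra_simps)
    moreover have "(B + 1) / (deriv \<rho> s - \<gamma>) \<le> x" by (simp add: x_def)
    then have "B + 1 \<le> (deriv \<rho> s - \<gamma>) * x" using g by (simp add: field_simps)
    ultimately show False by simp
  qed
  show "0 \<le> deriv \<rho> s * s"
  proof (cases "s < 0")
    case True
    then show ?thesis
      using tan[of s 0] \<rho>(3)[of s] \<rho>(3)[of 0] by simp
  qed (use pos in simp)
qed

text \<open>Stationarity of the original u is tested with the cut-off of its Borel representative v.
  Both integrands agree almost everywhere on \<Omega>, which also supplies the measurability of the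
  one that contains Du.\<close>

lemma stationary_sobolev:
  assumes st: "stationary \<rho> \<Omega> u Du" and \<Omega>: "open \<Omega>" "bounded \<Omega>" and s: "sobolev \<Omega> v Dv"
    and ae: "AE x in lebesgue. x \<in> \<Omega> \<longrightarrow> v x = u x \<and> Dv x = Du x"
    and \<rho>: "deriv \<rho> \<in> borel_measurable borel" and \<zeta>: "test_fun \<Omega> \<zeta>"
  shows "(LINT x|lborel. frob (Dv x + deriv \<rho> (det (Dv x)) *\<^sub>R cof2 (Dv x)) (Dcut \<zeta> v Dv a x)) = 0"
proof -
  let ?F = "\<lambda>D x. frob (D x + deriv \<rho> (det (D x)) *\<^sub>R cof2 (D x)) (Dcut \<zeta> v Dv a x)"
  note [measurable] = sobolev_borel(4)[OF s] \<rho> sq_int_borel[OF cut_sq_int(2)[OF s \<zeta>]]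
  have m: "?F Dv \<in> borel_measurable borel"
    unfolding frob_def cof2_def det_2 sum_2 by simp
  have O: "\<Omega> \<in> sets lebesgue" "\<Omega> \<in> sets borel" using \<Omega> by auto
  have z: "?F Dv x = 0" if "x \<notin> \<Omega>" for x
    using test_fun_out[OF \<zeta> that] by (simp add: Dcut_def frob_def)
  have m1: "(\<lambda>x. indicator \<Omega> x *\<^sub>R ?F Dv x) \<in> borel_measurable lebesgue"
    using m O by (auto intro!: measurable_completion borel_measurable_scaleR borel_measurable_indicator)
  have ae': "AE x in lebesgue. indicator \<Omega> x *\<^sub>R ?F Dv x = indicator \<Omega> x *\<^sub>R ?F Du x"
    using ae by eventually_elim (auto simp: indicator_def)
  have m2: "(\<lambda>x. indicator \<Omega> x *\<^sub>R ?F Du x) \<in> borel_measurable lebesgue"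
    by (rule borel_measurable_AE[OF m1 ae'])
  have "(LINT x|lborel. ?F Dv x) = (LINT x:\<Omega>|lebesgue. ?F Dv x)"
    by (rule LINT_lebesgue_eq[symmetric, OF m z])
  also have "\<dots> = (LINT x:\<Omega>|lebesgue. ?F Du x)"
    unfolding set_lebesgue_integral_def by (rule integral_cong_AE[OF m1 m2 ae'])
  also have "\<dots> = 0"
    using st W012_cut[OF s \<Omega> \<zeta>, of a] unfolding stationary_def by blast
  finally show ?thesis .
qed

subsection \<open>Averages and Hoelder continuity\<close>

definition average :: "(real^2 \<Rightarrow> real^2) \<Rightarrow> (real^2) set \<Rightarrow> real^2" where
  "average u X = (1 / measure lborel X) *\<^sub>R (LINT x|lborel. indicator X x *\<^sub>R u x)"

text \<open>The variance decomposition: the integrals of |u - b|^2 and of |u - A|^2 over X, with A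
  the average, differ by the measure of X times |A - b|^2.\<close>

lemma average_square_le:
  assumes u: "integrable lborel u" "integrable lborel (\<lambda>x. (norm (u x))\<^sup>2)"
    and X: "X \<in> sets borel" "emeasure lborel X < \<infinity>" "measure lborel X > 0"
  shows "ennreal (measure lborel X) * ennreal ((norm (average u X - b))\<^sup>2) \<le>
    (\<integral>\<^sup>+x. indicator X x * ennreal ((norm (u x - b))\<^sup>2) \<partial>lborel)"
proof -
  define m where "m = measure lborel X"
  define A where "A = average u X"
  have [measurable]: "X \<in> sets borel" "u \<in> borel_measurable borel" using X u(1) by auto
  have i1: "integrable lborel (indicator X :: real^2 \<Rightarrow> real)" "(LINT x|lborel. indicator X x :: real) = m"
    using X by (auto simp: m_def intro!: integrable_real_indicator)
  have iu: "integrable lborel (\<lambda>x. indicator X x *\<^sub>R u x)"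
    using integrable_mult_indicator[OF _ u(1), of X] by simp
  have mA: "(LINT x|lborel. indicator X x *\<^sub>R u x) = m *\<^sub>R A"
    using X(3) by (simp add: A_def average_def m_def)
  have iu2: "integrable lborel (\<lambda>x. indicator X x * (norm (u x))\<^sup>2)"
    using integrable_mult_indicator[OF _ u(2), of X] by simp
  have ii: "integrable lborel (\<lambda>x. (indicator X x *\<^sub>R u x) \<bullet> w)"
    "(LINT x|lborel. (indicator X x *\<^sub>R u x) \<bullet> w) = (m *\<^sub>R A) \<bullet> w" for w
    using integrable_inner_left[of w lborel, OF iu] integral_inner_left[of w lborel, OF iu] mA by (simp_all only:)
  have ex: "indicator X x * (norm (u x - w))\<^sup>2 = indicator X x * (norm (u x))\<^sup>2 - 2 * ((indicator X x *\<^sub>R u x) \<bullet> w) + (norm w)\<^sup>2 * indicator X x"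
    for x w
    by (simp add: power2_norm_eq_inner inner_diff_left inner_diff_right inner_commute algebra_simps)
  have iw: "integrable lborel (\<lambda>x. indicator X x * (norm (u x - w))\<^sup>2)"
    and Iw: "(LINT x|lborel. indicator X x * (norm (u x - w))\<^sup>2) =
      (LINT x|lborel. indicator X x * (norm (u x))\<^sup>2) - 2 * ((m *\<^sub>R A) \<bullet> w) + (norm w)\<^sup>2 * m" for w
    unfolding ex using iu2 ii i1 by auto
  have "0 \<le> (LINT x|lborel. indicator X x * (norm (u x - A))\<^sup>2)"
    by (rule integral_nonneg_AE) simp
  then have "m * (norm (A - b))\<^sup>2 \<le> (LINT x|lborel. indicator X x * (norm (u x - b))\<^sup>2)"
    unfolding Iw by (simp add: power2_norm_eq_inner inner_diff_left inner_diff_right inner_commute algebra_simps)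
  then have "ennreal (m * (norm (A - b))\<^sup>2) \<le> ennreal (LINT x|lborel. indicator X x * (norm (u x - b))\<^sup>2)"
    by (rule ennreal_leI)
  also have "\<dots> = (\<integral>\<^sup>+x. ennreal (indicator X x * (norm (u x - b))\<^sup>2) \<partial>lborel)"
    by (rule nn_integral_eq_integral[symmetric, OF iw]) simp
  also have "\<dots> = (\<integral>\<^sup>+x. indicator X x * ennreal ((norm (u x - b))\<^sup>2) \<partial>lborel)"
    by (intro nn_integral_cong) (auto simp: indicator_def)
  finally show ?thesis
    using X(3) by (simp add: m_def A_def ennreal_mult)
qed

text \<open>The preceding inequality is applied once in each variable, with b =
  \<open>average u Y\<close> and then with b = u(x).\<close>

lemma average_diff_le:
  assumes u: "integrable lborel u" "integrable lborel (\<lambda>x. (norm (u x))\<^sup>2)"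
    and X: "X \<in> sets borel" "emeasure lborel X < \<infinity>" "measure lborel X > 0"
    and Y: "Y \<in> sets borel" "emeasure lborel Y < \<infinity>" "measure lborel Y > 0"
  shows "ennreal (measure lborel X * measure lborel Y * (norm (average u X - average u Y))\<^sup>2) \<le> osc u X Y"
proof -
  have [measurable]: "X \<in> sets borel" "Y \<in> sets borel" "u \<in> borel_measurable borel" using X Y u(1) by auto
  have "ennreal (measure lborel X * measure lborel Y * (norm (average u X - average u Y))\<^sup>2) =
      ennreal (measure lborel Y) * (ennreal (measure lborel X) * ennreal ((norm (average u X - average u Y))\<^sup>2))"
    by (simp add: ennreal_mult mult_ac)
  also have "\<dots> \<le> ennreal (measure lborel Y) * (\<integral>\<^sup>+x. indicator X x * ennreal ((norm (u x - average u Y))\<^sup>2) \<partial>lborel)"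
    by (intro mult_left_mono average_square_le[OF u X]) simp
  also have "\<dots> = (\<integral>\<^sup>+x. indicator X x * (ennreal (measure lborel Y) * ennreal ((norm (average u Y - u x))\<^sup>2)) \<partial>lborel)"
    by (subst nn_integral_cmult[symmetric]) (auto simp: mult_ac norm_minus_commute)
  also have "\<dots> \<le> (\<integral>\<^sup>+x. indicator X x * (\<integral>\<^sup>+y. indicator Y y * ennreal ((norm (u y - u x))\<^sup>2) \<partial>lborel) \<partial>lborel)"
    by (intro nn_integral_mono mult_left_mono average_square_le[OF u Y]) simp
  also have "\<dots> = osc u X Y"
    unfolding osc_def
    by (intro nn_integral_cong) (simp add: nn_integral_cmult[symmetric] mult.assoc norm_minus_commute)
  finally show ?thesis .
qed

lemma sobolev_L1:
  assumes s: "sobolev \<Omega> u Du" and \<Omega>: "bounded \<Omega>"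
  shows "integrable lborel u"
proof -
  have "integrable lborel (\<lambda>x. u x $ i)" for i
    by (rule sq_int_integrable[OF _ \<Omega>]) (use s in \<open>auto simp: sobolev_def\<close>)
  then have "integrable lborel (\<lambda>x. \<Sum>i\<in>UNIV. u x $ i *\<^sub>R axis i (1::real))"
    by (intro Bochner_Integration.integrable_sum integrable_scaleR_left) auto
  moreover have "(\<Sum>i\<in>UNIV. u x $ i *\<^sub>R axis i 1) = u x" for x
    by (simp add: vec_eq_iff axis_def if_distrib cong: if_cong)
  ultimately show ?thesis by simp
qed

text \<open>Each of X and Y has area at least R^2 / 81, whence the constant 768 * 81^2. In the plane
  all powers of R cancel, so decay of the Dirichlet integral passes directly to the
  averages.\<close>

lemma average_cube_diff:
  assumes s: "sobolev \<Omega> u Du" and \<Omega>: "open \<Omega>" "bounded \<Omega>" and R: "R > 0" "cube c (4 * R) \<subseteq> \<Omega>"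
    and X: "X \<in> sets borel" "X \<subseteq> cube c R" "measure lborel X \<ge> R\<^sup>2 / 81"
    and Y: "Y \<in> sets borel" "Y \<subseteq> cube c R" "measure lborel Y \<ge> R\<^sup>2 / 81"
  shows "(norm (average u X - average u Y))\<^sup>2 \<le> 5038848 * dirichlet Du (cube c R)"
proof -
  note u = sobolev_L1[OF s \<Omega>(2)] sobolev_integrable(2)[OF s]
  have R2: "R\<^sup>2 / 81 > 0" using R(1) by simp
  have fin: "emeasure lborel Z < \<infinity>" if "Z \<subseteq> cube c R" for Z
    using emeasure_mono[OF that, of lborel] emeasure_cube[of R c] R(1) by (simp add: order_le_less_trans)
  define n where "n = (norm (average u X - average u Y))\<^sup>2"
  have n: "n \<ge> 0" by (simp add: n_def)
  have "R\<^sup>2 / 81 * (R\<^sup>2 / 81) * n \<le> measure lborel X * measure lborel Y * n"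
    using X(3) Y(3) R2 n by (intro mult_right_mono mult_mono) auto
  then have "ennreal (R\<^sup>2 / 81 * (R\<^sup>2 / 81) * n) \<le> ennreal (measure lborel X * measure lborel Y * n)"
    by (rule ennreal_leI)
  also have "\<dots> \<le> osc u X Y"
    unfolding n_def by (rule average_diff_le[OF u X(1) fin[OF X(2)] _ Y(1) fin[OF Y(2)]]) (use X Y R2 in linarith)+
  also have "\<dots> \<le> osc u (cube c R) (cube c R)" by (rule osc_mono[OF X(2) Y(2)])
  also have "\<dots> \<le> ennreal (768 * R ^ 4) * energy Du (cube c R)"
    by (rule osc_convex[OF s \<Omega> R convex_cube cube_borel order_refl])
  also have "\<dots> = ennreal (768 * R ^ 4 * dirichlet Du (cube c R))"
    unfolding energy_eq_dirichlet[OF s cube_borel] by (rule ennreal_mult'[symmetric]) simp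
  finally have "R\<^sup>2 / 81 * (R\<^sup>2 / 81) * n \<le> 768 * R ^ 4 * dirichlet Du (cube c R)"
    using dirichlet_nonneg by (subst (asm) ennreal_le_iff) auto
  then have "R ^ 4 * n \<le> R ^ 4 * (5038848 * dirichlet Du (cube c R))"
    by (simp add: power2_eq_square power4_eq_xxxx mult.assoc)
  then show ?thesis
    using R(1) unfolding n_def by (subst (asm) mult_le_cancel_left_pos) auto
qed

section \<open>Geometric convergence of averages over shrinking squares\<close>

lemma geometric_limit:
  fixes a :: "nat \<Rightarrow> 'a::banach"
  assumes l: "0 < l" "l < 1" and C: "C \<ge> 0" and step: "\<And>j. j \<ge> N \<Longrightarrow> norm (a j - a (Suc j)) \<le> C * l ^ j" and j: "j \<ge> N"
  shows "a \<longlonglongrightarrow> lim a" "norm (lim a - a j) \<le> C / (1 - l) * l ^ j"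
proof -
  have part: "norm (a j - a (j + n)) \<le> C / (1 - l) * l ^ j" if "j \<ge> N" for j n
  proof -
    \<comment> \<open>The partial geometric sum is kept in closed form; the weaker bound without the
      factor 1 - l^n would not be inductive.\<close>
    have "norm (a j - a (j + n)) \<le> C / (1 - l) * l ^ j * (1 - l ^ n)"
    proof (induction n)
      case (Suc n)
      have "norm (a j - a (j + Suc n)) \<le> norm (a j - a (j + n)) + norm (a (j + n) - a (Suc (j + n)))"
        using norm_triangle_ineq[of "a j - a (j + n)" "a (j + n) - a (Suc (j + n))"] by simp
      also have "\<dots> \<le> C / (1 - l) * l ^ j * (1 - l ^ n) + C * l ^ (j + n)"
        using Suc step[of "j + n"] that by (intro add_mono) auto
      also have "\<dots> = C / (1 - l) * l ^ j * (1 - l ^ Suc n)"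
        using l by (simp add: field_simps power_add)
      finally show ?case .
    qed simp
    also have "\<dots> \<le> C / (1 - l) * l ^ j * 1"
      using l C by (intro mult_left_mono) auto
    finally show ?thesis by simp
  qed
  have "Cauchy a"
  proof (rule metric_CauchyI)
    fix e :: real assume e: "e > 0"
    have "(\<lambda>j. C / (1 - l) * l ^ j) \<longlonglongrightarrow> C / (1 - l) * 0"
      using l by (intro tendsto_intros LIMSEQ_realpow_zero) auto
    then have "\<forall>\<^sub>F j in sequentially. C / (1 - l) * l ^ j < e / 2"
      using e by (intro order_tendstoD(2)) auto
    then obtain M where M: "\<And>j. j \<ge> M \<Longrightarrow> C / (1 - l) * l ^ j < e / 2"
      unfolding eventually_sequentially by blast
    let ?m = "max M N"
    have near: "dist (a ?m) (a p) < e / 2" if "p \<ge> ?m" for p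
    proof -
      have "norm (a ?m - a (?m + (p - ?m))) \<le> C / (1 - l) * l ^ ?m" by (rule part) simp
      also have "\<dots> < e / 2" by (rule M) simp
      finally show ?thesis using that by (simp add: dist_norm)
    qed
    have "dist (a p) (a p') < e" if "p \<ge> ?m" "p' \<ge> ?m" for p p'
      using dist_triangle_half_r[OF near[OF that(1)] near[OF that(2)]] .
    then show "\<exists>M. \<forall>m\<ge>M. \<forall>n\<ge>M. dist (a m) (a n) < e" by blast
  qed
  then show lim: "a \<longlonglongrightarrow> lim a"
    by (simp add: Cauchy_convergent_iff convergent_LIMSEQ_iff)
  have "(\<lambda>n. norm (a (n + j) - a j)) \<longlonglongrightarrow> norm (lim a - a j)"
    by (intro tendsto_intros LIMSEQ_ignore_initial_segment lim)
  then show "norm (lim a - a j) \<le> C / (1 - l) * l ^ j"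
    by (rule LIMSEQ_le_const2) (use part[OF j] in \<open>auto simp: norm_minus_commute add.commute\<close>)
qed

text \<open>Squares with x as lower left corner are the family used by the differentiation theorem
  below; the ratio 1/3 matches the hole-filling step.\<close>

definition corner_cube :: "nat \<Rightarrow> real^2 \<Rightarrow> (real^2) set" where
  "corner_cube k x = cbox x (x + (1 / 3) ^ k *\<^sub>R One)"

lemma mem_corner_cube:
  "y \<in> corner_cube k x \<longleftrightarrow> (\<forall>i. x $ i \<le> y $ i \<and> y $ i \<le> x $ i + (1 / 3) ^ k)"
proof -
  have "(One :: real^2) $ i = 1" for i
    using inner_sum_left_Basis[of "axis i 1 :: real^2" "\<lambda>_. 1"] by (simp add: inner_axis)
  then show ?thesis unfolding corner_cube_def by (simp add: mem_box_cart)
qed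

lemma corner_cube_borel [measurable, simp]: "corner_cube k x \<in> sets borel"
  by (simp add: corner_cube_def)

lemma measure_corner_cube: "measure lborel (corner_cube k x) = ((1 / 3) ^ k)\<^sup>2"
proof -
  have "measure lborel (corner_cube k x) = (\<Prod>b\<in>(Basis :: (real^2) set). ((x + (1 / 3) ^ k *\<^sub>R One) - x) \<bullet> b)"
    unfolding corner_cube_def by (rule measure_lborel_cbox) (auto simp: inner_add_left)
  also have "\<dots> = (\<Prod>b\<in>(Basis :: (real^2) set). (1 / 3) ^ k)"
    by (rule prod.cong) auto
  finally show ?thesis by (simp add: prod_constant)
qed

text \<open>Lebesgue differentiation along the sides 3^(-k). It identifies the limit of averages as
  a representative of u.\<close>

lemma average_corner_cube_tendsto:
  assumes u: "integrable lborel u"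
  shows "AE x in lebesgue. (\<lambda>k. average u (corner_cube k x)) \<longlonglongrightarrow> u x"
proof -
  have si: "set_integrable lborel (cbox a b) u" for a b
    using integrable_mult_indicator[OF _ u, of "cbox a b"] by (simp add: set_integrable_def)
  have "u integrable_on cbox a b" for a b
    by (rule set_borel_integral_eq_integral(1)[OF si])
  from integrable_ccontinuous_explicit[of u, OF this]
  obtain N where N: "negligible N" and lim: "\<forall>x e. x \<notin> N \<and> 0 < e \<longrightarrow>
      (\<exists>d>0. \<forall>h. 0 < h \<and> h < d \<longrightarrow> norm (integral (cbox x (x + h *\<^sub>R One)) u /\<^sub>R h ^ DIM(real^2) - u x) < e)"
    by (metis (no_types, lifting))
  have eq: "average u (corner_cube k x) = integral (cbox x (x + (1 / 3) ^ k *\<^sub>R One)) u /\<^sub>R ((1 / 3) ^ k) ^ DIM(real^2)" for k x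
  proof -
    have "(LINT y|lborel. indicator (corner_cube k x) y *\<^sub>R u y) = integral (cbox x (x + (1 / 3) ^ k *\<^sub>R One)) u"
      using set_borel_integral_eq_integral(2)[OF si[of x "x + (1 / 3) ^ k *\<^sub>R One"]]
      unfolding set_lebesgue_integral_def corner_cube_def .
    moreover have "DIM(real^2) = 2" by simp
    ultimately show ?thesis
      unfolding average_def measure_corner_cube by (simp only: divide_inverse mult_1)
  qed
  have "(\<lambda>k. average u (corner_cube k x)) \<longlonglongrightarrow> u x" if xN: "x \<notin> N" for x
  proof (rule LIMSEQ_I)
    fix e :: real assume "e > 0"
    then obtain d where d: "d > 0" "\<And>h. 0 < h \<Longrightarrow> h < d \<Longrightarrow>
        norm (integral (cbox x (x + h *\<^sub>R One)) u /\<^sub>R h ^ DIM(real^2) - u x) < e"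
      using lim[rule_format, OF conjI[OF xN]] by blast
    have "(\<lambda>k. (1 / 3 :: real) ^ k) \<longlonglongrightarrow> 0" by (intro LIMSEQ_realpow_zero) auto
    from order_tendstoD(2)[OF this d(1)] obtain M where "\<And>k. k \<ge> M \<Longrightarrow> (1 / 3 :: real) ^ k < d"
      unfolding eventually_sequentially by blast
    then show "\<exists>M. \<forall>k\<ge>M. norm (average u (corner_cube k x) - u x) < e"
      unfolding eq using d(2) by (intro exI[of _ M]) auto
  qed
  moreover have "AE x in lebesgue. x \<notin> N"
    using N unfolding negligible_iff_null_sets by (rule AE_not_in)
  ultimately show ?thesis by (auto elim: eventually_mono)
qed

lemma compact_cubes:
  assumes "compact K" "K \<subseteq> \<Omega>" "open \<Omega>"
  obtains n :: nat where "\<And>x k. x \<in> K \<Longrightarrow> k \<ge> n \<Longrightarrow> cube x (12 * (1 / 3) ^ k) \<subseteq> \<Omega>"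
proof -
  obtain e where e: "e > 0" and sub: "(\<Union>x\<in>K. cball x e) \<subseteq> \<Omega>"
    using compact_subset_open_imp_cball_epsilon_subset[OF assms(1,3,2)] by metis
  have "(\<lambda>k. (1 / 3 :: real) ^ k) \<longlonglongrightarrow> 0" by (intro LIMSEQ_realpow_zero) auto
  \<comment> \<open>12 (e/24) = e/2 bounds each coordinate, and the two coordinates add up to e in
    the l1 norm.\<close>
  from order_tendstoD(2)[OF this, of "e / 24"] e obtain n where n: "\<And>k. k \<ge> n \<Longrightarrow> (1 / 3 :: real) ^ k < e / 24"
    unfolding eventually_sequentially by auto
  show ?thesis
  proof (rule that[of n], rule subsetI)
    fix x y k assume x: "x \<in> K" and k: "k \<ge> n" and y: "y \<in> cube x (12 * (1 / 3) ^ k)"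
    have c: "\<bar>(x - y) $ i\<bar> \<le> e / 2" for i
    proof -
      have "\<bar>y $ i - x $ i\<bar> < 12 * (1 / 3) ^ k" using y by (simp add: cube_def)
      then show ?thesis using n[OF k] by (simp add: abs_minus_commute)
    qed
    have "norm (x - y) \<le> (\<Sum>i\<in>UNIV. \<bar>(x - y) $ i\<bar>)" by (rule norm_le_l1_cart)
    also have "\<dots> \<le> e" using c[of 1] c[of 2] by (simp add: sum_2)
    finally have "y \<in> cball x e" by (simp add: dist_norm)
    then show "y \<in> \<Omega>" using sub x by blast
  qed
qed

text \<open>Iterating the hypothesis gives D(r_k) <= C0 l^(2k) for r_k = 3^(-k). Hence averages over
  comparable squares at level k differ by a multiple of l^k = r_k^\<alpha>, and summing over the
  levels transfers this to their limits.\<close>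

proposition Morrey_Campanato:
  assumes s: "sobolev \<Omega> u Du" and \<Omega>: "open \<Omega>" "bounded \<Omega>"
    and \<alpha>: "0 < \<alpha>" and l: "l = 3 powr (- \<alpha>)"
    and hole: "\<And>c r. r > 0 \<Longrightarrow> cube c (12 * r) \<subseteq> \<Omega> \<Longrightarrow> dirichlet Du (cube c r) \<le> l\<^sup>2 * dirichlet Du (cube c (3 * r))"
    and K: "compact K" "K \<subseteq> \<Omega>"
  shows "\<exists>C. \<forall>x\<in>K. \<forall>y\<in>K. dist (lim (\<lambda>k. average u (corner_cube k x))) (lim (\<lambda>k. average u (corner_cube k y))) \<le> C * dist x y powr \<alpha>"
proof -
  define V where "V k x = average u (corner_cube k x)" for k x
  define v where "v x = lim (\<lambda>k. V k x)" for x
  define r :: "nat \<Rightarrow> real" where "r k = (1 / 3) ^ k" for k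
  define E where "E = dirichlet Du UNIV"
  have l01: "0 < l" "l < 1" using \<alpha> by (auto simp: l powr_less_one)
  have rk: "r k > 0" "r (Suc k) = r k / 3" for k by (auto simp: r_def)
  have lr: "l ^ k = r k powr \<alpha>" for k
  proof -
    have "r k powr \<alpha> = ((1 / 3) powr \<alpha>) ^ k"
      unfolding r_def by (simp add: powr_power[symmetric] powr_realpow[symmetric] powr_powr mult.commute)
    then show ?thesis by (simp add: l powr_minus powr_divide inverse_eq_divide)
  qed
  obtain n where n: "\<And>x k. x \<in> K \<Longrightarrow> k \<ge> n \<Longrightarrow> cube x (12 * r k) \<subseteq> \<Omega>"
    unfolding r_def by (rule compact_cubes[OF K \<Omega>(1)]) blast
  \<comment> \<open>Normalized so that the decay estimate at the starting level n is just
    monotonicity of the Dirichlet integral.\<close>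
  define C0 where "C0 = E / l ^ (2 * n)"
  have E: "E \<ge> 0" unfolding E_def by (rule dirichlet_nonneg)
  have C0: "C0 \<ge> 0" unfolding C0_def using E l01 by simp
  have decay: "dirichlet Du (cube x (r k)) \<le> C0 * l ^ (2 * k)" if x: "x \<in> K" and k: "k \<ge> n" for x k
    using k
  proof (induction k rule: dec_induct)
    case base
    have "dirichlet Du (cube x (r n)) \<le> E" unfolding E_def by (rule dirichlet_mono[OF s]) auto
    then show ?case using l01 by (simp add: C0_def)
  next
    case (step k)
    have "dirichlet Du (cube x (r (Suc k))) \<le> l\<^sup>2 * dirichlet Du (cube x (3 * r (Suc k)))"
      by (rule hole[OF rk(1) n[OF x]]) (use step in simp)
    also have "\<dots> \<le> l\<^sup>2 * (C0 * l ^ (2 * k))"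
      using step.IH by (intro mult_left_mono) (auto simp: rk(2))
    finally show ?case by (simp add: power2_eq_square mult_ac)
  qed
  define C1 where "C1 = sqrt (5038848 * C0)"
  have C1: "C1 \<ge> 0" unfolding C1_def using C0 by simp
  have avd: "norm (average u X - average u Y) \<le> C1 * l ^ k"
    if x: "x \<in> K" and k: "k \<ge> n" and X: "X \<in> sets borel" "X \<subseteq> cube x (r k)" "measure lborel X \<ge> (r k)\<^sup>2 / 81"
      and Y: "Y \<in> sets borel" "Y \<subseteq> cube x (r k)" "measure lborel Y \<ge> (r k)\<^sup>2 / 81" for x k X Y
  proof -
    have "cube x (4 * r k) \<subseteq> cube x (12 * r k)"
      using rk(1)[of k] by (auto simp: cube_def intro: order_less_trans)
    then have sub: "cube x (4 * r k) \<subseteq> \<Omega>" using n[OF x k] by blast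
    have "(norm (average u X - average u Y))\<^sup>2 \<le> 5038848 * dirichlet Du (cube x (r k))"
      by (rule average_cube_diff[OF s \<Omega> rk(1) sub X Y])
    also have "\<dots> \<le> 5038848 * (C0 * l ^ (2 * k))"
      using decay[OF x k] by simp
    also have "\<dots> = (C1 * l ^ k)\<^sup>2"
      unfolding C1_def power_mult_distrib using C0 by (simp add: power_mult[symmetric] mult.commute)
    finally show ?thesis
      by (rule power2_le_imp_le) (use C1 l01 in simp)
  qed
  \<comment> \<open>Squares of level m are compared inside a square one level coarser, k = m - 1.
    This causes the division by l here and the shift \<open>N = Suc n\<close> below.\<close>
  define C2 where "C2 = C1 / l"
  have C2: "C2 \<ge> 0" unfolding C2_def using C1 l01 by simp
  define N where "N = Suc n"
  have Q: "corner_cube j y \<subseteq> cube x (r k)" if "j \<ge> Suc k" "dist x y \<le> r (Suc k)" for j k x y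
  proof
    fix z assume z: "z \<in> corner_cube j y"
    have 1: "r j \<le> r (Suc k)" unfolding r_def using that(1) by (intro power_decreasing) auto
    have "\<bar>z $ i - x $ i\<bar> < r k" for i
    proof -
      have "\<bar>y $ i - x $ i\<bar> \<le> r (Suc k)"
        using that(2) component_le_norm_cart[of "y - x" i] by (simp add: dist_norm norm_minus_commute)
      moreover have "y $ i \<le> z $ i \<and> z $ i \<le> y $ i + r j"
        using z by (simp add: mem_corner_cube r_def)
      ultimately show ?thesis using 1 rk[of k] by linarith
    qed
    then show "z \<in> cube x (r k)" by (simp add: cube_def)
  qed
  \<comment> \<open>Relative to the reference scale r_k the levels k + 1 and k + 2 occur; side
    3^(-k-2) gives exactly the area r_k^2 / 81.\<close>
  have mQ: "measure lborel (corner_cube j x) \<ge> (r k)\<^sup>2 / 81" if "j \<le> k + 2" for j k x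
  proof -
    have "r (k + 2) \<le> r j" unfolding r_def using that by (intro power_decreasing) auto
    then have "(r (k + 2))\<^sup>2 \<le> (r j)\<^sup>2" using rk(1)[of "k + 2"] by (intro power_mono) auto
    moreover have "(r (k + 2))\<^sup>2 = (r k)\<^sup>2 / 81" by (simp add: r_def power_divide power_mult_distrib)
    moreover have "measure lborel (corner_cube j x) = (r j)\<^sup>2" by (simp add: measure_corner_cube r_def)
    ultimately show ?thesis by linarith
  qed
  \<comment> \<open>One estimate with two uses: consecutive levels at the same point, for
    convergence, and equal levels at two nearby points, for the Hoelder bound.\<close>
  have pair: "norm (V i x - V j y) \<le> C2 * l ^ m"
    if x: "x \<in> K" and m: "m \<ge> N" and ij: "m \<le> i" "i \<le> Suc m" "m \<le> j" "j \<le> Suc m" and d: "dist x y \<le> r m" for i j m x y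
  proof -
    obtain k where k: "m = Suc k" "k \<ge> n" using m unfolding N_def by (cases m) auto
    have "norm (V i x - V j y) \<le> C1 * l ^ k"
      unfolding V_def
      by (rule avd[OF x k(2) corner_cube_borel Q mQ corner_cube_borel Q mQ])
        (use ij d k rk(1)[of "Suc k"] in auto)
    then show ?thesis unfolding C2_def k(1) using l01 by simp
  qed
  define A where "A = C2 / (1 - l)"
  have A: "A \<ge> 0" unfolding A_def using C2 l01 by simp
  have vV: "norm (v x - V j x) \<le> A * l ^ j" if "x \<in> K" "j \<ge> N" for x j
    unfolding v_def A_def
    by (rule geometric_limit(2)[OF l01 C2 _ that(2)]) (use pair that(1) rk(1) in \<open>auto simp: less_imp_le\<close>)
  have near: "dist (v x) (v y) \<le> (2 * A + C2) * l ^ j" if "x \<in> K" "y \<in> K" "j \<ge> N" "dist x y \<le> r j" for x y j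
  proof -
    have "dist (v x) (v y) \<le> norm (v x - V j x) + norm (V j x - V j y) + norm (v y - V j y)"
      using norm_triangle_ineq[of "v x - V j x" "V j x - V j y"] norm_triangle_ineq4[of "v x - V j y" "v y - V j y"]
      by (simp add: dist_norm)
    also have "\<dots> \<le> A * l ^ j + C2 * l ^ j + A * l ^ j"
      by (intro add_mono vV pair that) auto
    finally show ?thesis by (simp add: algebra_simps)
  qed
  \<comment> \<open>A uniform bound takes care of pairs farther apart than r_N. It comes from the L1
    norm of u at level N plus the distance to the limit.\<close>
  obtain B where B: "B > 0" "\<And>x. x \<in> K \<Longrightarrow> norm (v x) \<le> B"
  proof -
    define b where "b = 1 / (r N)\<^sup>2 * (LINT x|lborel. norm (u x))"
    have "norm (V N x) \<le> b" for x
    proof -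
      have "norm (LINT y|lborel. indicator (corner_cube N x) y *\<^sub>R u y) \<le> (LINT y|lborel. norm (u y))"
      proof (rule order_trans[OF integral_norm_bound integral_mono])
        show "integrable lborel (\<lambda>y. norm (indicator (corner_cube N x) y *\<^sub>R u y))"
          by (intro integrable_norm integrable_mult_indicator) (use sobolev_L1[OF s \<Omega>(2)] in auto)
        show "integrable lborel (\<lambda>y. norm (u y))" using sobolev_L1[OF s \<Omega>(2)] by auto
      qed (auto simp: indicator_def)
      then show ?thesis
        unfolding V_def average_def b_def measure_corner_cube by (simp add: r_def divide_right_mono)
    qed
    then have "norm (v x) \<le> b + A * l ^ N" if "x \<in> K" for x
      using vV[OF that order_refl] norm_triangle_sub[of "v x" "V N x"] by (meson add_mono order_trans)
    then show ?thesis
      by (intro that[of "max 1 (b + A * l ^ N)"]) (auto simp: le_max_iff_disj)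
  qed
  show ?thesis
  proof (intro exI ballI)
    fix x y assume xy: "x \<in> K" "y \<in> K"
    let ?d = "dist x y"
    define G where "G = (2 * A + C2) / l"
    define F where "F = 2 * B / r N powr \<alpha>"
    have GF: "G \<ge> 0" "F \<ge> 0" unfolding G_def F_def using A C2 B(1) l01 by auto
    have "dist (v x) (v y) \<le> (G + F) * ?d powr \<alpha>"
    proof (cases "?d \<le> r N")
      case True
      show ?thesis
      proof (cases "x = y")
        case False
        then have d: "?d > 0" by simp
        have "(\<lambda>k. (1 / 3 :: real) ^ k) \<longlonglongrightarrow> 0" by (intro LIMSEQ_realpow_zero) auto
        from order_tendstoD(2)[OF this d] have "\<exists>k. r k < ?d"
          unfolding eventually_sequentially r_def by blast
        \<comment> \<open>The first scale below the distance. Since the distance is at most r_N, the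
          preceding scale has index at least N and still dominates the distance, at the cost of one
          factor l.\<close>
        define k where "k = (LEAST k. r k < ?d)"
        have k1: "r k < ?d" unfolding k_def using \<open>\<exists>k. r k < ?d\<close> by (rule LeastI_ex)
        have "k > N"
        proof (rule ccontr)
          assume "\<not> k > N"
          then have "r N \<le> r k" unfolding r_def by (intro power_decreasing) auto
          then show False using k1 True by simp
        qed
        then obtain j where j: "k = Suc j" "j \<ge> N" by (cases k) auto
        have "\<not> r j < ?d" using not_less_Least[of j "\<lambda>k. r k < ?d"] j(1) unfolding k_def by simp
        then have "dist (v x) (v y) \<le> (2 * A + C2) * l ^ j"
          by (intro near xy j(2)) simp
        also have "\<dots> = G * l ^ k" unfolding G_def j(1) using l01 by simp
        also have "\<dots> \<le> G * ?d powr \<alpha>"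
          unfolding lr using k1 rk(1)[of k] \<alpha> GF by (intro mult_left_mono powr_mono2) auto
        also have "\<dots> \<le> (G + F) * ?d powr \<alpha>"
          using GF by (intro mult_right_mono) auto
        finally show ?thesis .
      qed simp
    next
      case False
      have "dist (v x) (v y) \<le> 2 * B"
        using B(2)[OF xy(1)] B(2)[OF xy(2)] norm_triangle_ineq4[of "v x" "v y"] by (simp add: dist_norm)
      also have "\<dots> = F * r N powr \<alpha>" unfolding F_def using rk(1)[of N] by simp
      also have "\<dots> \<le> F * ?d powr \<alpha>"
        using False rk(1)[of N] \<alpha> GF by (intro mult_left_mono powr_mono2) auto
      also have "\<dots> \<le> (G + F) * ?d powr \<alpha>"
        using GF by (intro mult_right_mono) auto
      finally show ?thesis .
    qed
    then show "dist (lim (\<lambda>k. average u (corner_cube k x))) (lim (\<lambda>k. average u (corner_cube k y))) \<le>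
        ((2 * A + C2) / l + 2 * B / r N powr \<alpha>) * dist x y powr \<alpha>"
      by (simp add: v_def V_def G_def F_def)
  qed
qed

text \<open>Continuity at a point follows from the estimate on a closed ball around it that lies in
  \<Omega>.\<close>

lemma holder_loc_I:
  assumes "open \<Omega>" "\<alpha> > 0"
    and H: "\<And>K. compact K \<Longrightarrow> K \<subseteq> \<Omega> \<Longrightarrow> \<exists>C. \<forall>x\<in>K. \<forall>y\<in>K. dist (v x) (v y) \<le> C * dist x y powr \<alpha>"
  shows "holder_loc \<alpha> \<Omega> v"
proof -
  have "isCont v x" if x: "x \<in> \<Omega>" for x
  proof -
    obtain e where e: "e > 0" "cball x e \<subseteq> \<Omega>" using assms(1) x unfolding open_contains_cball by blast
    obtain C where C: "\<And>y z. y \<in> cball x e \<Longrightarrow> z \<in> cball x e \<Longrightarrow> dist (v y) (v z) \<le> C * dist y z powr \<alpha>"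
      using H[OF compact_cball e(2)] by blast
    have "((\<lambda>y. dist y x) \<longlongrightarrow> dist x x) (at x)" by (intro tendsto_intros)
    then have "((\<lambda>y. dist y x powr \<alpha>) \<longlongrightarrow> 0) (at x)"
      using assms(2) by (intro tendsto_zero_powrI[where b = \<alpha>]) auto
    from tendsto_mult_right_zero[OF this, of C]
    have "((\<lambda>y. C * dist y x powr \<alpha>) \<longlongrightarrow> 0) (at x)" .
    moreover have "\<forall>\<^sub>F y in at x. norm (dist (v y) (v x)) \<le> C * dist y x powr \<alpha>"
      unfolding eventually_at
    proof (intro exI[of _ e] conjI ballI impI e(1))
      fix y assume "y \<noteq> x \<and> dist y x < e"
      then have "y \<in> cball x e" "x \<in> cball x e" using e(1) by (auto simp: dist_commute)
      from C[OF this] show "norm (dist (v y) (v x)) \<le> C * dist y x powr \<alpha>"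
        by (simp only: real_norm_def abs_of_nonneg[OF zero_le_dist])
    qed
    ultimately have "((\<lambda>y. dist (v y) (v x)) \<longlongrightarrow> 0) (at x)"
      by (rule Lim_null_comparison[rotated])
    then show ?thesis unfolding isCont_def by (rule tendsto_dist_iff[THEN iffD2])
  qed
  then have "continuous_on \<Omega> v" by (simp add: continuous_at_imp_continuous_on)
  then show ?thesis unfolding holder_loc_def using H by blast
qed

theorem theorem1p1:
  fixes \<gamma> :: real
  assumes "\<gamma> > 0"
  shows "\<exists>\<alpha>. 0 < \<alpha> \<and> \<alpha> < 1 \<and>
    (\<forall>(s0::real) (\<kappa>::real) (\<rho>::real \<Rightarrow> real) (\<Omega>::(real^2) set)
       (u0::real^2 \<Rightarrow> real^2) Du0 (u::real^2 \<Rightarrow> real^2) Du.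
       s0 \<ge> 0 \<and> \<kappa> \<ge> - \<gamma> * s0 \<and>
       smooth_fun \<rho> \<and> convex_on UNIV \<rho> \<and>
       (\<forall>s\<le>0. \<rho> s = 0) \<and> (\<forall>s\<ge>s0. \<rho> s = \<gamma> * s + \<kappa>) \<and>
       open \<Omega> \<and> bounded \<Omega> \<and> lipschitz_boundary \<Omega> \<and>
       W12 \<Omega> u0 Du0 \<and> W12 \<Omega> u Du \<and> same_trace \<Omega> u Du u0 Du0 \<and>
       stationary \<rho> \<Omega> u Du
       \<longrightarrow> (\<exists>v. (AE x in lebesgue. x \<in> \<Omega> \<longrightarrow> v x = u x) \<and> holder_loc \<alpha> \<Omega> v))"
proof -
  obtain \<theta> where \<theta>: "1 / 2 \<le> \<theta>" "\<theta> < 1" and hole: "hole_constant \<gamma> \<theta>"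
    by (rule hole_filling[OF assms])
  \<comment> \<open>The solution of 3^(-2 \<alpha>) = \<theta>, so that l^2 = \<theta>.\<close>
  define \<alpha> where "\<alpha> = - ln \<theta> / (2 * ln 3)"
  define l where "l = 3 powr (- \<alpha>)"
  have "ln \<theta> < 0" using \<theta> by simp
  then have \<alpha>0: "0 < \<alpha>" unfolding \<alpha>_def by (simp add: divide_neg_pos)
  \<comment> \<open>\<theta> >= 1/2 gives - ln \<theta> <= ln 2 < 2 ln 3.\<close>
  have \<alpha>1: "\<alpha> < 1"
  proof -
    have "- ln \<theta> \<le> ln 2" using \<theta> ln_mono[of "1 / 2" \<theta>] by (simp add: ln_div)
    also have "\<dots> < 2 * ln 3" using ln_less_cancel_iff[of 2 "3 :: real"] ln_gt_zero[of "3 :: real"] by linarith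
    finally have "- ln \<theta> / (2 * ln 3) < 2 * ln 3 / (2 * ln (3 :: real))"
      by (intro divide_strict_right_mono) auto
    then show ?thesis unfolding \<alpha>_def by simp
  qed
  have l2: "l\<^sup>2 = \<theta>"
  proof -
    have "l\<^sup>2 = 3 powr (- \<alpha> + - \<alpha>)"
      unfolding l_def power2_eq_square powr_add ..
    also have "\<dots> = exp (ln \<theta>)" unfolding powr_def \<alpha>_def by simp
    finally show ?thesis using \<theta> by simp
  qed
  show ?thesis
  proof (intro exI[of _ \<alpha>] conjI \<alpha>0 \<alpha>1 allI impI, elim conjE)
    fix s0 \<kappa> :: real and \<rho> :: "real \<Rightarrow> real" and \<Omega> :: "(real^2) set" and u0 Du0 and u :: "real^2 \<Rightarrow> real^2" and Du
    assume \<rho>: "smooth_fun \<rho>" "convex_on UNIV \<rho>" "\<forall>s\<le>0. \<rho> s = 0" "\<forall>s\<ge>s0. \<rho> s = \<gamma> * s + \<kappa>"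
      and \<Omega>: "open \<Omega>" "bounded \<Omega>" and u: "W12 \<Omega> u Du" and st: "stationary \<rho> \<Omega> u Du"
    obtain v Dv where s: "sobolev \<Omega> v Dv" and ae: "AE x in lebesgue. x \<in> \<Omega> \<longrightarrow> v x = u x \<and> Dv x = Du x"
      using W12_ex_sobolev[OF \<Omega>(1) u] by blast
    note d = energy_density_deriv[OF \<rho>(1,2) \<rho>(3,4)[rule_format]]
    have dm: "det \<circ> Dv \<in> borel_measurable borel"
      using sobolev_borel(4)[OF s] unfolding comp_def det_2 by measurable
    have q: "(\<lambda>x. deriv \<rho> (det (Dv x))) \<in> borel_measurable borel"
      using measurable_compose[OF dm d(1)] by (simp add: comp_def)
    \<comment> \<open>The coefficient is q = \<rho>'(det Dv); its bounds are those of \<rho>',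
      evaluated at s = det Dv.\<close>
    have hole': "dirichlet Dv (cube c r) \<le> l\<^sup>2 * dirichlet Dv (cube c (3 * r))" if "r > 0" "cube c (12 * r) \<subseteq> \<Omega>" for c r
      unfolding l2
    proof (rule hole[unfolded hole_constant_def, rule_format, where u = v, OF _ conjI[OF that]], intro conjI allI impI)
      show "(LINT x|lborel. frob (Dv x + deriv \<rho> (det (Dv x)) *\<^sub>R cof2 (Dv x)) (Dcut \<zeta> v Dv a x)) = 0"
        if "test_fun \<Omega> \<zeta>" for \<zeta> a
        by (rule stationary_sobolev[OF st \<Omega> s ae d(1) that])
    qed (simp_all add: s \<Omega> q d)
    \<comment> \<open>Hoelder continuous on compact subsets by the decay, and equal to u almost
      everywhere in \<Omega> by Lebesgue differentiation.\<close>
    let ?w = "\<lambda>x. lim (\<lambda>k. average v (corner_cube k x))"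
    have w1: "holder_loc \<alpha> \<Omega> ?w"
      by (rule holder_loc_I[OF \<Omega>(1) \<alpha>0]) (rule Morrey_Campanato[OF s \<Omega> \<alpha>0 l_def hole'])
    have w2: "AE x in lebesgue. x \<in> \<Omega> \<longrightarrow> ?w x = u x"
      using average_corner_cube_tendsto[OF sobolev_L1[OF s \<Omega>(2)]] ae
      by eventually_elim (auto dest: limI)
    show "\<exists>v. (AE x in lebesgue. x \<in> \<Omega> \<longrightarrow> v x = u x) \<and> holder_loc \<alpha> \<Omega> v"
      by (rule exI[of _ ?w], rule conjI[OF w2 w1])
  qed
qed

end
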